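(* Let $\frac{n}{2}+\frac12<\alpha<\frac n2+1$. Then the process $\{\mathbf{W}_\alpha(t,x);t\in\mathbb{R}_+,x\in\mathbf{H}^n\}$ is properly defined by $$\mathbf{W}_\alpha(t,x)=\int_{\mathbb{R}_+\times\mathbf{H}^n}\mathbf{1}_{[0,t]}(r)\,\big(G_\alpha(x,q)-G_\alpha(e,q)\big)\,dW_{\mathbf{H}^n}(r,q),$$ that is, for every $(t,x)\in\mathbb{R}_+\times\mathbf{H}^n$ the integrand $(r,q)\mapsto\mathbf{1}_{[0,t]}(r)(G_\alpha(x,q)-G_\alpha(e,q))$ belongs to $L^2(\mathbb{R}_+\times\mathbf{H}^n;dt\otimes\mu)$, so that the Wiener integral against the white noise $W_{\mathbf{H}^n}$ is well defined.
   Context: Let $n\ge1$. The Heisenberg group $\mathbf{H}^n$ is $\mathbb{R}^n\times\mathbb{R}^n\times\mathbb{R}$ with product $(x,y,z)\star(x',y',z')=(x+x',y+y',z+z'+2\sum_{i=1}^n(x_i'y_i-x_iy_i'))$ and identity $e=(0,0,0)$; $\mu$ is Lebesgue measure on $\mathbb{R}^{2n+1}$. Let $X_i=\partial_{x_i}+2y_i\partial_z$, $Y_i=\partial_{y_i}-2x_i\partial_z$ and $\Delta=\sum_{i=1}^n(X_i^2+Y_i^2)$ (self-adjoint on $L^2(\mathbf{H}^n,\mu)$). For $0<\alpha<n+1$, $G_\alpha(q_1,q_2)=\frac{1}{\Gamma(\alpha)}\int_0^\infty t^{\alpha-1}h_t(q_1^{-1}q_2)\,dt$ is the integral kernel of $(-\Delta)^{-\alpha}$,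 where $h_t(q_1^{-1}q_2)$ is the kernel (w.r.t. $\mu$) of $e^{t\Delta}$. $W_{\mathbf{H}^n}$ is a white noise on $\mathbb{R}_+\times\mathbf{H}^n$, i.e. a centered Gaussian family $\{W_{\mathbf{H}^n}(f);f\in L^2(\mathbb{R}_+\times\mathbf{H}^n;dt\otimes\mu)\}$ with $\mathbf{E}(W_{\mathbf{H}^n}(f)W_{\mathbf{H}^n}(g))=\int_{\mathbb{R}_+\times\mathbf{H}^n}f\,g\,d\mu\,dt$; one writes $W_{\mathbf{H}^n}(f)=\int f\,dW_{\mathbf{H}^n}$. *)

theory Defs
  imports "HOL-Probability.Probability"
begin

text \<open>
  The index type \<open>'n\<close> plays the role of \<open>{1..n}\<close>, so \<open>n = CARD('n) \<ge> 1\<close>. The measure \<open>\<mu>\<close> is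
  \<open>lborel\<close> on the underlying Euclidean space. The library's componentwise structure on
  products gives the vector space operations and the identity \<open>0\<close>, but not the group law.
\<close>

type_synonym 'n heis = "(real ^ 'n) \<times> (real ^ 'n) \<times> real"

fun heis_mult :: "'n::finite heis \<Rightarrow> 'n heis \<Rightarrow> 'n heis"  (infixl "\<star>" 70) where
  "(x, y, z) \<star> (x', y', z') =
     (x + x', y + y', z + z' + 2 * (\<Sum>i\<in>UNIV. x' $ i * y $ i - x $ i * y' $ i))"

fun heis_inv :: "'n::finite heis \<Rightarrow> 'n heis" where
  "heis_inv (x, y, z) = (- x, - y, - z)"

definition heis_e :: "'n::finite heis" where
  "heis_e = (0, 0, 0)"

lemma heis_mult_assoc: "(p \<star> q) \<star> r = p \<star> (q \<star> r)"
  by (cases p; cases q; cases r) (simp add: algebra_simps sum.distrib sum_subtractf)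

lemma heis_mult_e: "heis_e \<star> q = q" "q \<star> heis_e = q"
  by (cases q; simp add: heis_e_def)+

lemma heis_mult_inv: "heis_inv q \<star> q = heis_e" "q \<star> heis_inv q = heis_e"
  by (cases q; simp add: heis_e_def mult.commute)+

section \<open>The sub-Laplacian on test functions\<close>

definition dir_deriv :: "'a::euclidean_space \<Rightarrow> ('a \<Rightarrow> real) \<Rightarrow> 'a \<Rightarrow> real" where
  "dir_deriv v f q = frechet_derivative f (at q) v"

fun Ck :: "nat \<Rightarrow> ('a::euclidean_space \<Rightarrow> real) \<Rightarrow> bool" where
  "Ck 0 f \<longleftrightarrow> continuous_on UNIV f"
| "Ck (Suc k) f \<longleftrightarrow> (\<forall>q. f differentiable (at q)) \<and> (\<forall>v\<in>Basis. Ck k (dir_deriv v f))"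

definition test_function :: "('a::euclidean_space \<Rightarrow> real) \<Rightarrow> bool" where
  "test_function f \<longleftrightarrow> (\<forall>k. Ck k f) \<and> compact (closure {q. f q \<noteq> 0})"

definition X_field :: "'n::finite \<Rightarrow> ('n heis \<Rightarrow> real) \<Rightarrow> 'n heis \<Rightarrow> real" where
  "X_field i f = (\<lambda>(x, y, z). dir_deriv (axis i 1, 0, 0) f (x, y, z)
                             + 2 * y $ i * dir_deriv (0, 0, 1) f (x, y, z))"

definition Y_field :: "'n::finite \<Rightarrow> ('n heis \<Rightarrow> real) \<Rightarrow> 'n heis \<Rightarrow> real" where
  "Y_field i f = (\<lambda>(x, y, z). dir_deriv (0, axis i 1, 0) f (x, y, z)
                             - 2 * x $ i * dir_deriv (0, 0, 1) f (x, y, z))"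

definition sub_laplacian :: "('n::finite heis \<Rightarrow> real) \<Rightarrow> 'n heis \<Rightarrow> real" where
  "sub_laplacian f q = (\<Sum>i\<in>UNIV. X_field i (X_field i f) q + Y_field i (Y_field i f) q)"

section \<open>Operators and semigroups on L2\<close>

text \<open>
  Elements of \<open>L\<^sup>2\<close> are represented by measurable functions; equality of classes is equality
  almost everywhere, and an (unbounded) operator is represented by its graph.
\<close>

definition L2 :: "'a measure \<Rightarrow> ('a \<Rightarrow> real) set" where
  "L2 M = {f. f \<in> borel_measurable M \<and> integrable M (\<lambda>x. (f x)\<^sup>2)}"

definition norm_L2 :: "'a measure \<Rightarrow> ('a \<Rightarrow> real) \<Rightarrow> real" where
  "norm_L2 M f = sqrt (\<integral>x. (f x)\<^sup>2 \<partial>M)"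

definition C0_semigroup_L2 :: "'a measure \<Rightarrow> (real \<Rightarrow> ('a \<Rightarrow> real) \<Rightarrow> 'a \<Rightarrow> real) \<Rightarrow> bool" where
  "C0_semigroup_L2 M T \<longleftrightarrow>
     (\<forall>t\<ge>0. \<forall>f\<in>L2 M. T t f \<in> L2 M)
   \<and> (\<forall>t\<ge>0. \<forall>f\<in>L2 M. \<forall>g\<in>L2 M. \<forall>a b.
        AE q in M. T t (\<lambda>p. a * f p + b * g p) q = a * T t f q + b * T t g q)
   \<and> (\<forall>t\<ge>0. \<exists>C. \<forall>f\<in>L2 M. norm_L2 M (T t f) \<le> C * norm_L2 M f)
   \<and> (\<forall>f\<in>L2 M. AE q in M. T 0 f q = f q)
   \<and> (\<forall>s\<ge>0. \<forall>t\<ge>0. \<forall>f\<in>L2 M. AE q in M. T (s + t) f q = T s (T t f) q)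
   \<and> (\<forall>f\<in>L2 M. ((\<lambda>t. norm_L2 M (\<lambda>q. T t f q - f q)) \<longlongrightarrow> 0) (at_right 0))"

definition generator_L2 ::
  "'a measure \<Rightarrow> (real \<Rightarrow> ('a \<Rightarrow> real) \<Rightarrow> 'a \<Rightarrow> real) \<Rightarrow> (('a \<Rightarrow> real) \<times> ('a \<Rightarrow> real)) set" where
  "generator_L2 M T = {(f, g). f \<in> L2 M \<and> g \<in> L2 M \<and>
     ((\<lambda>t. norm_L2 M (\<lambda>q. (T t f q - f q) / t - g q)) \<longlongrightarrow> 0) (at_right 0)}"

text \<open>
  The sub-Laplacian is essentially self-adjoint on test functions; the self-adjoint operator
  \<open>\<Delta>\<close> on \<open>L\<^sup>2\<close> is its closure.
\<close>

definition sub_laplacian_L2 :: "(('n::finite heis \<Rightarrow> real) \<times> ('n heis \<Rightarrow> real)) set" where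
  "sub_laplacian_L2 = {(f, g). f \<in> L2 lborel \<and> g \<in> L2 lborel \<and>
     (\<exists>\<phi> :: nat \<Rightarrow> 'n heis \<Rightarrow> real. (\<forall>k. test_function (\<phi> k))
        \<and> (\<lambda>k. norm_L2 lborel (\<lambda>q. \<phi> k q - f q)) \<longlonglongrightarrow> 0
        \<and> (\<lambda>k. norm_L2 lborel (\<lambda>q. sub_laplacian (\<phi> k) q - g q)) \<longlonglongrightarrow> 0)}"

text \<open>\<open>T t = e\<^bsup>t\<Delta>\<^esup>\<close>: the strongly continuous semigroup generated by \<open>\<Delta>\<close>.\<close>

definition is_heat_semigroup ::
  "(real \<Rightarrow> ('n::finite heis \<Rightarrow> real) \<Rightarrow> 'n heis \<Rightarrow> real) \<Rightarrow> bool" where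
  "is_heat_semigroup T \<longleftrightarrow>
     C0_semigroup_L2 lborel T \<and> generator_L2 lborel T = sub_laplacian_L2"

text \<open>
  \<open>h t (q\<^sub>1\<^sup>-\<^sup>1 \<star> q\<^sub>2)\<close> is the integral kernel of \<open>e\<^bsup>t\<Delta>\<^esup>\<close>. A kernel is only determined up to null
  sets; as usual the continuous version is taken, which pins down \<open>h t\<close> for all \<open>t > 0\<close>.
\<close>

definition is_heat_kernel :: "(real \<Rightarrow> 'n::finite heis \<Rightarrow> real) \<Rightarrow> bool" where
  "is_heat_kernel h \<longleftrightarrow>
     continuous_on ({0<..} \<times> UNIV) (\<lambda>(t, q). h t q) \<and>
     (\<exists>T. is_heat_semigroup T \<and>
        (\<forall>t>0. \<forall>f\<in>L2 lborel. AE q1 in lborel.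
           integrable lborel (\<lambda>q2. h t (heis_inv q1 \<star> q2) * f q2) \<and>
           T t f q1 = (\<integral>q2. h t (heis_inv q1 \<star> q2) * f q2 \<partial>lborel)))"

definition G_kernel ::
  "(real \<Rightarrow> 'n::finite heis \<Rightarrow> real) \<Rightarrow> real \<Rightarrow> 'n heis \<Rightarrow> 'n heis \<Rightarrow> real" where
  "G_kernel h \<alpha> q1 q2 =
     1 / Gamma \<alpha> * (LBINT t:{0<..}. t powr (\<alpha> - 1) * h t (heis_inv q1 \<star> q2))"

section \<open>White noise and the process\<close>

definition time_heis :: "(real \<times> 'n::finite heis) measure" where
  "time_heis = restrict_space lborel {0..} \<Otimes>\<^sub>M lborel"

text \<open>Degenerate (almost surely zero) variables count as Gaussian.\<close>

definition centered_gaussian :: "'w measure \<Rightarrow> ('w \<Rightarrow> real) \<Rightarrow> bool" where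
  "centered_gaussian M X \<longleftrightarrow> X \<in> borel_measurable M \<and>
     ((AE w in M. X w = 0) \<or>
      (\<exists>\<sigma>>0. distributed M lborel X (\<lambda>x. ennreal (normal_density 0 \<sigma> x))))"

definition centered_gaussian_family ::
  "'w measure \<Rightarrow> 'i set \<Rightarrow> ('i \<Rightarrow> 'w \<Rightarrow> real) \<Rightarrow> bool" where
  "centered_gaussian_family M I X \<longleftrightarrow>
     (\<forall>J a. finite J \<and> J \<subseteq> I \<longrightarrow> centered_gaussian M (\<lambda>w. \<Sum>j\<in>J. a j * X j w))"

definition white_noise ::
  "'w measure \<Rightarrow> ((real \<times> 'n::finite heis \<Rightarrow> real) \<Rightarrow> 'w \<Rightarrow> real) \<Rightarrow> bool" where
  "white_noise M W \<longleftrightarrow> prob_space M \<and>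
     centered_gaussian_family M (L2 time_heis) W \<and>
     (\<forall>f\<in>L2 time_heis. \<forall>g\<in>L2 time_heis.
        (\<integral>w. W f w * W g w \<partial>M) = (\<integral>p. f p * g p \<partial>time_heis))"

definition W_integrand ::
  "(real \<Rightarrow> 'n::finite heis \<Rightarrow> real) \<Rightarrow> real \<Rightarrow> real \<Rightarrow> 'n heis \<Rightarrow> real \<times> 'n heis \<Rightarrow> real" where
  "W_integrand h \<alpha> t x =
     (\<lambda>(r, q). indicator {0..t} r * (G_kernel h \<alpha> x q - G_kernel h \<alpha> heis_e q))"

text \<open>
  The Wiener integral of \<open>f\<close> against \<open>W\<close> is \<open>W f\<close>; it is meaningful only for \<open>f \<in> L2 time_heis\<close>,
  since \<open>white_noise\<close> says nothing about \<open>W\<close> elsewhere.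
\<close>

definition W_process ::
  "((real \<times> 'n::finite heis \<Rightarrow> real) \<Rightarrow> 'w \<Rightarrow> real) \<Rightarrow> (real \<Rightarrow> 'n heis \<Rightarrow> real) \<Rightarrow> real
     \<Rightarrow> real \<Rightarrow> 'n heis \<Rightarrow> 'w \<Rightarrow> real" where
  "W_process W h \<alpha> t x = W (W_integrand h \<alpha> t x)"

end

theory Submission
  imports Defs
begin

text \<open>
  By duality \<open>h t (x\<inverse> \<star> q) - h t q\<close> is the semigroup applied to \<open>\<delta>\<^sub>x - \<delta>\<^sub>e\<close>, so no pointwise
  Gaussian estimates are needed. The semigroup is symmetric, hence \<open>\<parallel>h t\<parallel>\<^sup>2 \<le> h (2 * t) e\<close>; the bound
  \<open>- \<langle>\<Delta> T t f, T t f\<rangle> \<le> \<langle>T t f, f\<rangle> / t\<close> and the fact that horizontal directions generate the group give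
  \<open>\<parallel>h t (x\<inverse> \<star> q) - h t q\<parallel>\<^sup>2 \<le> C * h t e / t\<close>; uniqueness of the semigroup and dilations give
  \<open>h t e = t powr (- (n + 1)) * h 1 e\<close>. Minkowski's inequality for
  \<open>\<integral> t powr (\<alpha> - 1) * (h t (x\<inverse> \<star> q) - h t q) dt\<close> then converges at \<open>t = 0\<close> because
  \<open>\<alpha> > (n + 1) / 2\<close> and at infinity because \<open>\<alpha> < n / 2 + 1\<close>. Statements about \<open>\<delta>\<^sub>x\<close> are obtained from
  bump functions by Fatou's lemma.
\<close>

section \<open>Square-integrable functions\<close>

text \<open>Little is given about \<open>T\<close>: each \<open>T t\<close> is bounded with no
  stated uniformity in t, orbits are right continuous at time 0, and the generator is the closure of
  the sub-Laplacian on test functions. Contraction and symmetry have to be derived. Contraction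
  follows from dissipativity by a continuity argument in time. Symmetry and uniqueness are two uses
  of one telescoping argument, \<open>duality\<close>, for two semigroups with the same generator:
  it is applied to \<open>T\<close> with itself and to \<open>T\<close> with its dilate.

  Where the exponents come from: a dilation by r multiplies volume by r^(2n+2) and time by r^2,
  hence h t e decays like t^-(n+1) and the norm of h t like t^-((n+1)/2). A fixed translation gains
  a further t^-(1/2). Time is cut at 1 because neither bound serves on both sides: for \<alpha> in
  the given range, the exponent \<alpha> - 1 - (n+1)/2 lies above -1, which is integrable only at 0,
  and \<alpha> - 1 - (n+2)/2 lies below -1, which is integrable only at infinity.\<close>

definition ip :: "'a measure \<Rightarrow> ('a \<Rightarrow> real) \<Rightarrow> ('a \<Rightarrow> real) \<Rightarrow> real" where
  "ip M f g = (\<integral>x. f x * g x \<partial>M)"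

lemma L2_measurable: "f \<in> L2 M \<Longrightarrow> f \<in> borel_measurable M"
  and L2_integrable: "f \<in> L2 M \<Longrightarrow> integrable M (\<lambda>x. (f x)\<^sup>2)"
  by (auto simp: L2_def)

lemma L2_integrable_mult:
  assumes f: "f \<in> L2 M" and g: "g \<in> L2 M"
  shows "integrable M (\<lambda>x. f x * g x)"
proof (rule Bochner_Integration.integrable_bound)
  show "integrable M (\<lambda>x. (f x)\<^sup>2 + (g x)\<^sup>2)"
    using f g by (auto simp: L2_def)
  show "(\<lambda>x. f x * g x) \<in> borel_measurable M"
    using f g by (auto simp: L2_def)
  have "\<bar>a * b\<bar> \<le> a\<^sup>2 + b\<^sup>2" for a b :: real
    using sum_squares_bound[of "\<bar>a\<bar>" "\<bar>b\<bar>"] mult_nonneg_nonneg[of "\<bar>a\<bar>" "\<bar>b\<bar>"]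
    unfolding abs_mult by (simp del: mult_nonneg_nonneg)
  then show "AE x in M. norm (f x * g x) \<le> norm ((f x)\<^sup>2 + (g x)\<^sup>2)"
    by simp
qed

lemma L2_cmult: "f \<in> L2 M \<Longrightarrow> (\<lambda>x. c * f x) \<in> L2 M"
  by (auto simp: L2_def power_mult_distrib)

lemma L2_add:
  assumes f: "f \<in> L2 M" and g: "g \<in> L2 M"
  shows "(\<lambda>x. f x + g x) \<in> L2 M"
  using L2_integrable_mult[OF f g] f g by (auto simp: L2_def power2_sum mult.assoc)

lemma L2_lin:
  assumes f: "f \<in> L2 M" and g: "g \<in> L2 M"
  shows "(\<lambda>x. a * f x + b * g x) \<in> L2 M"
  by (intro L2_add L2_cmult f g)

lemma L2_diff:
  assumes f: "f \<in> L2 M" and g: "g \<in> L2 M"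
  shows "(\<lambda>x. f x - g x) \<in> L2 M"
  using L2_lin[OF assms, of 1 "-1"] by simp

lemma L2_cong_AE:
  assumes "AE x in M. f x = g x" "f \<in> L2 M" "g \<in> borel_measurable M"
  shows "g \<in> L2 M"
  using assms by (auto simp: L2_def elim!: integrable_cong_AE_imp)

lemma ip_commute: "ip M f g = ip M g f"
  by (simp add: ip_def mult.commute)

lemma ip_cong_AE:
  assumes "f \<in> L2 M" "f' \<in> L2 M" "g \<in> L2 M" "g' \<in> L2 M"
    and "AE x in M. f x = f' x" "AE x in M. g x = g' x"
  shows "ip M f g = ip M f' g'"
  unfolding ip_def using assms by (intro integral_cong_AE) (auto simp: L2_def)

lemma ip_lin_left:
  assumes "f \<in> L2 M" "g \<in> L2 M" "k \<in> L2 M"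
  shows "ip M (\<lambda>x. a * f x + b * g x) k = a * ip M f k + b * ip M g k"
proof -
  have "ip M (\<lambda>x. a * f x + b * g x) k = (\<integral>x. a * (f x * k x) + b * (g x * k x) \<partial>M)"
    by (simp add: ip_def algebra_simps)
  then show ?thesis
    using L2_integrable_mult[OF assms(1,3)] L2_integrable_mult[OF assms(2,3)]
    by (simp add: ip_def)
qed

lemma ip_lin_right:
  assumes "f \<in> L2 M" "g \<in> L2 M" "k \<in> L2 M"
  shows "ip M k (\<lambda>x. a * f x + b * g x) = a * ip M k f + b * ip M k g"
  using ip_lin_left[OF assms] by (simp add: ip_commute)

lemma ip_diff_left:
  assumes "f \<in> L2 M" "g \<in> L2 M" "k \<in> L2 M"
  shows "ip M (\<lambda>x. f x - g x) k = ip M f k - ip M g k"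
  using ip_lin_left[OF assms, of 1 "-1"] by simp

lemma ip_self_nonneg: "0 \<le> ip M f f"
  by (simp add: ip_def)

lemma norm_L2_power2: "(norm_L2 M f)\<^sup>2 = ip M f f"
  by (simp add: norm_L2_def ip_def power2_eq_square[symmetric])

lemma norm_L2_nonneg: "0 \<le> norm_L2 M f"
  by (simp add: norm_L2_def)

lemma norm_L2_eq_0_iff:
  assumes "f \<in> L2 M"
  shows "norm_L2 M f = 0 \<longleftrightarrow> (AE x in M. f x = 0)"
  using assms by (simp add: norm_L2_def L2_def integral_nonneg_eq_0_iff_AE)

lemma norm_L2_cong_AE:
  assumes "f \<in> borel_measurable M" "g \<in> borel_measurable M" "AE x in M. f x = g x"
  shows "norm_L2 M f = norm_L2 M g"
proof -
  have "(\<integral>x. (f x)\<^sup>2 \<partial>M) = (\<integral>x. (g x)\<^sup>2 \<partial>M)"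
    using assms by (intro integral_cong_AE) auto
  then show ?thesis
    by (simp add: norm_L2_def)
qed

lemma norm_L2_cmult: "norm_L2 M (\<lambda>x. c * f x) = \<bar>c\<bar> * norm_L2 M f"
  by (simp add: norm_L2_def power_mult_distrib real_sqrt_mult)

lemma norm_L2_minus_commute: "norm_L2 M (\<lambda>x. f x - g x) = norm_L2 M (\<lambda>x. g x - f x)"
  by (simp add: norm_L2_def power2_commute)

lemma ip_bound:
  assumes f: "f \<in> L2 M" and g: "g \<in> L2 M"
  shows "\<bar>ip M f g\<bar> \<le> norm_L2 M f * norm_L2 M g"
proof (cases "norm_L2 M g = 0")
  case True
  then have "AE x in M. g x = 0"
    using norm_L2_eq_0_iff[OF g] by simp
  then have "AE x in M. f x * g x = 0"
    by eventually_elim simp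
  then have "ip M f g = 0"
    unfolding ip_def by (rule integral_eq_zero_AE)
  then show ?thesis
    by (simp add: norm_L2_nonneg)
next
  case False
  define C where "C = ip M g g"
  have C: "C > 0"
    using False norm_L2_power2[of M g] ip_self_nonneg[of M g] unfolding C_def
    by (metis less_eq_real_def power_eq_0_iff)
  \<comment> \<open>The minimiser of the quadratic polynomial
    \<open>s \<mapsto> ip M (f + s g) (f + s g)\<close>; its nonnegativity there is the
    Cauchy-Schwarz inequality.\<close>
  define s where "s = - ip M f g / C"
  let ?u = "\<lambda>x. 1 * f x + s * g x"
  have u: "?u \<in> L2 M"
    by (rule L2_lin[OF f g])
  have "0 \<le> ip M ?u ?u"
    by (rule ip_self_nonneg)
  also have "ip M ?u ?u = ip M f f + 2 * s * ip M f g + s\<^sup>2 * C"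
    unfolding ip_lin_left[OF f g u] ip_lin_right[OF f g f] ip_lin_right[OF f g g] C_def
    by (simp add: ip_commute[of M g f] power2_eq_square algebra_simps)
  also have "\<dots> = ip M f f - (ip M f g)\<^sup>2 / C"
    using C by (simp add: s_def power2_eq_square field_simps)
  finally have "(ip M f g)\<^sup>2 \<le> ip M f f * C"
    using C by (simp add: field_simps)
  then have "(ip M f g)\<^sup>2 \<le> (norm_L2 M f * norm_L2 M g)\<^sup>2"
    by (simp add: power_mult_distrib norm_L2_power2 C_def)
  then show ?thesis
    by (rule power2_le_imp_le[of "\<bar>ip M f g\<bar>", simplified]) (simp add: norm_L2_nonneg)
qed

lemma norm_L2_add_power2:
  assumes f: "f \<in> L2 M" and g: "g \<in> L2 M"
  shows "(norm_L2 M (\<lambda>x. f x + g x))\<^sup>2 = (norm_L2 M f)\<^sup>2 + 2 * ip M f g + (norm_L2 M g)\<^sup>2"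
proof -
  have "ip M (\<lambda>x. 1 * f x + 1 * g x) (\<lambda>x. 1 * f x + 1 * g x) = ip M f f + 2 * ip M f g + ip M g g"
    unfolding ip_lin_left[OF f g L2_lin[OF f g]] ip_lin_right[OF f g f] ip_lin_right[OF f g g]
    by (simp add: ip_commute[of M g f])
  then show ?thesis
    by (simp add: norm_L2_power2)
qed

lemma norm_L2_diff_power2:
  assumes f: "f \<in> L2 M" and g: "g \<in> L2 M"
  shows "(norm_L2 M (\<lambda>x. f x - g x))\<^sup>2 = (norm_L2 M f)\<^sup>2 - 2 * ip M f g + (norm_L2 M g)\<^sup>2"
  using norm_L2_add_power2[OF f L2_cmult[OF g, of "-1"]] norm_L2_cmult[of M "-1" g]
    ip_lin_right[OF g g f, of "-1" 0] by simp

lemma norm_L2_add: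
  assumes f: "f \<in> L2 M" and g: "g \<in> L2 M"
  shows "norm_L2 M (\<lambda>x. f x + g x) \<le> norm_L2 M f + norm_L2 M g"
proof (rule power2_le_imp_le)
  show "(norm_L2 M (\<lambda>x. f x + g x))\<^sup>2 \<le> (norm_L2 M f + norm_L2 M g)\<^sup>2"
    using ip_bound[OF f g] norm_L2_add_power2[OF f g] by (simp add: power2_sum)
qed (simp add: norm_L2_nonneg)

lemma norm_L2_diff:
  assumes f: "f \<in> L2 M" and g: "g \<in> L2 M"
  shows "norm_L2 M (\<lambda>x. f x - g x) \<le> norm_L2 M f + norm_L2 M g"
  using norm_L2_add[OF f L2_cmult[OF g, of "-1"]] norm_L2_cmult[of M "-1" g] by simp

lemma norm_L2_triangle:
  assumes f: "f \<in> L2 M" and g: "g \<in> L2 M" and k: "k \<in> L2 M"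
  shows "norm_L2 M (\<lambda>x. f x - g x) \<le> norm_L2 M (\<lambda>x. f x - k x) + norm_L2 M (\<lambda>x. k x - g x)"
  using norm_L2_add[OF L2_diff[OF f k] L2_diff[OF k g]] by simp

lemma norm_L2_le_add_diff:
  assumes f: "f \<in> L2 M" and g: "g \<in> L2 M"
  shows "norm_L2 M f \<le> norm_L2 M g + norm_L2 M (\<lambda>x. f x - g x)"
  using norm_L2_add[OF g L2_diff[OF f g]] by simp

lemma norm_L2_tendsto:
  assumes f: "f \<in> L2 M" and u: "\<And>k. u k \<in> L2 M"
    and lim: "((\<lambda>k. norm_L2 M (\<lambda>x. u k x - f x)) \<longlongrightarrow> 0) F"
  shows "((\<lambda>k. norm_L2 M (u k)) \<longlongrightarrow> norm_L2 M f) F"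
proof (rule Lim_transform2[OF tendsto_const], rule Lim_null_comparison[OF _ lim])
  show "\<forall>\<^sub>F k in F. norm (norm_L2 M f - norm_L2 M (u k)) \<le> norm_L2 M (\<lambda>x. u k x - f x)"
    using norm_L2_le_add_diff[OF f u] norm_L2_le_add_diff[OF u f] norm_L2_minus_commute[of M f]
    by (intro always_eventually) (auto simp: abs_le_iff algebra_simps)
qed

lemma ip_tendsto:
  assumes f: "f \<in> L2 M" and g: "g \<in> L2 M" and u: "\<And>k. u k \<in> L2 M" and v: "\<And>k. v k \<in> L2 M"
    and limu: "((\<lambda>k. norm_L2 M (\<lambda>x. u k x - f x)) \<longlongrightarrow> 0) F"
    and limv: "((\<lambda>k. norm_L2 M (\<lambda>x. v k x - g x)) \<longlongrightarrow> 0) F"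
  shows "((\<lambda>k. ip M (u k) (v k)) \<longlongrightarrow> ip M f g) F"
proof (rule Lim_transform2[OF tendsto_const], rule Lim_null_comparison)
  show "\<forall>\<^sub>F k in F. norm (ip M f g - ip M (u k) (v k))
     \<le> norm_L2 M (\<lambda>x. u k x - f x) * norm_L2 M (v k) + norm_L2 M f * norm_L2 M (\<lambda>x. v k x - g x)"
  proof (intro always_eventually allI)
    fix k
    have "ip M (u k) (v k) - ip M f g
        = ip M (\<lambda>x. u k x - f x) (v k) + ip M f (\<lambda>x. v k x - g x)"
      using ip_diff_left[OF u f v] ip_diff_left[OF v g f] by (simp add: ip_commute)
    then show "norm (ip M f g - ip M (u k) (v k))
       \<le> norm_L2 M (\<lambda>x. u k x - f x) * norm_L2 M (v k) + norm_L2 M f * norm_L2 M (\<lambda>x. v k x - g x)"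
      using ip_bound[OF L2_diff[OF u f] v, of k k] ip_bound[OF f L2_diff[OF v g], of k]
      by (simp add: abs_le_iff)
  qed
  show "((\<lambda>k. norm_L2 M (\<lambda>x. u k x - f x) * norm_L2 M (v k)
      + norm_L2 M f * norm_L2 M (\<lambda>x. v k x - g x)) \<longlongrightarrow> 0) F"
    using tendsto_add[OF tendsto_mult[OF limu norm_L2_tendsto[OF g v limv]]
        tendsto_mult[OF tendsto_const limv]] by simp
qed

section \<open>Symmetric semigroups\<close>

text \<open>
  \<open>lsc\<close> replaces the uniform boundedness principle: it excludes upward jumps of
  \<open>s \<mapsto> \<parallel>T s f\<parallel>\<close> from the left, while strong continuity only controls this function from the right.
\<close>

locale L2_semigroup =
  fixes M :: "'a measure" and T :: "real \<Rightarrow> ('a \<Rightarrow> real) \<Rightarrow> 'a \<Rightarrow> real"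
    and D :: "('a \<Rightarrow> real) set" and A :: "('a \<Rightarrow> real) \<Rightarrow> 'a \<Rightarrow> real"
  assumes C0: "C0_semigroup_L2 M T"
    and D_L2: "f \<in> D \<Longrightarrow> f \<in> L2 M"
    and D_lin: "f \<in> D \<Longrightarrow> g \<in> D \<Longrightarrow> (\<lambda>q. a * f q + b * g q) \<in> D"
    and A_L2: "f \<in> D \<Longrightarrow> A f \<in> L2 M"
    and A_sym: "f \<in> D \<Longrightarrow> g \<in> D \<Longrightarrow> ip M (A f) g = ip M f (A g)"
    and A_nonpos: "f \<in> D \<Longrightarrow> ip M (A f) f \<le> 0"
    and gen: "generator_L2 M T = {(f, g). f \<in> L2 M \<and> g \<in> L2 M \<and>
      (\<exists>\<phi> :: nat \<Rightarrow> 'a \<Rightarrow> real. (\<forall>k. \<phi> k \<in> D)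
        \<and> (\<lambda>k. norm_L2 M (\<lambda>q. \<phi> k q - f q)) \<longlonglongrightarrow> 0
        \<and> (\<lambda>k. norm_L2 M (\<lambda>q. A (\<phi> k) q - g q)) \<longlonglongrightarrow> 0)}"
    and lsc: "f \<in> D \<Longrightarrow> 0 < s \<Longrightarrow> (\<And>r. 0 \<le> r \<Longrightarrow> r < s \<Longrightarrow> norm_L2 M (T r f) \<le> c)
      \<Longrightarrow> norm_L2 M (T s f) \<le> c"
begin

lemma T_L2: "0 \<le> t \<Longrightarrow> f \<in> L2 M \<Longrightarrow> T t f \<in> L2 M"
  and T_lin: "0 \<le> t \<Longrightarrow> f \<in> L2 M \<Longrightarrow> g \<in> L2 M \<Longrightarrow>
    AE q in M. T t (\<lambda>p. a * f p + b * g p) q = a * T t f q + b * T t g q"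
  and T_bdd: "0 \<le> t \<Longrightarrow> \<exists>C. \<forall>f\<in>L2 M. norm_L2 M (T t f) \<le> C * norm_L2 M f"
  and T_0: "f \<in> L2 M \<Longrightarrow> AE q in M. T 0 f q = f q"
  and T_add: "0 \<le> s \<Longrightarrow> 0 \<le> t \<Longrightarrow> f \<in> L2 M \<Longrightarrow> AE q in M. T (s + t) f q = T s (T t f) q"
  using C0 unfolding C0_semigroup_L2_def by simp_all

text \<open>Linearity of \<open>T t\<close> holds only almost everywhere, so boundedness is recast
  once for differences. The constant may depend on \<open>t\<close>; it is made nonnegative so that
  it can multiply further estimates.\<close>

lemma T_bdd_diff:
  assumes "0 \<le> t"
  shows "\<exists>C\<ge>0. \<forall>f\<in>L2 M. \<forall>g\<in>L2 M.
    norm_L2 M (\<lambda>q. T t f q - T t g q) \<le> C * norm_L2 M (\<lambda>q. f q - g q)"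
proof -
  obtain C where C: "\<forall>f\<in>L2 M. norm_L2 M (T t f) \<le> C * norm_L2 M f"
    using T_bdd[OF assms] by blast
  show ?thesis
  proof (intro exI[of _ "max C 0"] conjI ballI)
    fix f g assume f: "f \<in> L2 M" and g: "g \<in> L2 M"
    have "AE q in M. T t (\<lambda>p. f p - g p) q = T t f q - T t g q"
      using T_lin[OF assms f g, of 1 "-1"] by simp
    then have "norm_L2 M (\<lambda>q. T t f q - T t g q) = norm_L2 M (T t (\<lambda>p. f p - g p))"
      by (intro norm_L2_cong_AE L2_measurable T_L2 L2_diff f g assms) auto
    also have "\<dots> \<le> C * norm_L2 M (\<lambda>p. f p - g p)"
      using C L2_diff[OF f g] by blast
    also have "\<dots> \<le> max C 0 * norm_L2 M (\<lambda>p. f p - g p)"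
      by (intro mult_right_mono norm_L2_nonneg) simp
    finally show "norm_L2 M (\<lambda>q. T t f q - T t g q) \<le> max C 0 * norm_L2 M (\<lambda>q. f q - g q)" .
  qed simp
qed

lemma gen_L2: "(f, g) \<in> generator_L2 M T \<Longrightarrow> f \<in> L2 M" "(f, g) \<in> generator_L2 M T \<Longrightarrow> g \<in> L2 M"
  and gen_lim: "(f, g) \<in> generator_L2 M T \<Longrightarrow>
    ((\<lambda>t. norm_L2 M (\<lambda>q. (T t f q - f q) / t - g q)) \<longlongrightarrow> 0) (at_right 0)"
  by (auto simp: generator_L2_def)

lemma D_gen: "f \<in> D \<Longrightarrow> (f, A f) \<in> generator_L2 M T"
  unfolding gen using D_L2 A_L2 by (auto intro!: exI[of _ "\<lambda>_. f"] simp: norm_L2_def)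

lemma L2_quot:
  assumes "0 \<le> t" "f \<in> L2 M" "g \<in> L2 M"
  shows "(\<lambda>q. (T t f q - f q) / t - g q) \<in> L2 M"
  using L2_lin[OF L2_lin[OF T_L2[OF assms(1,2)] assms(2), of "1/t" "-1/t"] assms(3), of 1 "-1"]
  by (simp add: diff_divide_distrib)

text \<open>Up to null sets \<open>T s\<close> commutes with the difference quotients at 0, because
  the time sum factors in both orders; boundedness of \<open>T s\<close> carries the limit
  through.\<close>

lemma gen_T:
  assumes s: "0 \<le> s" and fg: "(f, g) \<in> generator_L2 M T"
  shows "(T s f, T s g) \<in> generator_L2 M T"
proof -
  note f = gen_L2(1)[OF fg] and g = gen_L2(2)[OF fg]
  obtain C where C: "C \<ge> 0" "\<And>f g. f \<in> L2 M \<Longrightarrow> g \<in> L2 M \<Longrightarrow>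
    norm_L2 M (\<lambda>q. T s f q - T s g q) \<le> C * norm_L2 M (\<lambda>q. f q - g q)"
    using T_bdd_diff[OF s] by blast
  have "((\<lambda>t. norm_L2 M (\<lambda>q. (T t (T s f) q - T s f q) / t - T s g q)) \<longlongrightarrow> 0) (at_right 0)"
  proof (rule Lim_null_comparison)
    show "((\<lambda>t. C * norm_L2 M (\<lambda>q. (T t f q - f q) / t - g q)) \<longlongrightarrow> 0) (at_right 0)"
      using tendsto_mult_left[OF gen_lim[OF fg], of C] by simp
    have "norm_L2 M (\<lambda>q. (T t (T s f) q - T s f q) / t - T s g q)
        \<le> C * norm_L2 M (\<lambda>q. (T t f q - f q) / t - g q)" if t: "0 < t" for t
    proof -
      let ?d = "\<lambda>q. (1 / t) * T t f q + (- 1 / t) * f q"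
      have t': "0 \<le> t" using t by simp
      note Tf = T_L2[OF t' f]
      have d: "?d \<in> L2 M"
        by (rule L2_lin[OF Tf f])
      have "AE q in M. (T t (T s f) q - T s f q) / t - T s g q = T s ?d q - T s g q"
        using T_lin[OF s Tf f, of "1/t" "-1/t"] T_add[OF s t' f] T_add[OF t' s f]
        by eventually_elim (simp add: add.commute diff_divide_distrib)
      then have "norm_L2 M (\<lambda>q. (T t (T s f) q - T s f q) / t - T s g q)
          = norm_L2 M (\<lambda>q. T s ?d q - T s g q)"
        by (intro norm_L2_cong_AE L2_measurable L2_quot L2_diff T_L2 s t' f g d)
      also have "\<dots> \<le> C * norm_L2 M (\<lambda>q. ?d q - g q)"
        by (rule C(2)[OF d g])
      finally show ?thesis
        by (simp add: diff_divide_distrib)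
    qed
    then show "\<forall>\<^sub>F t in at_right 0. norm (norm_L2 M (\<lambda>q. (T t (T s f) q - T s f q) / t - T s g q))
        \<le> C * norm_L2 M (\<lambda>q. (T t f q - f q) / t - g q)"
      by (intro eventually_mono[OF eventually_at_right_less[of 0]]) (simp add: norm_L2_nonneg)
  qed
  then show ?thesis
    using T_L2[OF s] f g by (simp add: generator_L2_def)
qed

section \<open>Dissipativity of the generator and contraction\<close>

lemma gen_sym:
  assumes "(f, g) \<in> generator_L2 M T" "(f', g') \<in> generator_L2 M T"
  shows "ip M g f' = ip M f g'"
proof -
  note L = gen_L2[OF assms(1)] gen_L2[OF assms(2)]
  obtain u where u: "\<And>k::nat. u k \<in> D" "(\<lambda>k. norm_L2 M (\<lambda>q. u k q - f q)) \<longlonglongrightarrow> 0"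
      "(\<lambda>k. norm_L2 M (\<lambda>q. A (u k) q - g q)) \<longlonglongrightarrow> 0"
    using assms(1) unfolding gen by blast
  obtain v where v: "\<And>k::nat. v k \<in> D" "(\<lambda>k. norm_L2 M (\<lambda>q. v k q - f' q)) \<longlonglongrightarrow> 0"
      "(\<lambda>k. norm_L2 M (\<lambda>q. A (v k) q - g' q)) \<longlonglongrightarrow> 0"
    using assms(2) unfolding gen by blast
  have "(\<lambda>k. ip M (A (u k)) (v k)) \<longlonglongrightarrow> ip M g f'"
    by (intro ip_tendsto L A_L2 D_L2 u v)
  moreover have "(\<lambda>k. ip M (u k) (A (v k))) \<longlonglongrightarrow> ip M f g'"
    by (intro ip_tendsto L A_L2 D_L2 u v)
  ultimately show ?thesis
    using A_sym[OF u(1) v(1)] LIMSEQ_unique by simp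
qed

lemma gen_nonpos:
  assumes "(f, g) \<in> generator_L2 M T"
  shows "ip M g f \<le> 0"
proof -
  note L = gen_L2[OF assms]
  obtain u where u: "\<And>k::nat. u k \<in> D" "(\<lambda>k. norm_L2 M (\<lambda>q. u k q - f q)) \<longlonglongrightarrow> 0"
      "(\<lambda>k. norm_L2 M (\<lambda>q. A (u k) q - g q)) \<longlonglongrightarrow> 0"
    using assms unfolding gen by blast
  have "(\<lambda>k. ip M (A (u k)) (u k)) \<longlonglongrightarrow> ip M g f"
    by (intro ip_tendsto L A_L2 D_L2 u)
  then show ?thesis
    using A_nonpos[OF u(1)] by (intro LIMSEQ_le_const2) auto
qed

text \<open>Expand \<open>T \<tau> f\<close> as \<open>f\<close> plus \<open>\<tau>\<close> times
  \<open>g + r \<tau>\<close>. The first-order coefficient of the squared norm is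
  \<open>2 * ip M f g\<close>, nonpositive by dissipativity, and the remaining terms are
  o(\<tau>).\<close>

lemma norm_T_right:
  assumes fg: "(f, g) \<in> generator_L2 M T" and \<epsilon>: "0 < \<epsilon>"
  shows "\<forall>\<^sub>F \<tau> in at_right 0. (norm_L2 M (T \<tau> f))\<^sup>2 \<le> (norm_L2 M f)\<^sup>2 + \<epsilon> * \<tau>"
proof -
  note f = gen_L2(1)[OF fg] and g = gen_L2(2)[OF fg]
  define r where "r \<tau> = (\<lambda>q. (T \<tau> f q - f q) / \<tau> - g q)" for \<tau>
  \<comment> \<open>A bound for the increment without its nonpositive term, already divided by
    \<open>\<tau>\<close>.\<close>
  let ?e = "\<lambda>\<tau>. 2 * norm_L2 M (r \<tau>) * norm_L2 M f + \<tau> * (norm_L2 M g + norm_L2 M (r \<tau>))\<^sup>2"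
  have "((\<lambda>\<tau>. norm_L2 M (r \<tau>)) \<longlongrightarrow> 0) (at_right 0)"
    using gen_lim[OF fg] by (simp add: r_def)
  then have "(?e \<longlongrightarrow> 2 * 0 * norm_L2 M f + 0 * (norm_L2 M g + 0)\<^sup>2) (at_right 0)"
    by (intro tendsto_intros)
  then have "\<forall>\<^sub>F \<tau> in at_right 0. ?e \<tau> < \<epsilon>"
    using \<epsilon> by (intro order_tendstoD) auto
  with eventually_at_right_less[of 0] show ?thesis
  proof eventually_elim
    case (elim \<tau>)
    then have \<tau>: "0 \<le> \<tau>" "\<tau> > 0" by auto
    have r: "r \<tau> \<in> L2 M"
      unfolding r_def by (rule L2_quot[OF \<tau>(1) f g])
    let ?w = "\<lambda>q. g q + r \<tau> q"
    have w: "?w \<in> L2 M" by (rule L2_add[OF g r])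
    have "T \<tau> f = (\<lambda>q. f q + \<tau> * ?w q)"
      using \<tau> by (auto simp: r_def)
    then have "(norm_L2 M (T \<tau> f))\<^sup>2 = (norm_L2 M f)\<^sup>2 + 2 * ip M f (\<lambda>q. \<tau> * ?w q) + (norm_L2 M (\<lambda>q. \<tau> * ?w q))\<^sup>2"
      using norm_L2_add_power2[OF f L2_cmult[OF w]] by simp
    also have "ip M f (\<lambda>q. \<tau> * ?w q) = \<tau> * (ip M f g + ip M f (r \<tau>))"
      using ip_lin_right[OF w w f, of \<tau> 0] ip_lin_right[OF g r f, of 1 1] by simp
    also have "(norm_L2 M (\<lambda>q. \<tau> * ?w q))\<^sup>2 = \<tau>\<^sup>2 * (norm_L2 M ?w)\<^sup>2"
      by (simp add: norm_L2_cmult power_mult_distrib)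
    also have "\<dots> \<le> \<tau>\<^sup>2 * (norm_L2 M g + norm_L2 M (r \<tau>))\<^sup>2"
      by (intro mult_left_mono power_mono norm_L2_add g r norm_L2_nonneg) simp
    finally have 1: "(norm_L2 M (T \<tau> f))\<^sup>2 \<le> (norm_L2 M f)\<^sup>2 + 2 * (\<tau> * (ip M f g + ip M f (r \<tau>)))
        + \<tau>\<^sup>2 * (norm_L2 M g + norm_L2 M (r \<tau>))\<^sup>2" by simp
    have "ip M f g + ip M f (r \<tau>) \<le> norm_L2 M (r \<tau>) * norm_L2 M f"
      using gen_nonpos[OF fg] ip_bound[OF f r] by (simp add: ip_commute[of M f g] mult.commute)
    then have "\<tau> * (ip M f g + ip M f (r \<tau>)) \<le> \<tau> * (norm_L2 M (r \<tau>) * norm_L2 M f)"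
      using \<tau> by (intro mult_left_mono) auto
    with 1 have "(norm_L2 M (T \<tau> f))\<^sup>2 \<le> (norm_L2 M f)\<^sup>2 + \<tau> * ?e \<tau>"
      by (simp add: algebra_simps power2_eq_square)
    also have "\<dots> \<le> (norm_L2 M f)\<^sup>2 + \<tau> * \<epsilon>"
      using elim \<tau> by (intro add_left_mono mult_left_mono) auto
    finally show ?case by (simp add: mult.commute)
  qed
qed

text \<open>A first-violation argument. From any point of the orbit the squared norm grows to the
  right at rate at most \<open>\<epsilon>\<close>, by \<open>norm_T_right\<close>, while
  \<open>lsc\<close> carries the bound to a time approached from the left. The slack
  \<open>\<epsilon>\<close> is removed at the end.\<close>

lemma contraction_D:
  assumes f: "f \<in> D" and t: "0 \<le> t"
  shows "norm_L2 M (T t f) \<le> norm_L2 M f"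
proof -
  define \<phi> where "\<phi> s = (norm_L2 M (T s f))\<^sup>2" for s
  note fL = D_L2[OF f]
  have \<phi>0: "\<phi> 0 = (norm_L2 M f)\<^sup>2"
    using norm_L2_cong_AE[OF _ _ T_0[OF fL]] T_L2[OF _ fL, of 0] fL by (simp add: \<phi>_def L2_measurable)
  have bound: "\<phi> s \<le> \<phi> 0 + \<epsilon> * s" if s: "0 \<le> s" and \<epsilon>: "0 < \<epsilon>" for s \<epsilon>
  proof (rule ccontr)
    \<comment> \<open>Times at which the bound with slack fails. At their infimum \<open>S\<close>
      the bound still holds, and it persists on an interval to the right of \<open>S\<close>, which
      contradicts the choice of \<open>S\<close>.\<close>
    define B where "B = {s. 0 \<le> s \<and> \<phi> s > \<phi> 0 + \<epsilon> * s}"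
    assume "\<not> \<phi> s \<le> \<phi> 0 + \<epsilon> * s"
    then have "s \<in> B" using s by (simp add: B_def)
    then have ne: "B \<noteq> {}" by blast
    have bb: "bdd_below B" by (rule bdd_belowI[of _ 0]) (simp add: B_def)
    define S where "S = Inf B"
    have S0: "0 \<le> S" unfolding S_def by (rule cInf_greatest[OF ne]) (simp add: B_def)
    have below: "\<phi> r \<le> \<phi> 0 + \<epsilon> * r" if "0 \<le> r" "r < S" for r
      using that cInf_lower[OF _ bb, of r] unfolding S_def[symmetric] by (force simp: B_def)
    have nn: "0 \<le> \<phi> 0 + \<epsilon> * r" if "0 \<le> r" for r
      using that \<epsilon> by (simp add: \<phi>_def)
    have "\<phi> S \<le> \<phi> 0 + \<epsilon> * S"
    proof (cases "S = 0")
      case False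
      have "norm_L2 M (T S f) \<le> sqrt (\<phi> 0 + \<epsilon> * S)"
      proof (rule lsc[OF f])
        fix r assume r: "0 \<le> r" "r < S"
        have "\<phi> r \<le> \<phi> 0 + \<epsilon> * S"
          using below[OF r] r \<epsilon> by (smt (verit) mult_left_mono)
        then show "norm_L2 M (T r f) \<le> sqrt (\<phi> 0 + \<epsilon> * S)"
          by (intro real_le_rsqrt) (simp add: \<phi>_def)
      qed (use False S0 in auto)
      then have "(norm_L2 M (T S f))\<^sup>2 \<le> (sqrt (\<phi> 0 + \<epsilon> * S))\<^sup>2"
        by (intro power_mono norm_L2_nonneg)
      then show ?thesis using nn[OF S0] by (simp add: \<phi>_def)
    qed simp
    moreover have "\<forall>\<^sub>F \<tau> in at_right 0. \<phi> (S + \<tau>) \<le> \<phi> S + \<epsilon> * \<tau>"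
      using norm_T_right[OF gen_T[OF S0 D_gen[OF f]] \<epsilon>] eventually_at_right_less[of 0]
    proof eventually_elim
      case (elim \<tau>)
      have "norm_L2 M (T (\<tau> + S) f) = norm_L2 M (T \<tau> (T S f))"
        using elim S0 by (intro norm_L2_cong_AE T_add fL L2_measurable T_L2) auto
      then show ?case using elim by (simp add: \<phi>_def add.commute)
    qed
    ultimately have "\<forall>\<^sub>F \<tau> in at_right 0. \<phi> (S + \<tau>) \<le> \<phi> 0 + \<epsilon> * (S + \<tau>)"
      by (auto elim!: eventually_mono simp: algebra_simps)
    then obtain \<delta> where \<delta>: "\<delta> > 0" "\<And>\<tau>. 0 < \<tau> \<Longrightarrow> \<tau> < \<delta> \<Longrightarrow> \<phi> (S + \<tau>) \<le> \<phi> 0 + \<epsilon> * (S + \<tau>)"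
      unfolding eventually_at_right_field by auto
    have "S + \<delta> \<le> S"
      unfolding S_def
    proof (rule cInf_greatest[OF ne], unfold S_def[symmetric])
      fix r assume r: "r \<in> B"
      show "S + \<delta> \<le> r"
      proof (rule ccontr)
        assume n: "\<not> S + \<delta> \<le> r"
        have "S \<le> r" unfolding S_def by (rule cInf_lower[OF r bb])
        then have "\<phi> r \<le> \<phi> 0 + \<epsilon> * r"
          using \<delta>(2)[of "r - S"] n \<open>\<phi> S \<le> _\<close> by (cases "r = S") auto
        with r show False by (simp add: B_def)
      qed
    qed
    with \<delta>(1) show False by simp
  qed
  have "\<phi> t \<le> \<phi> 0"
  proof (rule field_le_epsilon)
    fix e :: real assume e: "0 < e"
    show "\<phi> t \<le> \<phi> 0 + e"
    proof (cases "t = 0")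
      case False
      \<comment> \<open>With slope \<open>e / t\<close> the total slack at time \<open>t\<close> is
        exactly \<open>e\<close>.\<close>
      then show ?thesis using bound[OF t, of "e / t"] t e by simp
    qed (use e in simp)
  qed
  then have "(norm_L2 M (T t f))\<^sup>2 \<le> (norm_L2 M f)\<^sup>2"
    using \<phi>0 by (simp add: \<phi>_def)
  then show ?thesis
    by (rule power2_le_imp_le) (rule norm_L2_nonneg)
qed

text \<open>The norm closure of the core \<open>D\<close>. Contraction extends to it by
  approximation, and it contains domain and range of the generator together with the remainders of
  the difference quotients.\<close>

definition V :: "('a \<Rightarrow> real) set" where
  "V = {f \<in> L2 M. \<forall>\<epsilon>>0. \<exists>d\<in>D. norm_L2 M (\<lambda>q. f q - d q) < \<epsilon>}"

lemma V_L2: "f \<in> V \<Longrightarrow> f \<in> L2 M"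
  by (simp add: V_def)

lemma V_closed:
  assumes f: "f \<in> L2 M" and ex: "\<And>\<epsilon>. 0 < \<epsilon> \<Longrightarrow> \<exists>v\<in>V. norm_L2 M (\<lambda>q. f q - v q) < \<epsilon>"
  shows "f \<in> V"
  unfolding V_def
proof (intro CollectI conjI f allI impI)
  fix \<epsilon> :: real assume "0 < \<epsilon>"
  then have e: "0 < \<epsilon> / 2" by simp
  obtain v where v: "v \<in> V" "norm_L2 M (\<lambda>q. f q - v q) < \<epsilon> / 2"
    using ex[OF e] by blast
  obtain d where d: "d \<in> D" "norm_L2 M (\<lambda>q. v q - d q) < \<epsilon> / 2"
    using v(1) e unfolding V_def by blast
  show "\<exists>d\<in>D. norm_L2 M (\<lambda>q. f q - d q) < \<epsilon>"
    using norm_L2_triangle[OF f D_L2[OF d(1)] V_L2[OF v(1)]] v(2) d by (intro bexI[of _ d]) auto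
qed

lemma V_lin:
  assumes f: "f \<in> V" and g: "g \<in> V"
  shows "(\<lambda>q. a * f q + b * g q) \<in> V"
  unfolding V_def
proof (intro CollectI conjI L2_lin V_L2 f g allI impI)
  fix \<epsilon> :: real assume "0 < \<epsilon>"
  \<comment> \<open>The summand 1 keeps the denominator positive and makes the final estimate
    strict.\<close>
  define e where "e = \<epsilon> / (\<bar>a\<bar> + \<bar>b\<bar> + 1)"
  have e: "0 < e" using \<open>0 < \<epsilon>\<close> by (simp add: e_def)
  obtain d where d: "d \<in> D" "norm_L2 M (\<lambda>q. f q - d q) < e"
    using f e unfolding V_def by blast
  obtain d' where d': "d' \<in> D" "norm_L2 M (\<lambda>q. g q - d' q) < e"
    using g e unfolding V_def by blast
  have "norm_L2 M (\<lambda>q. (a * f q + b * g q) - (a * d q + b * d' q))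
      = norm_L2 M (\<lambda>q. a * (f q - d q) + b * (g q - d' q))"
    by (simp add: algebra_simps)
  also have "\<dots> \<le> \<bar>a\<bar> * norm_L2 M (\<lambda>q. f q - d q) + \<bar>b\<bar> * norm_L2 M (\<lambda>q. g q - d' q)"
    using norm_L2_add[OF L2_cmult[OF L2_diff[OF V_L2[OF f] D_L2[OF d(1)]], of a]
        L2_cmult[OF L2_diff[OF V_L2[OF g] D_L2[OF d'(1)]], of b]] by (simp add: norm_L2_cmult)
  also have "\<dots> \<le> \<bar>a\<bar> * e + \<bar>b\<bar> * e"
    using d d' by (intro add_mono mult_left_mono) auto
  also have "\<dots> < (\<bar>a\<bar> + \<bar>b\<bar> + 1) * e"
    using e by (simp add: algebra_simps)
  also have "\<dots> = \<epsilon>" by (simp add: e_def)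
  finally show "\<exists>d\<in>D. norm_L2 M (\<lambda>q. (a * f q + b * g q) - d q) < \<epsilon>"
    using D_lin[OF d(1) d'(1), of a b] by (intro bexI[of _ "\<lambda>q. a * d q + b * d' q"])
qed

text \<open>Boundedness of \<open>T t\<close> with an unknown \<open>C\<close> is enough to compare
  \<open>T t f\<close> with \<open>T t d\<close> for \<open>d\<close> in \<open>D\<close> close to
  \<open>f\<close>; since the distance is arbitrary, \<open>C\<close> leaves no trace in the
  result.\<close>

lemma contraction_V:
  assumes f: "f \<in> V" and t: "0 \<le> t"
  shows "norm_L2 M (T t f) \<le> norm_L2 M f"
proof (rule field_le_epsilon)
  fix e :: real assume e: "0 < e"
  obtain C where C: "C \<ge> 0" "\<And>f g. f \<in> L2 M \<Longrightarrow> g \<in> L2 M \<Longrightarrow>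
    norm_L2 M (\<lambda>q. T t f q - T t g q) \<le> C * norm_L2 M (\<lambda>q. f q - g q)"
    using T_bdd_diff[OF t] by blast
  \<comment> \<open>The distance to \<open>d\<close> is lost \<open>C\<close> times through
    boundedness and once more when the norm of \<open>d\<close> is replaced by that of
    \<open>f\<close>.\<close>
  define \<delta> where "\<delta> = e / (C + 1)"
  have \<delta>: "\<delta> > 0" using e C by (simp add: \<delta>_def)
  obtain d where d: "d \<in> D" "norm_L2 M (\<lambda>q. f q - d q) < \<delta>"
    using f \<delta> unfolding V_def by blast
  note L = V_L2[OF f] D_L2[OF d(1)]
  have "norm_L2 M (T t f) \<le> norm_L2 M (T t d) + norm_L2 M (\<lambda>q. T t f q - T t d q)"
    by (intro norm_L2_le_add_diff T_L2 t L)
  also have "\<dots> \<le> norm_L2 M d + C * norm_L2 M (\<lambda>q. f q - d q)"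
    by (intro add_mono contraction_D d t C L)
  also have "norm_L2 M d \<le> norm_L2 M f + norm_L2 M (\<lambda>q. f q - d q)"
    using norm_L2_le_add_diff[OF L(2,1)] norm_L2_minus_commute[of M d f] by simp
  finally have "norm_L2 M (T t f) \<le> norm_L2 M f + (C + 1) * norm_L2 M (\<lambda>q. f q - d q)"
    by (simp add: algebra_simps)
  also have "\<dots> \<le> norm_L2 M f + (C + 1) * \<delta>"
    using C d by (intro add_left_mono mult_left_mono) auto
  also have "(C + 1) * \<delta> = e" using C by (simp add: \<delta>_def)
  finally show "norm_L2 M (T t f) \<le> norm_L2 M f + e" .
qed

lemma gen_V1: "(f, g) \<in> generator_L2 M T \<Longrightarrow> f \<in> V"
proof -
  assume fg: "(f, g) \<in> generator_L2 M T"
  obtain u where u: "\<And>k::nat. u k \<in> D" "(\<lambda>k. norm_L2 M (\<lambda>q. u k q - f q)) \<longlonglongrightarrow> 0"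
      "(\<lambda>k. norm_L2 M (\<lambda>q. A (u k) q - g q)) \<longlonglongrightarrow> 0"
    using fg unfolding gen by blast
  show ?thesis
    unfolding V_def
  proof (intro CollectI conjI gen_L2(1)[OF fg] allI impI)
    fix e :: real assume "0 < e"
    then have "\<forall>\<^sub>F k in sequentially. norm_L2 M (\<lambda>q. u k q - f q) < e"
      using u(2) by (intro order_tendstoD) auto
    then obtain k where "norm_L2 M (\<lambda>q. u k q - f q) < e"
      using eventually_happens'[OF sequentially_bot] by blast
    then show "\<exists>d\<in>D. norm_L2 M (\<lambda>q. f q - d q) < e"
      using u(1)[of k] norm_L2_minus_commute[of M f "u k"] by (intro bexI[of _ "u k"]) auto
  qed
qed

text \<open>\<open>g\<close> is a limit of difference quotients, and both of their terms lie in
  \<open>V\<close> because \<open>T t\<close> preserves the domain of the generator.\<close>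

lemma gen_V2:
  assumes fg: "(f, g) \<in> generator_L2 M T"
  shows "g \<in> V"
proof (rule V_closed[OF gen_L2(2)[OF fg]])
  fix e :: real assume "0 < e"
  then have "\<forall>\<^sub>F t in at_right 0. norm_L2 M (\<lambda>q. (T t f q - f q) / t - g q) < e"
    using gen_lim[OF fg] by (intro order_tendstoD) auto
  with eventually_at_right_less[of 0]
  have "\<forall>\<^sub>F t in at_right 0. 0 < t \<and> norm_L2 M (\<lambda>q. (T t f q - f q) / t - g q) < e"
    by eventually_elim simp
  then obtain t where t: "0 < t" "norm_L2 M (\<lambda>q. (T t f q - f q) / t - g q) < e"
    using eventually_happens'[OF trivial_limit_at_right_real] by blast
  let ?v = "\<lambda>q. (T t f q - f q) / t"
  have "(\<lambda>q. (1/t) * T t f q + (-1/t) * f q) \<in> V"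
    using t gen_V1[OF gen_T[OF _ fg]] by (intro V_lin gen_V1[OF fg]) auto
  then have "?v \<in> V" by (simp add: diff_divide_distrib)
  with t(2) show "\<exists>v\<in>V. norm_L2 M (\<lambda>q. g q - v q) < e"
    using norm_L2_minus_commute[of M g ?v] by (intro bexI[of _ ?v]) auto
qed

text \<open>The remainder \<open>r\<close> is formed at time 0 and does not depend on
  \<open>s\<close>. Membership in \<open>V\<close> lets contraction bound \<open>T s r\<close>
  uniformly in \<open>s\<close>, as a sum over many time steps requires.\<close>

lemma T_step:
  assumes fg: "(f, g) \<in> generator_L2 M T" and s: "0 \<le> s" and \<tau>: "0 < \<tau>"
  defines "r \<equiv> \<lambda>q. (T \<tau> f q - f q) / \<tau> - g q"
  shows "r \<in> V" "AE q in M. T (s + \<tau>) f q = T s f q + \<tau> * (T s g q + T s r q)"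
proof -
  note f = gen_L2(1)[OF fg] and g = gen_L2(2)[OF fg]
  have "(\<lambda>q. 1 * ((1/\<tau>) * T \<tau> f q + (-1/\<tau>) * f q) + (-1) * g q) \<in> V"
    using \<tau> gen_V1[OF gen_T[OF _ fg]] by (intro V_lin gen_V1[OF fg] gen_V2[OF fg]) auto
  then show r: "r \<in> V"
    by (simp add: r_def diff_divide_distrib)
  note rL = V_L2[OF r]
  let ?w = "\<lambda>q. 1 * g q + 1 * r q"
  have w: "?w \<in> L2 M" by (rule L2_lin[OF g rL])
  have eq: "T \<tau> f = (\<lambda>q. 1 * f q + \<tau> * ?w q)"
    using \<tau> by (auto simp: r_def)
  have "AE q in M. T s (T \<tau> f) q = 1 * T s f q + \<tau> * T s ?w q"
    using T_lin[OF s f w, of 1 \<tau>] unfolding eq .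
  moreover have "AE q in M. T (s + \<tau>) f q = T s (T \<tau> f) q"
    using \<tau> by (intro T_add s f) simp
  ultimately show "AE q in M. T (s + \<tau>) f q = T s f q + \<tau> * (T s g q + T s r q)"
    using T_lin[OF s g rL, of 1 1] by eventually_elim simp
qed

text \<open>Consider \<open>ip M (T a f) (S b g)\<close> with a + b = t. Moving a step
  \<open>\<tau>\<close> from one semigroup to the other cancels the first-order terms, by symmetry
  of the common generator, and costs \<open>\<tau> * e \<tau>\<close>; all steps together cost
  \<open>t * e \<tau>\<close>, which tends to 0. The case \<open>S = T\<close> is symmetry; a
  different \<open>S\<close> yields uniqueness.\<close>

lemma duality:
  assumes S: "L2_semigroup M S D A"
    and fg: "(f, f') \<in> generator_L2 M T" and gg: "(g, g') \<in> generator_L2 M T" and t: "0 \<le> t"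
  shows "ip M (T t f) g = ip M f (S t g)"
proof (cases "t = 0")
  interpret S: L2_semigroup M S D A by (rule S)
  case True
  note f = gen_L2(1)[OF fg] and g = gen_L2(1)[OF gg]
  have "ip M (T 0 f) g = ip M f g" "ip M f (S 0 g) = ip M f g"
    using T_L2[OF order_refl f] S.T_L2[OF order_refl g]
    by (auto intro: ip_cong_AE[OF _ f g g T_0[OF f]] ip_cong_AE[OF f f _ g _ S.T_0[OF g]])
  with True show ?thesis by simp
next
  interpret S: L2_semigroup M S D A by (rule S)
  case False
  then have t: "0 < t" using t by simp
  have ST: "generator_L2 M S = generator_L2 M T"
    by (simp only: gen S.gen)
  note gS = gg[folded ST]
  note L = gen_L2[OF fg] gen_L2[OF gg]
  define r where "r \<tau> = (\<lambda>q. (T \<tau> f q - f q) / \<tau> - f' q)" for \<tau>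
  define r' where "r' \<tau> = (\<lambda>q. (S \<tau> g q - g q) / \<tau> - g' q)" for \<tau>
  define e where "e \<tau> = norm_L2 M (r \<tau>) * norm_L2 M g + norm_L2 M f * norm_L2 M (r' \<tau>)" for \<tau>
  have lim: "(e \<longlongrightarrow> 0) (at_right 0)"
    using tendsto_add[OF tendsto_mult_left_zero[OF gen_lim[OF fg]] tendsto_mult_right_zero[OF S.gen_lim[OF gS]]]
    by (simp add: e_def[abs_def] r_def r'_def)
  have step: "\<bar>ip M (T (a + \<tau>) f) (S b g) - ip M (T a f) (S (b + \<tau>) g)\<bar> \<le> \<tau> * e \<tau>"
    if a: "0 \<le> a" and b: "0 \<le> b" and \<tau>: "0 < \<tau>" for a b \<tau>
  proof -
    note r = T_step[OF fg a \<tau>, folded r_def] and r' = S.T_step[OF gS b \<tau>, folded r'_def]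
    have rL: "r \<tau> \<in> L2 M" "r' \<tau> \<in> L2 M" using r(1) r'(1) V_L2 S.V_L2 by auto
    have Ta: "T a f \<in> L2 M" "T a f' \<in> L2 M" "T a (r \<tau>) \<in> L2 M" "T (a + \<tau>) f \<in> L2 M"
      using a \<tau> L rL by (auto intro!: T_L2)
    have Sb: "S b g \<in> L2 M" "S b g' \<in> L2 M" "S b (r' \<tau>) \<in> L2 M" "S (b + \<tau>) g \<in> L2 M"
      using b \<tau> L rL by (auto intro!: S.T_L2)
    note w1 = L2_lin[OF Ta(2,3), of 1 1] and w2 = L2_lin[OF Sb(2,3), of 1 1]
    have "ip M (T (a + \<tau>) f) (S b g)
       = ip M (\<lambda>q. 1 * T a f q + \<tau> * (1 * T a f' q + 1 * T a (r \<tau>) q)) (S b g)"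
      using r(2) by (intro ip_cong_AE L2_lin Ta Sb) auto
    also have "\<dots> = ip M (T a f) (S b g) + \<tau> * (ip M (T a f') (S b g) + ip M (T a (r \<tau>)) (S b g))"
      unfolding ip_lin_left[OF Ta(1) w1 Sb(1)] ip_lin_left[OF Ta(2,3) Sb(1)] by simp
    finally have 1: "ip M (T (a + \<tau>) f) (S b g)
      = ip M (T a f) (S b g) + \<tau> * (ip M (T a f') (S b g) + ip M (T a (r \<tau>)) (S b g))" .
    have "ip M (T a f) (S (b + \<tau>) g)
       = ip M (T a f) (\<lambda>q. 1 * S b g q + \<tau> * (1 * S b g' q + 1 * S b (r' \<tau>) q))"
      using r'(2) by (intro ip_cong_AE L2_lin Ta Sb) auto
    also have "\<dots> = ip M (T a f) (S b g) + \<tau> * (ip M (T a f) (S b g') + ip M (T a f) (S b (r' \<tau>)))"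
      unfolding ip_lin_right[OF Sb(1) w2 Ta(1)] ip_lin_right[OF Sb(2,3) Ta(1)] by simp
    finally have 2: "ip M (T a f) (S (b + \<tau>) g)
      = ip M (T a f) (S b g) + \<tau> * (ip M (T a f) (S b g') + ip M (T a f) (S b (r' \<tau>)))" .
    \<comment> \<open>The cancellation of first-order terms: \<open>T a f\<close> and
      \<open>S b g\<close> both stay in the domain of the common symmetric generator.\<close>
    have 3: "ip M (T a f') (S b g) = ip M (T a f) (S b g')"
      using gen_sym[OF gen_T[OF a fg] S.gen_T[OF b gS, unfolded ST]] .
    have "\<bar>ip M (T a (r \<tau>)) (S b g)\<bar> \<le> norm_L2 M (r \<tau>) * norm_L2 M g"
      by (rule order_trans[OF ip_bound[OF Ta(3) Sb(1)]])
        (intro mult_mono contraction_V[OF r(1) a] S.contraction_V[OF S.gen_V1[OF gS] b] norm_L2_nonneg)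
    moreover have "\<bar>ip M (T a f) (S b (r' \<tau>))\<bar> \<le> norm_L2 M f * norm_L2 M (r' \<tau>)"
      by (rule order_trans[OF ip_bound[OF Ta(1) Sb(3)]])
        (intro mult_mono contraction_V[OF gen_V1[OF fg] a] S.contraction_V[OF r'(1) b] norm_L2_nonneg)
    ultimately have "\<bar>ip M (T a (r \<tau>)) (S b g) - ip M (T a f) (S b (r' \<tau>))\<bar> \<le> e \<tau>"
      unfolding e_def by linarith
    then have "\<tau> * \<bar>ip M (T a (r \<tau>)) (S b g) - ip M (T a f) (S b (r' \<tau>))\<bar> \<le> \<tau> * e \<tau>"
      using \<tau> by (intro mult_left_mono) auto
    moreover have "ip M (T (a + \<tau>) f) (S b g) - ip M (T a f) (S (b + \<tau>) g)
      = \<tau> * (ip M (T a (r \<tau>)) (S b g) - ip M (T a f) (S b (r' \<tau>)))"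
      unfolding 1 2 3 by (simp add: algebra_simps)
    ultimately show ?thesis
      using \<tau> by (simp add: abs_mult)
  qed
  \<comment> \<open>\<open>i\<close> is kept arbitrary because each step taken from \<open>T\<close>
    is added to the time of \<open>S\<close>.\<close>
  have telescope: "\<bar>ip M (T (real j * \<tau>) f) (S (real i * \<tau>) g) - ip M (T 0 f) (S (real (i + j) * \<tau>) g)\<bar>
      \<le> real j * (\<tau> * e \<tau>)" if \<tau>: "0 < \<tau>" for i j \<tau>
  proof (induction j arbitrary: i)
    case (Suc j)
    have "\<bar>ip M (T (real j * \<tau> + \<tau>) f) (S (real i * \<tau>) g)
        - ip M (T (real j * \<tau>) f) (S (real i * \<tau> + \<tau>) g)\<bar> \<le> \<tau> * e \<tau>"
      using \<tau> by (intro step) auto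
    moreover have "real j * \<tau> + \<tau> = real (Suc j) * \<tau>" "real i * \<tau> + \<tau> = real (Suc i) * \<tau>"
      by (auto simp: algebra_simps)
    ultimately show ?case
      using Suc[of "Suc i"] by (simp add: algebra_simps)
  qed simp
  have main: "\<bar>ip M (T t f) (S 0 g) - ip M (T 0 f) (S t g)\<bar> \<le> t * e (t / real (Suc N))" for N
    using telescope[of "t / real (Suc N)" "Suc N" 0] t by simp
  have "(\<lambda>N. t / real (Suc N)) \<longlonglongrightarrow> 0"
    using tendsto_mult_left[OF LIMSEQ_inverse_real_of_nat, of t] by (simp add: divide_inverse)
  then have "filterlim (\<lambda>N. t / real (Suc N)) (at_right 0) sequentially"
    using t by (auto simp: filterlim_at)
  then have "(\<lambda>N. t * e (t / real (Suc N))) \<longlonglongrightarrow> t * 0"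
    by (intro tendsto_mult_left filterlim_compose[OF lim])
  then have "\<bar>ip M (T t f) (S 0 g) - ip M (T 0 f) (S t g)\<bar> \<le> t * 0"
    by (rule LIMSEQ_le_const) (use main in auto)
  moreover have "ip M (T t f) (S 0 g) = ip M (T t f) g" "ip M (T 0 f) (S t g) = ip M f (S t g)"
    by (rule ip_cong_AE; use t L T_0[OF L(1)] S.T_0[OF L(3)] in \<open>simp add: T_L2 S.T_L2\<close>)+
  ultimately show ?thesis by simp
qed

lemma symmetric:
  assumes "(f, f') \<in> generator_L2 M T" "(g, g') \<in> generator_L2 M T" "0 \<le> t"
  shows "ip M (T t f) g = ip M f (T t g)"
  using duality[OF L2_semigroup_axioms assms] .

lemma ip_T_add:
  assumes fg: "(f, f') \<in> generator_L2 M T" and a: "0 \<le> a" and b: "0 \<le> b"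
  shows "ip M (T (a + b) f) f = ip M (T a f) (T b f)"
proof -
  note f = gen_L2(1)[OF fg]
  have "ip M (T (a + b) f) f = ip M (T a (T b f)) f"
    using a b by (intro ip_cong_AE[OF _ _ f f T_add[OF a b f]] T_L2 f AE_I2 refl) simp_all
  also have "\<dots> = ip M (T b f) (T a f)"
    by (rule symmetric[OF gen_T[OF b fg] fg a])
  also have "\<dots> = ip M (T a f) (T b f)"
    by (rule ip_commute)
  finally show ?thesis .
qed

text \<open>The function \<open>c a = \<langle>T a f, f\<rangle>\<close> is midpoint convex, so its slope at \<open>2 * t\<close> is controlled
  by its increment over the interval from \<open>t\<close> to \<open>2 * t\<close>.\<close>

lemma energy_bound:
  assumes fg: "(f, f') \<in> generator_L2 M T" and t: "0 < t"
    and w: "(T t f, w) \<in> generator_L2 M T"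
  shows "- ip M w (T t f) \<le> ip M (T t f) f / t"
proof -
  note f = gen_L2(1)[OF fg]
  define c where "c a = ip M (T a f) f" for a
  \<comment> \<open>By \<open>ip_T_add\<close> the three values of \<open>c\<close> are inner
    products of \<open>T (a/2) f\<close> and \<open>T (b/2) f\<close>, so midpoint convexity is the
    nonnegativity of the squared norm of their difference.\<close>
  have conv: "2 * c ((a + b) / 2) \<le> c a + c b" if a: "0 \<le> a" and b: "0 \<le> b" for a b
  proof -
    have L: "T (a/2) f \<in> L2 M" "T (b/2) f \<in> L2 M" using a b f by (auto intro!: T_L2)
    have eq: "c a = ip M (T (a/2) f) (T (a/2) f)" "c b = ip M (T (b/2) f) (T (b/2) f)"
      "c ((a + b) / 2) = ip M (T (a/2) f) (T (b/2) f)"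
      using ip_T_add[OF fg, of "a/2" "a/2"] ip_T_add[OF fg, of "b/2" "b/2"]
        ip_T_add[OF fg, of "a/2" "b/2"] a b by (auto simp: c_def add_divide_distrib)
    have "0 \<le> (norm_L2 M (\<lambda>q. T (a/2) f q - T (b/2) f q))\<^sup>2" by simp
    also have "\<dots> = c a - 2 * c ((a + b) / 2) + c b"
      unfolding norm_L2_diff_power2[OF L] eq by (simp add: norm_L2_power2)
    finally show ?thesis by simp
  qed
  have step: "(c (2 * t) - c (2 * t + \<tau>)) / \<tau> \<le> c t / t" if N: "N > 0" and \<tau>: "\<tau> = t / real N" for N \<tau>
  proof -
    have \<tau>0: "\<tau> > 0" using t N by (simp add: \<tau>)
    \<comment> \<open>Samples of \<open>c\<close> running backwards: \<open>b 0\<close> and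
      \<open>b 1\<close> give the slope at \<open>2 * t\<close>, and \<open>b (Suc N)\<close> is
      \<open>c t\<close> since \<open>N\<close> steps make up \<open>t\<close>. Convexity makes the
      first increment the smallest, so \<open>N\<close> times it is at most the increment from
      \<open>b 1\<close> to \<open>b (Suc N)\<close>.\<close>
    define b where "b j = c (2 * t + \<tau> - real j * \<tau>)" for j
    have bconv: "b (Suc j) - b j \<le> b (Suc (Suc j)) - b (Suc j)" if "j < N" for j
    proof -
      have "real (Suc (Suc j)) * \<tau> \<le> real (Suc N) * \<tau>"
        using that \<tau>0 by (intro mult_right_mono) auto
      also have "\<dots> = t + \<tau>" using N by (simp add: \<tau> field_simps)
      finally have le: "real (Suc (Suc j)) * \<tau> \<le> 2 * t + \<tau>" using t by simp
      have "2 * c (((2 * t + \<tau> - real j * \<tau>) + (2 * t + \<tau> - real (Suc (Suc j)) * \<tau>)) / 2) \<le> b j + b (Suc (Suc j))"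
        unfolding b_def using le \<tau>0 by (intro conv) (auto simp: algebra_simps)
      also have "((2 * t + \<tau> - real j * \<tau>) + (2 * t + \<tau> - real (Suc (Suc j)) * \<tau>)) / 2 = 2 * t + \<tau> - real (Suc j) * \<tau>"
        by (simp add: field_simps)
      finally show ?thesis by (simp add: b_def)
    qed
    have mono: "b 1 - b 0 \<le> b (Suc j) - b j" if "j \<le> N" for j
      using that
    proof (induction j)
      case (Suc j)
      then show ?case using bconv[of j] by simp
    qed simp
    have "real j * (b 1 - b 0) \<le> b (Suc j) - b 1" if "j \<le> N" for j
      using that
    proof (induction j)
      case (Suc j)
      then show ?case using mono[of "Suc j"] by (simp add: algebra_simps)
    qed simp
    from this[of N] have "real N * (b 1 - b 0) \<le> b (Suc N) - b 1" by simp
    also have "b (Suc N) = c t" using N by (simp add: b_def \<tau> field_simps)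
    finally have "real N * (c (2 * t) - c (2 * t + \<tau>)) \<le> c t - c (2 * t)" by (simp add: b_def)
    moreover have "c (2 * t) \<ge> 0"
      using ip_T_add[OF fg, of t t] t ip_self_nonneg[of M "T t f"] by (simp add: c_def)
    ultimately have "real N * (c (2 * t) - c (2 * t + \<tau>)) \<le> c t" by simp
    then have "real N * (c (2 * t) - c (2 * t + \<tau>)) / t \<le> c t / t"
      using t by (intro divide_right_mono) auto
    then show ?thesis using N by (simp add: \<tau> mult.commute)
  qed
  define v where "v = T t f"
  have v: "(v, T t f') \<in> generator_L2 M T" unfolding v_def using gen_T[OF _ fg] t by simp
  have vL: "v \<in> L2 M" "w \<in> L2 M" using gen_L2[OF w] by (auto simp: v_def)
  \<comment> \<open>Pairing the difference quotient at \<open>v = T t f\<close> with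
    \<open>v\<close> gives the slope of \<open>c\<close> at \<open>2 * t\<close>, since
    \<open>ip M (T \<tau> v) v\<close> is \<open>c (2 * t + \<tau>)\<close>.\<close>
  have diffq: "ip M (\<lambda>q. (T \<tau> v q - v q) / \<tau>) v = (c (2 * t + \<tau>) - c (2 * t)) / \<tau>" if "0 < \<tau>" for \<tau>
  proof -
    have Tv: "T \<tau> v \<in> L2 M" using that vL by (intro T_L2) auto
    have "ip M (T \<tau> v) v = ip M (T (\<tau> + t) f) v"
    proof (intro ip_cong_AE Tv vL(1))
      show "T (\<tau> + t) f \<in> L2 M" using that t by (intro T_L2 f) auto
      have "AE q in M. T (\<tau> + t) f q = T \<tau> v q"
        unfolding v_def using that t by (intro T_add f) auto
      then show "AE q in M. T \<tau> v q = T (\<tau> + t) f q"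
        by eventually_elim (rule sym)
    qed simp
    also have "\<dots> = c (2 * t + \<tau>)"
      using ip_T_add[OF fg, of "\<tau> + t" t] that t by (simp add: v_def c_def algebra_simps)
    finally have 1: "ip M (T \<tau> v) v = c (2 * t + \<tau>)" .
    have 2: "ip M v v = c (2 * t)"
      using ip_T_add[OF fg, of t t] t by (simp add: v_def c_def)
    show ?thesis
      using ip_lin_left[OF Tv vL(1) vL(1), of "1/\<tau>" "-1/\<tau>"] 1 2 by (simp add: diff_divide_distrib)
  qed
  have lim: "(\<lambda>N. t / real (Suc N)) \<longlonglongrightarrow> 0"
    using tendsto_mult_left[OF LIMSEQ_inverse_real_of_nat, of t] by (simp add: divide_inverse)
  then have lim: "filterlim (\<lambda>N. t / real (Suc N)) (at_right 0) sequentially"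
    using t by (auto simp: filterlim_at)
  have "(\<lambda>N. ip M (\<lambda>q. (T (t / real (Suc N)) v q - v q) / (t / real (Suc N))) v) \<longlonglongrightarrow> ip M w v"
  proof (rule ip_tendsto[OF vL(2,1) _ vL(1)])
    show "(\<lambda>q. (T (t / real (Suc N)) v q - v q) / (t / real (Suc N))) \<in> L2 M" for N
    proof -
      have Tv: "T (t / real (Suc N)) v \<in> L2 M" using t vL by (intro T_L2) auto
      show ?thesis
        using L2_cmult[OF L2_diff[OF Tv vL(1)], of "inverse (t / real (Suc N))"]
        by (simp add: divide_inverse mult.commute)
    qed
    show "(\<lambda>N. norm_L2 M (\<lambda>q. (T (t / real (Suc N)) v q - v q) / (t / real (Suc N)) - w q)) \<longlonglongrightarrow> 0"
      using filterlim_compose[OF gen_lim[OF w] lim] by (simp add: v_def)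
  qed (simp add: norm_L2_def)
  then have "ip M w v \<ge> - (c t / t)"
  proof (rule LIMSEQ_le_const, intro exI[of _ 0] allI impI)
    fix N :: nat
    have "(c (2 * t) - c (2 * t + t / real (Suc N))) / (t / real (Suc N)) \<le> c t / t"
      by (rule step[of "Suc N"]) auto
    then have "- (c t / t) \<le> (c (2 * t + t / real (Suc N)) - c (2 * t)) / (t / real (Suc N))"
      by (simp only: diff_divide_distrib)
    also have "\<dots> = ip M (\<lambda>q. (T (t / real (Suc N)) v q - v q) / (t / real (Suc N))) v"
      using t by (intro diffq[symmetric]) simp
    finally show "- (c t / t) \<le> ip M (\<lambda>q. (T (t / real (Suc N)) v q - v q) / (t / real (Suc N))) v" .
  qed
  then show ?thesis by (simp add: v_def c_def)
qed

end

section \<open>Haar measure and dilations on the Heisenberg group\<close>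

lemma heis_mult_conv:
  "p \<star> q = (fst p + fst q, fst (snd p) + fst (snd q),
     snd (snd p) + snd (snd q) + 2 * (fst q \<bullet> fst (snd p) - fst p \<bullet> fst (snd q)))"
  by (cases p; cases q) (simp add: inner_vec_def sum_subtractf)

lemma heis_inv_conv: "heis_inv q = - q"
  by (cases q) simp

lemma continuous_on_heis_mult [continuous_intros]:
  "continuous_on A f \<Longrightarrow> continuous_on A g \<Longrightarrow> continuous_on A (\<lambda>x. f x \<star> g x)"
  unfolding heis_mult_conv by (intro continuous_intros)

lemma continuous_on_heis_inv [continuous_intros]:
  "continuous_on A f \<Longrightarrow> continuous_on A (\<lambda>x. heis_inv (f x))"
  unfolding heis_inv_conv by (intro continuous_intros)

lemma heis_inv_mult: "heis_inv (p \<star> q) = heis_inv q \<star> heis_inv p"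
  by (cases p; cases q) (simp add: sum_subtractf algebra_simps)

lemma heis_inv_inv: "heis_inv (heis_inv p) = p"
  by (cases p) simp

lemma heis_mult_measurable [measurable]:
  assumes [measurable]: "f \<in> borel_measurable N" "g \<in> borel_measurable N"
  shows "(\<lambda>x. f x \<star> g x) \<in> borel_measurable N"
proof -
  have "(\<lambda>p. fst p \<star> snd p) \<in> borel_measurable (borel :: (('n::finite heis) \<times> 'n heis) measure)"
    by (intro borel_measurable_continuous_onI continuous_intros)
  then have "(\<lambda>p. fst p \<star> snd p) \<in> borel_measurable (borel \<Otimes>\<^sub>M (borel :: ('n::finite heis) measure))"
    by (simp add: borel_prod)
  from measurable_compose[OF _ this, of "\<lambda>x. (f x, g x)" N] show ?thesis
    by simp
qed

lemma heis_inv_measurable [measurable]: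
  assumes [measurable]: "f \<in> borel_measurable N"
  shows "(\<lambda>x. heis_inv (f x)) \<in> borel_measurable N"
  by (rule borel_measurable_continuous_on[OF _ assms]) (intro continuous_intros)

section \<open>Invariance of Lebesgue measure under both group translations\<close>

lemma nn_integral_lborel_translate:
  fixes f :: "'a::euclidean_space \<Rightarrow> ennreal"
  assumes [measurable]: "f \<in> borel_measurable borel"
  shows "(\<integral>\<^sup>+x. f (x + a) \<partial>lborel) = (\<integral>\<^sup>+x. f x \<partial>lborel)"
proof -
  have "(\<integral>\<^sup>+x. f x \<partial>lborel) = (\<integral>\<^sup>+x. f x \<partial>distr lborel borel ((+) a))"
    by (simp add: lborel_distr_plus)
  also have "\<dots> = (\<integral>\<^sup>+x. f (x + a) \<partial>lborel)"
    by (subst nn_integral_distr) (auto simp: add.commute)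
  finally show ?thesis by simp
qed

lemma nn_integral_heis:
  fixes f :: "'n::finite heis \<Rightarrow> ennreal"
  assumes [measurable]: "f \<in> borel_measurable borel"
  shows "(\<integral>\<^sup>+q. f q \<partial>lborel) = (\<integral>\<^sup>+x. \<integral>\<^sup>+y. \<integral>\<^sup>+z. f (x, y, z) \<partial>lborel \<partial>lborel \<partial>lborel)"
proof -
  have f: "f \<in> borel_measurable ((lborel :: (real^'n) measure) \<Otimes>\<^sub>M (lborel :: ((real^'n) \<times> real) measure))"
    by (simp add: lborel_prod)
  have fx: "(\<lambda>p. f (x, p)) \<in> borel_measurable ((lborel :: (real^'n) measure) \<Otimes>\<^sub>M (lborel :: real measure))" for x
    by (simp add: lborel_prod)
  have "(\<integral>\<^sup>+q. f q \<partial>lborel) = (\<integral>\<^sup>+x. \<integral>\<^sup>+p. f (x, p) \<partial>lborel \<partial>lborel)"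
    using lborel.nn_integral_fst[OF f] by (simp add: lborel_prod)
  also have "\<dots> = (\<integral>\<^sup>+x. \<integral>\<^sup>+y. \<integral>\<^sup>+z. f (x, y, z) \<partial>lborel \<partial>lborel \<partial>lborel)"
    using lborel.nn_integral_fst[OF fx] by (simp add: lborel_prod)
  finally show ?thesis .
qed

text \<open>The map is triangular: with x and y fixed the innermost integral sees only a translation
  of z, and the shifts of y and x are then removed in turn. Left and right group translations both
  have this form, hence the group is unimodular with Haar measure \<open>lborel\<close>.\<close>

lemma nn_integral_heis_shear:
  fixes f :: "'n::finite heis \<Rightarrow> ennreal" and l :: "real^'n \<Rightarrow> real^'n \<Rightarrow> real"
  assumes [measurable]: "f \<in> borel_measurable borel"
    and l: "continuous_on UNIV (\<lambda>p. l (fst p) (snd p))"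
  shows "(\<integral>\<^sup>+q. f (fst q + a, fst (snd q) + b, snd (snd q) + l (fst q) (fst (snd q))) \<partial>lborel) = (\<integral>\<^sup>+q. f q \<partial>lborel)"
proof -
  have c: "continuous_on UNIV (\<lambda>q. l (fst q) (fst (snd q)))"
    by (rule continuous_on_compose2[OF l, of UNIV "\<lambda>q. (fst q, fst (snd q))", simplified]) (intro continuous_intros)
  have [measurable]: "(\<lambda>q. f (fst q + a, fst (snd q) + b, snd (snd q) + l (fst q) (fst (snd q)))) \<in> borel_measurable borel"
    by (rule measurable_compose[OF _ assms(1)], rule borel_measurable_continuous_onI) (intro continuous_intros c)
  have m1: "(\<lambda>z. f (p, q, z)) \<in> borel_measurable borel" for p q
    by measurable
  have m2: "(\<lambda>y. \<integral>\<^sup>+z. f (p, y, z) \<partial>lborel) \<in> borel_measurable borel" for p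
  proof -
    have "(\<lambda>r. f (p, fst r, snd r)) \<in> borel_measurable ((borel :: (real^'n) measure) \<Otimes>\<^sub>M (lborel :: real measure))"
      by measurable
    from lborel.borel_measurable_nn_integral_fst[OF this] show ?thesis by simp
  qed
  have m3: "(\<lambda>x. \<integral>\<^sup>+y. \<integral>\<^sup>+z. f (x, y, z) \<partial>lborel \<partial>lborel) \<in> borel_measurable borel"
  proof -
    have "(\<lambda>r. f (fst (fst r), snd (fst r), snd r)) \<in> borel_measurable (((borel :: (real^'n) measure) \<Otimes>\<^sub>M (lborel :: (real^'n) measure)) \<Otimes>\<^sub>M (lborel :: real measure))"
      by measurable
    from lborel.borel_measurable_nn_integral_fst[OF this]
    have "(\<lambda>r. \<integral>\<^sup>+z. f (fst r, snd r, z) \<partial>lborel) \<in> borel_measurable ((borel :: (real^'n) measure) \<Otimes>\<^sub>M (lborel :: (real^'n) measure))"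
      by simp
    from lborel.borel_measurable_nn_integral_fst[OF this] show ?thesis by simp
  qed
  have "(\<integral>\<^sup>+q. f (fst q + a, fst (snd q) + b, snd (snd q) + l (fst q) (fst (snd q))) \<partial>lborel)
    = (\<integral>\<^sup>+x. \<integral>\<^sup>+y. \<integral>\<^sup>+z. f (x + a, y + b, z + l x y) \<partial>lborel \<partial>lborel \<partial>lborel)"
    by (subst nn_integral_heis) simp_all
  also have "\<dots> = (\<integral>\<^sup>+x. \<integral>\<^sup>+y. \<integral>\<^sup>+z. f (x + a, y + b, z) \<partial>lborel \<partial>lborel \<partial>lborel)"
    by (simp add: nn_integral_lborel_translate[OF m1])
  also have "\<dots> = (\<integral>\<^sup>+x. \<integral>\<^sup>+y. \<integral>\<^sup>+z. f (x + a, y, z) \<partial>lborel \<partial>lborel \<partial>lborel)"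
    by (simp add: nn_integral_lborel_translate[OF m2])
  also have "\<dots> = (\<integral>\<^sup>+x. \<integral>\<^sup>+y. \<integral>\<^sup>+z. f (x, y, z) \<partial>lborel \<partial>lborel \<partial>lborel)"
    by (rule nn_integral_lborel_translate[OF m3])
  also have "\<dots> = (\<integral>\<^sup>+q. f q \<partial>lborel)"
    by (rule nn_integral_heis[symmetric]) simp
  finally show ?thesis .
qed

lemma distr_lborel_eqI:
  fixes \<phi> :: "'a::euclidean_space \<Rightarrow> 'a"
  assumes [measurable]: "\<phi> \<in> borel_measurable borel"
    and "\<And>f. f \<in> borel_measurable borel \<Longrightarrow> (\<integral>\<^sup>+q. f (\<phi> q) \<partial>lborel) = (\<integral>\<^sup>+q. f q \<partial>lborel)"
  shows "distr lborel borel \<phi> = lborel"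
proof (rule measure_eqI)
  fix B assume "B \<in> sets (distr lborel borel \<phi>)"
  then have [measurable]: "B \<in> sets borel" by simp
  have "emeasure (distr lborel borel \<phi>) B = (\<integral>\<^sup>+q. indicator B q \<partial>distr lborel borel \<phi>)"
    by simp
  also have "\<dots> = (\<integral>\<^sup>+q. indicator B (\<phi> q) \<partial>lborel)"
    by (rule nn_integral_distr) auto
  also have "\<dots> = (\<integral>\<^sup>+q. indicator B q \<partial>lborel)"
    by (rule assms(2)) simp
  finally show "emeasure (distr lborel borel \<phi>) B = emeasure lborel B"
    by simp
qed simp

lemma distr_heis_mult_right:
  fixes p :: "'n::finite heis"
  shows "distr lborel borel (\<lambda>q. q \<star> p) = lborel"
proof (rule distr_lborel_eqI)
  fix f :: "'n heis \<Rightarrow> ennreal" assume f: "f \<in> borel_measurable borel"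
  have "continuous_on UNIV (\<lambda>r. snd (snd p) + 2 * (fst p \<bullet> snd r - fst r \<bullet> fst (snd p)))"
    by (intro continuous_intros)
  from nn_integral_heis_shear[OF f, of "\<lambda>x y. snd (snd p) + 2 * (fst p \<bullet> y - x \<bullet> fst (snd p))" "fst p" "fst (snd p)", OF this]
  show "(\<integral>\<^sup>+q. f (q \<star> p) \<partial>lborel) = (\<integral>\<^sup>+q. f q \<partial>lborel)"
    by (simp add: heis_mult_conv algebra_simps)
qed simp

lemma distr_heis_mult_left:
  fixes p :: "'n::finite heis"
  shows "distr lborel borel (\<lambda>q. p \<star> q) = lborel"
proof (rule distr_lborel_eqI)
  fix f :: "'n heis \<Rightarrow> ennreal" assume f: "f \<in> borel_measurable borel"
  have "continuous_on UNIV (\<lambda>r. snd (snd p) + 2 * (fst r \<bullet> fst (snd p) - fst p \<bullet> snd r))"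
    by (intro continuous_intros)
  from nn_integral_heis_shear[OF f, of "\<lambda>x y. snd (snd p) + 2 * (x \<bullet> fst (snd p) - fst p \<bullet> y)" "fst p" "fst (snd p)", OF this]
  show "(\<integral>\<^sup>+q. f (p \<star> q) \<partial>lborel) = (\<integral>\<^sup>+q. f q \<partial>lborel)"
    by (simp add: heis_mult_conv algebra_simps)
qed simp

lemma distr_heis_inv: "distr lborel borel heis_inv = (lborel :: 'n::finite heis measure)"
  using lborel_affine[of "-1" "0 :: 'n heis"] by (simp add: density_1 heis_inv_conv[abs_def])

lemma
  fixes \<phi> :: "'a::euclidean_space \<Rightarrow> 'a" and f :: "'a \<Rightarrow> real"
  assumes \<phi>: "distr lborel borel \<phi> = lborel" and [measurable]: "\<phi> \<in> borel_measurable borel" "f \<in> borel_measurable borel"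
  shows integral_preserving: "(\<integral>q. f (\<phi> q) \<partial>lborel) = (\<integral>q. f q \<partial>lborel)"
    and integrable_preserving: "integrable lborel (\<lambda>q. f (\<phi> q)) \<longleftrightarrow> integrable lborel f"
  using integral_distr[of \<phi> lborel borel f] integrable_distr_eq[of \<phi> lborel borel f] by (simp_all add: \<phi>)

lemma nn_integral_preserving:
  fixes \<phi> :: "'a::euclidean_space \<Rightarrow> 'a"
  assumes \<phi>: "distr lborel borel \<phi> = lborel" and [measurable]: "\<phi> \<in> borel_measurable borel" "f \<in> borel_measurable borel"
  shows "(\<integral>\<^sup>+q. f (\<phi> q) \<partial>lborel) = (\<integral>\<^sup>+q. f q \<partial>lborel)"
  using nn_integral_distr[of \<phi> lborel borel f] by (simp add: \<phi>)

lemma AE_preserving: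
  fixes \<phi> :: "'a::euclidean_space \<Rightarrow> 'a"
  assumes \<phi>: "distr lborel borel \<phi> = lborel" and [measurable]: "\<phi> \<in> borel_measurable borel"
    and "AE q in lborel. P q"
  shows "AE q in lborel. P (\<phi> q)"
proof (rule AE_distrD[where f = \<phi> and M' = borel and P = P])
  show "AE q in distr lborel borel \<phi>. P q"
    unfolding \<phi> by (rule assms(3))
qed simp

lemma L2_preserving:
  fixes \<phi> :: "'a::euclidean_space \<Rightarrow> 'a"
  assumes "distr lborel borel \<phi> = lborel" "\<phi> \<in> borel_measurable borel" "f \<in> L2 lborel"
  shows "(\<lambda>q. f (\<phi> q)) \<in> L2 lborel"
  using assms integrable_preserving[of \<phi> "\<lambda>q. (f q)\<^sup>2"] by (auto simp: L2_def)

lemma norm_L2_preserving: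
  fixes \<phi> :: "'a::euclidean_space \<Rightarrow> 'a"
  assumes "distr lborel borel \<phi> = lborel" "\<phi> \<in> borel_measurable borel" "f \<in> borel_measurable borel"
  shows "norm_L2 lborel (\<lambda>q. f (\<phi> q)) = norm_L2 lborel f"
  using assms integral_preserving[of \<phi> "\<lambda>q. (f q)\<^sup>2"] by (simp add: norm_L2_def)

text \<open>The dilations adapted to the group: the product is quadratic in the horizontal
  coordinates, so the central one must have weight two for \<open>heis_dil r\<close> to respect
  \<open>\<star>\<close>.\<close>

definition heis_dil :: "real \<Rightarrow> 'n::finite heis \<Rightarrow> 'n heis" where
  "heis_dil r q = (r *\<^sub>R fst q, r *\<^sub>R fst (snd q), r\<^sup>2 * snd (snd q))"

lemma heis_dil_mult: "heis_dil r (p \<star> q) = heis_dil r p \<star> heis_dil r q"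
  by (simp add: heis_dil_def heis_mult_conv algebra_simps power2_eq_square)

lemma heis_dil_inv: "heis_dil r (heis_inv p) = heis_inv (heis_dil r p)"
  by (simp add: heis_dil_def heis_inv_conv)

lemma heis_dil_dil: "heis_dil r (heis_dil s p) = heis_dil (r * s) p"
  by (simp add: heis_dil_def power_mult_distrib)

lemma heis_dil_1: "heis_dil 1 p = p"
  by (simp add: heis_dil_def)

lemma linear_heis_dil: "bounded_linear (heis_dil r)"
  unfolding heis_dil_def[abs_def]
  by (intro bounded_linear_Pair bounded_linear_scaleR_right[THEN bounded_linear_compose]
        bounded_linear_mult_right[THEN bounded_linear_compose]
        bounded_linear_fst bounded_linear_snd bounded_linear_compose[OF bounded_linear_fst]
        bounded_linear_compose[OF bounded_linear_snd])

lemma continuous_on_heis_dil [continuous_intros]: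
  "continuous_on A f \<Longrightarrow> continuous_on A (\<lambda>x. heis_dil r (f x))"
  unfolding heis_dil_def by (intro continuous_intros)

lemma heis_dil_measurable [measurable]: "heis_dil r \<in> borel_measurable borel"
  by (intro borel_measurable_continuous_onI continuous_intros)

text \<open>Eigenvalues of \<open>heis_dil r\<close> on the coordinate basis; the value has this
  meaning only for \<open>v\<close> in \<open>Basis\<close>.\<close>

definition dil_weight :: "real \<Rightarrow> 'n::finite heis \<Rightarrow> real" where
  "dil_weight r v = (if v = (0, 0, 1) then r\<^sup>2 else r)"

lemma heis_Basis: "(Basis :: 'n::finite heis set)
    = (\<lambda>u. (u, 0, 0)) ` Basis \<union> (\<lambda>u. (0, u, 0)) ` Basis \<union> {(0, 0, 1)}"
  by (simp add: Basis_prod_def zero_prod_def image_Un image_image Un_assoc)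

lemma heis_dil_Basis: "v \<in> Basis \<Longrightarrow> heis_dil r v = dil_weight r v *\<^sub>R v"
  by (auto simp: heis_Basis heis_dil_def dil_weight_def nonzero_Basis)

text \<open>There are \<open>2 * CARD('n)\<close> directions of weight one and a single one of
  weight two. The exponent is the homogeneous dimension, from which the decay rate of
  \<open>h t heis_e\<close> will come.\<close>

lemma prod_dil_weight: "(\<Prod>v\<in>(Basis :: 'n::finite heis set). dil_weight r v) = r ^ (2 * CARD('n) + 2)"
proof -
  have 1: "(\<Prod>v\<in>(\<lambda>u. (u, 0, 0)) ` (Basis :: (real^'n) set). dil_weight r v) = r ^ CARD('n)"
    by (subst prod.reindex) (auto simp: dil_weight_def inj_on_def)
  have 2: "(\<Prod>v\<in>(\<lambda>u. (0, u, 0)) ` (Basis :: (real^'n) set). dil_weight r v) = r ^ CARD('n)"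
    by (subst prod.reindex) (auto simp: dil_weight_def inj_on_def)
  show ?thesis
    unfolding heis_Basis
    by (subst prod.union_disjoint, simp, simp, force simp: nonzero_Basis,
        subst prod.union_disjoint, simp, simp, force simp: nonzero_Basis)
       (simp only: 1 2, simp add: dil_weight_def power_add mult_2 power2_eq_square)
qed

lemma nn_integral_heis_dil:
  fixes f :: "'n::finite heis \<Rightarrow> ennreal"
  assumes [measurable]: "f \<in> borel_measurable borel" and r: "0 < r"
  shows "(\<integral>\<^sup>+q. f q \<partial>lborel) = ennreal (r ^ (2 * CARD('n) + 2)) * (\<integral>\<^sup>+q. f (heis_dil r q) \<partial>lborel)"
proof -
  have eq: "heis_dil r q = 0 + (\<Sum>j\<in>Basis. (dil_weight r j * (q \<bullet> j)) *\<^sub>R j)" for q :: "'n heis"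
  proof -
    interpret bounded_linear "heis_dil r :: 'n heis \<Rightarrow> _" by (rule linear_heis_dil)
    have "heis_dil r q = heis_dil r (\<Sum>j\<in>Basis. (q \<bullet> j) *\<^sub>R j)" by (simp add: euclidean_representation)
    also have "\<dots> = (\<Sum>j\<in>Basis. (q \<bullet> j) *\<^sub>R heis_dil r j)" by (simp add: sum scaleR)
    also have "\<dots> = (\<Sum>j\<in>Basis. (dil_weight r j * (q \<bullet> j)) *\<^sub>R j)"
      by (intro sum.cong) (simp_all add: heis_dil_Basis mult.commute)
    finally show ?thesis by simp
  qed
  have nz: "dil_weight r j \<noteq> 0" and ab: "\<bar>dil_weight r j\<bar> = dil_weight r j" for j :: "'n heis"
    using r by (auto simp: dil_weight_def)
  have "(lborel :: 'n heis measure) = density (distr lborel borel (heis_dil r)) (\<lambda>_. ennreal (r ^ (2 * CARD('n) + 2)))"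
    using lborel_affine_euclidean[of "dil_weight r" "0 :: 'n heis", OF nz]
    unfolding eq[symmetric] ab prod_dil_weight .
  then have "(\<integral>\<^sup>+q. f q \<partial>lborel) = (\<integral>\<^sup>+q. f q \<partial>density (distr lborel borel (heis_dil r)) (\<lambda>_. ennreal (r ^ (2 * CARD('n) + 2))))"
    by simp
  then show ?thesis
    by (simp add: nn_integral_density nn_integral_distr nn_integral_cmult del: power_Suc)
qed

lemma
  fixes f :: "'n::finite heis \<Rightarrow> real"
  assumes [measurable]: "f \<in> borel_measurable borel" and r: "0 < r"
  shows integrable_heis_dil: "integrable lborel (\<lambda>q. f (heis_dil r q)) \<longleftrightarrow> integrable lborel f"
    and integral_heis_dil: "(\<integral>q. f (heis_dil r q) \<partial>lborel) = (\<integral>q. f q \<partial>lborel) / r ^ (2 * CARD('n) + 2)"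
proof -
  let ?c = "r ^ (2 * CARD('n) + 2)"
  have c: "0 < ?c" using r by simp
  have eq: "(lborel :: 'n heis measure) = density (distr lborel borel (heis_dil r)) (\<lambda>_. ennreal ?c)"
  proof (rule measure_eqI)
    fix A assume "A \<in> sets (lborel :: 'n heis measure)"
    then have [measurable]: "A \<in> sets borel" by simp
    have "emeasure lborel A = (\<integral>\<^sup>+q. indicator A q \<partial>lborel)" by simp
    also have "\<dots> = ennreal ?c * (\<integral>\<^sup>+q. indicator A (heis_dil r q) \<partial>lborel)"
      by (rule nn_integral_heis_dil) (use r in auto)
    also have "\<dots> = emeasure (density (distr lborel borel (heis_dil r)) (\<lambda>_. ennreal ?c)) A"
      by (simp add: emeasure_density nn_integral_cmult nn_integral_distr del: nn_integral_indicator nn_integral_indicator' power_Suc)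
    finally show "emeasure lborel A = emeasure (density (distr lborel borel (heis_dil r)) (\<lambda>_. ennreal ?c)) A" .
  qed simp
  have "integrable lborel f \<longleftrightarrow> integrable (density (distr lborel borel (heis_dil r)) (\<lambda>_. ennreal ?c)) f"
    using eq by simp
  also have "\<dots> \<longleftrightarrow> integrable lborel (\<lambda>q. f (heis_dil r q))"
    using c by (subst integrable_density) (auto simp: integrable_distr_eq)
  finally show "integrable lborel (\<lambda>q. f (heis_dil r q)) \<longleftrightarrow> integrable lborel f" by simp
  have "(\<integral>q. f q \<partial>lborel) = (\<integral>q. f q \<partial>density (distr lborel borel (heis_dil r)) (\<lambda>_. ennreal ?c))"
    using eq by simp
  also have "\<dots> = ?c * (\<integral>q. f (heis_dil r q) \<partial>lborel)"
    using c by (subst integral_density) (auto simp: integral_distr)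
  finally show "(\<integral>q. f (heis_dil r q) \<partial>lborel) = (\<integral>q. f q \<partial>lborel) / ?c"
    using c by (simp only: nonzero_mult_div_cancel_left less_imp_neq[symmetric] less_irrefl simp_thms)
qed

section \<open>Smooth functions\<close>

lemma dir_deriv_eq: "(f has_derivative f') (at q) \<Longrightarrow> dir_deriv v f q = f' v"
  unfolding dir_deriv_def by (simp add: frechet_derivative_at[symmetric])

lemma differentiable_has_derivative:
  "f differentiable (at q) \<Longrightarrow> (f has_derivative (\<lambda>v. dir_deriv v f q)) (at q)"
  unfolding dir_deriv_def by (simp add: frechet_derivative_works)

lemma Ck_Suc_imp: "Ck (Suc k) f \<Longrightarrow> Ck k f"
proof (induction k arbitrary: f)
  case 0
  then show ?case
    by (auto intro!: differentiable_imp_continuous_on simp: differentiable_on_def intro: differentiable_at_withinI)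
next
  case (Suc k)
  then show ?case by (metis Ck.simps(2))
qed

lemma Ck_add: "Ck k f \<Longrightarrow> Ck k g \<Longrightarrow> Ck k (\<lambda>q. f q + g q)"
proof (induction k arbitrary: f g)
  case (Suc k)
  have "dir_deriv v (\<lambda>q. f q + g q) = (\<lambda>q. dir_deriv v f q + dir_deriv v g q)" for v
    using Suc.prems by (auto intro!: dir_deriv_eq has_derivative_add differentiable_has_derivative)
  with Suc show ?case by (auto intro: differentiable_add)
qed (auto intro: continuous_intros)

lemma Ck_mult: "Ck k f \<Longrightarrow> Ck k g \<Longrightarrow> Ck k (\<lambda>q. f q * g q)"
proof (induction k arbitrary: f g)
  case (Suc k)
  have "dir_deriv v (\<lambda>q. f q * g q) = (\<lambda>q. f q * dir_deriv v g q + dir_deriv v f q * g q)" for v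
    using Suc.prems by (auto intro!: dir_deriv_eq has_derivative_mult differentiable_has_derivative)
  with Suc show ?case
    using Ck_Suc_imp[OF Suc.prems(1)] Ck_Suc_imp[OF Suc.prems(2)]
    by (auto intro!: differentiable_mult Ck_add)
qed (auto intro: continuous_intros)

lemma Ck_const: "Ck k (\<lambda>_::'b::euclidean_space. c)"
proof (induction k arbitrary: c)
  case (Suc k)
  have "dir_deriv v (\<lambda>_. c) = (\<lambda>_. 0)" for v :: "'b::euclidean_space"
    by (intro ext dir_deriv_eq has_derivative_const)
  with Suc show ?case by simp
qed auto

lemma Ck_linear:
  assumes "bounded_linear f"
  shows "Ck k f"
proof (cases k)
  case (Suc k)
  have d: "(f has_derivative f) (at q)" for q
    using assms by (rule bounded_linear_imp_has_derivative)
  have "dir_deriv v f = (\<lambda>_. f v)" for v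
    by (intro ext dir_deriv_eq d)
  with Suc show ?thesis using d by (auto simp: Ck_const differentiable_def)
qed (use assms linear_continuous_on in auto)

abbreviation smooth :: "('a::euclidean_space \<Rightarrow> real) \<Rightarrow> bool" where
  "smooth f \<equiv> \<forall>k. Ck k f"

lemma smooth_differentiable: "smooth f \<Longrightarrow> f differentiable (at q)"
  using Ck.simps(2) by blast

lemma smooth_has_derivative: "smooth f \<Longrightarrow> (f has_derivative (\<lambda>v. dir_deriv v f q)) (at q)"
  by (intro differentiable_has_derivative smooth_differentiable)

lemma smooth_continuous: "smooth f \<Longrightarrow> continuous_on A f"
  using Ck.simps(1) continuous_on_subset by blast

lemma smooth_dir_deriv: "smooth f \<Longrightarrow> v \<in> Basis \<Longrightarrow> smooth (dir_deriv v f)"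
  using Ck.simps(2) by blast

lemma smooth_sum: "finite I \<Longrightarrow> (\<And>i. i \<in> I \<Longrightarrow> smooth (f i)) \<Longrightarrow> smooth (\<lambda>q. \<Sum>i\<in>I. f i q)"
  by (induction I rule: finite_induct) (simp_all add: Ck_const Ck_add)

lemma dir_deriv_scaled:
  assumes "smooth f"
  shows "dir_deriv (c *\<^sub>R v) f q = c * dir_deriv v f q"
  using smooth_differentiable[OF assms, of q] unfolding dir_deriv_def
  by (simp add: linear_frechet_derivative linear_scale)

text \<open>Basis vectors are eigenvectors of the dilation, so a partial derivative of the
  composition is a multiple of a composition of the same kind and the induction closes.\<close>

lemma Ck_heis_dil: "Ck k f \<Longrightarrow> Ck k (\<lambda>q. f (heis_dil r q))"
proof (induction k arbitrary: f)
  case 0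
  then show ?case
    by (auto intro!: continuous_on_compose2[of UNIV f] continuous_intros)
next
  case (Suc k)
  have D: "((\<lambda>q. f (heis_dil r q)) has_derivative (\<lambda>v. dir_deriv (heis_dil r v) f (heis_dil r q))) (at q)" for q
    by (intro has_derivative_compose[OF bounded_linear_imp_has_derivative[OF linear_heis_dil]
        differentiable_has_derivative]) (use Suc.prems Ck.simps(2) in blast)
  have "dir_deriv v (\<lambda>q. f (heis_dil r q)) = (\<lambda>q. dil_weight r v * dir_deriv v f (heis_dil r q))"
    if v: "v \<in> Basis" for v
  proof
    fix q
    have "f differentiable (at (heis_dil r q))"
      using Suc.prems Ck.simps(2) by blast
    then show "dir_deriv v (\<lambda>q. f (heis_dil r q)) q = dil_weight r v * dir_deriv v f (heis_dil r q)"
      unfolding dir_deriv_eq[OF D] heis_dil_Basis[OF v] dir_deriv_def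
      by (simp add: linear_frechet_derivative linear_scale)
  qed
  moreover have "(\<lambda>q. f (heis_dil r q)) differentiable (at q)" for q
    using D unfolding differentiable_def by blast
  moreover have "Ck k (\<lambda>q. dil_weight r v * dir_deriv v f (heis_dil r q))" if "v \<in> Basis" for v
    using Suc that by (intro Ck_mult Ck_const Suc.IH) simp
  ultimately show ?case
    unfolding Ck.simps by simp
qed

lemma dir_deriv_heis_dil:
  assumes "smooth f" "v \<in> Basis"
  shows "dir_deriv v (\<lambda>q. f (heis_dil r q)) q = dil_weight r v * dir_deriv v f (heis_dil r q)"
proof -
  have D: "((\<lambda>q. f (heis_dil r q)) has_derivative (\<lambda>v. dir_deriv (heis_dil r v) f (heis_dil r q))) (at q)"
    by (intro has_derivative_compose[OF bounded_linear_imp_has_derivative[OF linear_heis_dil]]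
        smooth_has_derivative assms)
  show ?thesis
    unfolding dir_deriv_eq[OF D] heis_dil_Basis[OF assms(2)] by (rule dir_deriv_scaled[OF assms(1)])
qed

section \<open>Bump functions\<close>

text \<open>The polynomial in \<open>1 / s\<close> is carried along so that the family is closed
  under differentiation; \<open>exp_recip 1\<close> is the usual flat function.\<close>

definition exp_recip :: "real poly \<Rightarrow> real \<Rightarrow> real" where
  "exp_recip P s = (if s > 0 then poly P (1 / s) * exp (- (1 / s)) else 0)"

lemma poly_exp_tendsto_0: "((\<lambda>x. poly P x * exp (- x)) \<longlongrightarrow> (0 :: real)) at_top"
proof -
  have "((\<lambda>x. \<Sum>i\<le>degree P. coeff P i * (x ^ i / exp x)) \<longlongrightarrow> (\<Sum>i\<le>degree P. coeff P i * 0)) at_top"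
    by (intro tendsto_sum tendsto_mult tendsto_const tendsto_power_div_exp_0)
  moreover have "(\<lambda>x. \<Sum>i\<le>degree P. coeff P i * (x ^ i / exp x)) = (\<lambda>x. poly P x * exp (- x))"
    by (auto simp: poly_altdef sum_distrib_right exp_minus divide_inverse mult.assoc)
  ultimately show ?thesis by simp
qed

text \<open>For \<open>s > 0\<close> the chain rule turns P into x^2 (P - P') evaluated at
  \<open>1 / s\<close>. At 0 both one-sided difference quotients tend to 0, on the right because the
  exponential beats every polynomial.\<close>

lemma exp_recip_has_derivative:
  "(exp_recip P has_real_derivative exp_recip ([:0, 0, 1:] * (P - pderiv P)) s) (at s)"
proof -
  consider "s > 0" | "s < 0" | "s = 0" by linarith
  then show ?thesis
  proof cases
    case 1
    have "((\<lambda>s. poly P (1 / s) * exp (- (1 / s))) has_real_derivative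
        exp_recip ([:0, 0, 1:] * (P - pderiv P)) s) (at s)"
      using 1 by (auto intro!: derivative_eq_intros DERIV_chain2[OF poly_DERIV]
          simp: exp_recip_def field_simps power2_eq_square)
    then show ?thesis
      by (rule has_field_derivative_transform_within_open[where S = "{0<..}"]) (use 1 in \<open>auto simp: exp_recip_def\<close>)
  next
    case 2
    have "((\<lambda>_. 0) has_real_derivative exp_recip ([:0, 0, 1:] * (P - pderiv P)) s) (at s)"
      using 2 by (simp add: exp_recip_def)
    then show ?thesis
      by (rule has_field_derivative_transform_within_open[where S = "{..<0}"]) (use 2 in \<open>auto simp: exp_recip_def\<close>)
  next
    case 3
    have "((\<lambda>s. exp_recip P s / s) \<longlongrightarrow> 0) (at_right 0)"
    proof -
      \<comment> \<open>Division by \<open>s\<close> multiplies the polynomial by its variable,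
        hence \<open>pCons 0 P\<close>.\<close>
      have "((\<lambda>s. poly (pCons 0 P) (inverse s) * exp (- inverse s)) \<longlongrightarrow> 0) (at_right (0 :: real))"
        by (rule filterlim_compose[OF poly_exp_tendsto_0 filterlim_inverse_at_top_right])
      then show ?thesis
        by (rule Lim_transform_eventually)
          (auto simp: exp_recip_def field_simps intro!: eventually_mono[OF eventually_at_right_less[of "0 :: real"]])
    qed
    moreover have "((\<lambda>s. exp_recip P s / s) \<longlongrightarrow> 0) (at_left 0)"
      by (rule Lim_transform_eventually[OF tendsto_const])
        (auto simp: exp_recip_def eventually_at_filter)
    ultimately have "((\<lambda>s. exp_recip P s / s) \<longlongrightarrow> 0) (at 0)"
      by (simp add: filterlim_split_at)
    then show ?thesis
      using 3 by (simp add: has_field_derivative_iff exp_recip_def)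
  qed
qed

lemma Ck_exp_recip: "smooth f \<Longrightarrow> Ck k (\<lambda>q. exp_recip P (f q))"
proof (induction k arbitrary: P)
  case 0
  have "continuous_on UNIV (exp_recip P)"
    using exp_recip_has_derivative by (meson DERIV_continuous_on has_field_derivative_at_within)
  then show ?case
    unfolding Ck.simps
    by (rule continuous_on_compose2[OF _ smooth_continuous[OF 0]]) simp
next
  case (Suc k)
  have D: "((\<lambda>q. exp_recip P (f q)) has_derivative
      (\<lambda>v. exp_recip ([:0, 0, 1:] * (P - pderiv P)) (f q) * dir_deriv v f q)) (at q)" for q
    by (rule has_derivative_compose[OF smooth_has_derivative[OF Suc.prems]
          exp_recip_has_derivative[unfolded has_field_derivative_def]])
  have "dir_deriv v (\<lambda>q. exp_recip P (f q)) =
      (\<lambda>q. exp_recip ([:0, 0, 1:] * (P - pderiv P)) (f q) * dir_deriv v f q)" for v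
    by (intro ext dir_deriv_eq D)
  moreover have "(\<lambda>q. exp_recip P (f q)) differentiable (at q)" for q
    using D unfolding differentiable_def by blast
  ultimately show ?case
    using Suc smooth_dir_deriv[OF Suc.prems] unfolding Ck.simps by (metis Ck_mult)
qed

section \<open>Closure properties of test functions\<close>

lemma test_function_smooth: "test_function f \<Longrightarrow> smooth f"
  and test_function_compact: "test_function f \<Longrightarrow> compact (closure {q. f q \<noteq> 0})"
  by (auto simp: test_function_def)

lemma test_functionI:
  assumes "smooth f" "compact K" "\<And>q. q \<notin> K \<Longrightarrow> f q = 0"
  shows "test_function f"
proof -
  have "closure {q. f q \<noteq> 0} \<subseteq> K"
    using assms(2,3) by (intro closure_minimal compact_imp_closed) auto
  then have "compact (closure {q. f q \<noteq> 0})"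
    using assms(2) by (metis closed_closure compact_Int_closed inf.absorb_iff2 inf_commute)
  with assms(1) show ?thesis by (simp add: test_function_def)
qed

lemma notin_support: "q \<notin> closure {q. f q \<noteq> 0} \<Longrightarrow> f q = 0"
  using subsetD[OF closure_subset, of q "{q. f q \<noteq> 0}"] unfolding mem_Collect_eq by metis

lemma test_function_lin:
  assumes f: "test_function f" and g: "test_function g"
  shows "test_function (\<lambda>q. a * f q + b * g q)"
proof (rule test_functionI)
  show "smooth (\<lambda>q. a * f q + b * g q)"
    using test_function_smooth[OF f] test_function_smooth[OF g]
    by (intro allI Ck_add Ck_mult Ck_const) blast+
  show "compact (closure {q. f q \<noteq> 0} \<union> closure {q. g q \<noteq> 0})"
    using f g by (intro compact_Un test_function_compact)
  show "a * f q + b * g q = 0" if "q \<notin> closure {q. f q \<noteq> 0} \<union> closure {q. g q \<noteq> 0}" for q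
    using that notin_support[of q f] notin_support[of q g] by simp
qed

lemma test_function_sum:
  assumes "finite I" "\<And>i. i \<in> I \<Longrightarrow> test_function (f i)"
  shows "test_function (\<lambda>q. \<Sum>i\<in>I. f i q)"
  using assms
proof (induction I rule: finite_induct)
  case empty
  show ?case by (rule test_functionI[of _ "{}"]) (auto simp: Ck_const)
next
  case (insert i I)
  then show ?case using test_function_lin[of "f i" "\<lambda>q. \<Sum>i\<in>I. f i q" 1 1] by simp
qed

lemma test_function_mult:
  assumes f: "test_function f" and g: "smooth g"
  shows "test_function (\<lambda>q. g q * f q)"
proof (rule test_functionI)
  show "smooth (\<lambda>q. g q * f q)"
    using test_function_smooth[OF f] g by (intro allI Ck_mult) blast+
  show "compact (closure {q. f q \<noteq> 0})"
    by (rule test_function_compact[OF f])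
  show "g q * f q = 0" if "q \<notin> closure {q. f q \<noteq> 0}" for q
    using that notin_support[of q f] by simp
qed

lemma dir_deriv_outside:
  assumes "q \<notin> closure {q. f q \<noteq> 0}"
  shows "dir_deriv v f q = 0"
proof (rule dir_deriv_eq)
  have "((\<lambda>_. 0 :: real) has_derivative (\<lambda>_. 0)) (at q)" by simp
  then show "(f has_derivative (\<lambda>_. 0)) (at q)"
  proof (rule has_derivative_transform_within_open)
    show "open (- closure {q. f q \<noteq> 0})" by (intro open_Compl closed_closure)
    show "q \<in> - closure {q. f q \<noteq> 0}" unfolding Compl_iff by (rule assms)
    show "0 = f x" if "x \<in> - closure {q. f q \<noteq> 0}" for x
      using notin_support[of x f] ComplD[OF that] by simp
  qed
qed

lemma test_function_dir_deriv:
  assumes f: "test_function f" and v: "v \<in> Basis"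
  shows "test_function (dir_deriv v f)"
  by (rule test_functionI[OF _ test_function_compact[OF f] dir_deriv_outside])
    (use smooth_dir_deriv[OF test_function_smooth[OF f] v] in auto)

lemma test_function_bounded:
  assumes "test_function f"
  obtains B where "\<And>q. \<bar>f q\<bar> \<le> B"
proof -
  have "bounded (f ` closure {q. f q \<noteq> 0})"
    using assms by (intro compact_imp_bounded compact_continuous_image smooth_continuous
        test_function_smooth test_function_compact)
  then obtain B where B: "\<And>q. q \<in> closure {q. f q \<noteq> 0} \<Longrightarrow> \<bar>f q\<bar> \<le> B"
    unfolding bounded_iff by auto
  show thesis
  proof (rule that[of "max B 0"])
    show "\<bar>f q\<bar> \<le> max B 0" for q
      using B[of q] notin_support[of q f] by (cases "q \<in> closure {q. f q \<noteq> 0}") simp_all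
  qed
qed

lemma test_function_continuous: "test_function f \<Longrightarrow> continuous_on A f"
  by (intro smooth_continuous test_function_smooth)

lemma test_function_measurable: "test_function f \<Longrightarrow> f \<in> borel_measurable borel"
  by (intro borel_measurable_continuous_onI test_function_continuous)

lemma continuous_times_test_integrable:
  assumes f: "test_function f" and g: "continuous_on UNIV g"
  shows "integrable lborel (\<lambda>q. g q * f q)"
proof -
  have "integrable lborel (\<lambda>q. indicator (closure {q. f q \<noteq> 0}) q *\<^sub>R (g q * f q))"
    using f g by (intro borel_integrable_compact test_function_compact continuous_intros
        test_function_continuous continuous_on_subset[OF g]) auto
  also have "(\<lambda>q. indicator (closure {q. f q \<noteq> 0}) q *\<^sub>R (g q * f q)) = (\<lambda>q. g q * f q)"
  proof
    show "indicator (closure {q. f q \<noteq> 0}) q *\<^sub>R (g q * f q) = g q * f q" for q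
      using notin_support[of q f] by (cases "q \<in> closure {q. f q \<noteq> 0}") simp_all
  qed
  finally show ?thesis .
qed

lemma test_function_integrable: "test_function f \<Longrightarrow> integrable lborel f"
  using continuous_times_test_integrable[of f "\<lambda>_. 1"] by simp

lemma test_function_L2: "test_function f \<Longrightarrow> f \<in> L2 lborel"
  using continuous_times_test_integrable[of f f]
  by (auto simp: L2_def test_function_continuous test_function_measurable power2_eq_square)

lemma bump_function_exists:
  fixes a :: "'a::euclidean_space"
  assumes r: "0 < r"
  obtains f where "test_function f" "\<And>q. 0 \<le> f q" "\<And>q. f q \<noteq> 0 \<Longrightarrow> q \<in> ball a r" "(\<integral>q. f q \<partial>lborel) = 1"
proof -
  \<comment> \<open>A polynomial written out in coordinates, so that smoothness follows from the
    rules for sums and products; it is positive exactly on the open ball.\<close>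
  define p where "p q = r\<^sup>2 - (\<Sum>b\<in>Basis. ((q - a) \<bullet> b) * ((q - a) \<bullet> b))" for q
  have p: "p q = r\<^sup>2 - (dist a q)\<^sup>2" for q
    unfolding p_def by (simp add: euclidean_inner[symmetric] dot_square_norm dist_norm norm_minus_commute)
  have "smooth (\<lambda>q. r\<^sup>2 + (-1) * (\<Sum>b\<in>Basis. (q \<bullet> b + (- (a \<bullet> b))) * (q \<bullet> b + (- (a \<bullet> b)))))"
    by (intro allI Ck_add Ck_const Ck_mult smooth_sum[rule_format] Ck_linear bounded_linear_inner_left) auto
  then have sp: "smooth p" by (simp add: p_def[abs_def] inner_diff_left)
  define g where "g q = exp_recip 1 (p q)" for q
  have pos: "g q > 0 \<longleftrightarrow> q \<in> ball a r" and nn: "g q \<ge> 0" for q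
    using r abs_less_iff power2_less_imp_less[of "dist a q" r] power_strict_mono[of "dist a q" r 2]
    by (auto simp: g_def exp_recip_def p)
  have g: "test_function g"
  proof (rule test_functionI)
    show "smooth g" unfolding g_def using Ck_exp_recip[OF sp] by blast
    show "g q = 0" if "q \<notin> cball a r" for q
      using that pos[of q] nn[of q] by auto
  qed simp
  define c where "c = (\<integral>q. g q \<partial>lborel)"
  have "c > 0"
  proof -
    have "c \<noteq> 0"
    proof
      assume "c = 0"
      then have "AE q in lborel. g q = 0"
        using integral_nonneg_eq_0_iff_AE[OF test_function_integrable[OF g]] nn by (simp add: c_def)
      then have "AE q in lborel. q \<notin> ball a r"
        by (rule eventually_mono) (metis less_irrefl pos)
      then have "emeasure lborel (ball a r) = 0"
        by (subst (asm) AE_iff_measurable[of "ball a r"]) auto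
      then have "measure lborel (ball a r) = 0"
        by (simp add: measure_def)
      then show False
        using content_ball_pos[OF r, of a] by simp
    qed
    moreover have "c \<ge> 0" unfolding c_def by (intro integral_nonneg_AE) (simp add: nn)
    ultimately show ?thesis by simp
  qed
  show thesis
  proof (rule that[of "\<lambda>q. (1 / c) * g q"])
    show "test_function (\<lambda>q. (1 / c) * g q)"
      using test_function_lin[OF g g, of "1 / c" 0] by simp
    show "0 \<le> (1 / c) * g q" for q using \<open>c > 0\<close> nn[of q] by simp
    show "q \<in> ball a r" if "(1 / c) * g q \<noteq> 0" for q
      using that pos[of q] nn[of q] by auto
    show "(\<integral>q. (1 / c) * g q \<partial>lborel) = 1"
      using \<open>c > 0\<close> by (simp add: c_def)
  qed
qed

section \<open>Horizontal vector fields\<close>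

text \<open>The left-invariant field generated by \<open>(a, b, 0)\<close>. For smooth
  \<open>f\<close> it is the combination of \<open>X_field\<close> and \<open>Y_field\<close> with
  coefficients \<open>a\<close> and \<open>b\<close>; a single direction vector makes its flow
  visible.\<close>

definition hfield :: "real^'n::finite \<Rightarrow> real^'n \<Rightarrow> ('n heis \<Rightarrow> real) \<Rightarrow> 'n heis \<Rightarrow> real" where
  "hfield a b f q = dir_deriv (a, b, 2 * (a \<bullet> fst (snd q) - fst q \<bullet> b)) f q"

lemma linear_dir_deriv: "smooth f \<Longrightarrow> linear (\<lambda>v. dir_deriv v f q)"
  unfolding dir_deriv_def by (intro linear_frechet_derivative smooth_differentiable)

lemma X_field_eq_hfield:
  fixes f :: "'n::finite heis \<Rightarrow> real"
  assumes "smooth f"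
  shows "X_field i f = hfield (axis i 1) 0 f"
proof
  fix q :: "'n heis"
  obtain x y z where q: "q = (x, y, z)" by (cases q)
  interpret linear "\<lambda>v. dir_deriv v f q" by (rule linear_dir_deriv[OF assms])
  have "(axis i 1, 0, 2 * y $ i) = (axis i 1, 0, 0) + (2 * y $ i) *\<^sub>R ((0, 0, 1) :: 'n heis)"
    by simp
  then have "dir_deriv (axis i 1, 0, 2 * y $ i) f q
      = dir_deriv (axis i 1, 0, 0) f q + 2 * y $ i * dir_deriv (0, 0, 1) f q"
    by (simp only: add scale real_scaleR_def)
  then show "X_field i f q = hfield (axis i 1) 0 f q"
    by (simp add: q X_field_def hfield_def inner_axis')
qed

lemma Y_field_eq_hfield:
  fixes f :: "'n::finite heis \<Rightarrow> real"
  assumes "smooth f"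
  shows "Y_field i f = hfield 0 (axis i 1) f"
proof
  fix q :: "'n heis"
  obtain x y z where q: "q = (x, y, z)" by (cases q)
  interpret linear "\<lambda>v. dir_deriv v f q" by (rule linear_dir_deriv[OF assms])
  have "(0, axis i 1, - (2 * x $ i)) = (0, axis i 1, 0) + (- (2 * x $ i)) *\<^sub>R ((0, 0, 1) :: 'n heis)"
    by simp
  then have "dir_deriv (0, axis i 1, - (2 * x $ i)) f q
      = dir_deriv (0, axis i 1, 0) f q + - (2 * x $ i) * dir_deriv (0, 0, 1) f q"
    by (simp only: add scale real_scaleR_def)
  then show "Y_field i f q = hfield 0 (axis i 1) f q"
    by (simp add: q Y_field_def hfield_def inner_axis)
qed

lemma hfield_sum:
  fixes f :: "'n::finite heis \<Rightarrow> real"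
  assumes "smooth f"
  shows "hfield a b f q = (\<Sum>i\<in>UNIV. a $ i * X_field i f q) + (\<Sum>i\<in>UNIV. b $ i * Y_field i f q)"
proof -
  obtain x y z where q: "q = (x, y, z)" by (cases q)
  interpret linear "\<lambda>v. dir_deriv v f q" by (rule linear_dir_deriv[OF assms])
  have vec: "(\<Sum>i\<in>UNIV. c $ i *\<^sub>R axis i 1) = c" for c :: "real^'n"
    using basis_expansion[of c] by (simp add: scalar_mult_eq_scaleR)
  have "(\<Sum>i\<in>UNIV. a $ i *\<^sub>R (axis i 1, 0, 2 * y $ i)) + (\<Sum>i\<in>UNIV. b $ i *\<^sub>R (0, axis i 1, - (2 * x $ i)))
      = (\<Sum>i\<in>UNIV. a $ i *\<^sub>R axis i 1, \<Sum>i\<in>UNIV. b $ i *\<^sub>R axis i 1,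
         (\<Sum>i\<in>UNIV. 2 * (a $ i * y $ i)) - (\<Sum>i\<in>UNIV. 2 * (x $ i * b $ i)))"
    by (simp add: sum_prod sum_negf algebra_simps)
  also have "\<dots> = (a, b, 2 * (a \<bullet> y - x \<bullet> b))"
    unfolding vec by (simp add: inner_vec_def sum_distrib_left right_diff_distrib)
  finally have v: "(a, b, 2 * (a \<bullet> y - x \<bullet> b))
      = (\<Sum>i\<in>UNIV. a $ i *\<^sub>R (axis i 1, 0, 2 * y $ i)) + (\<Sum>i\<in>UNIV. b $ i *\<^sub>R (0, axis i 1, - (2 * x $ i)))"
    by simp
  have "hfield a b f q = dir_deriv ((\<Sum>i\<in>UNIV. a $ i *\<^sub>R (axis i 1, 0, 2 * y $ i))
      + (\<Sum>i\<in>UNIV. b $ i *\<^sub>R (0, axis i 1, - (2 * x $ i)))) f q"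
    by (simp only: hfield_def q fst_conv snd_conv v)
  also have "\<dots> = (\<Sum>i\<in>UNIV. a $ i * dir_deriv (axis i 1, 0, 2 * y $ i) f q)
      + (\<Sum>i\<in>UNIV. b $ i * dir_deriv (0, axis i 1, - (2 * x $ i)) f q)"
    by (simp only: add scale real_scaleR_def sum)
  also have "\<dots> = (\<Sum>i\<in>UNIV. a $ i * X_field i f q) + (\<Sum>i\<in>UNIV. b $ i * Y_field i f q)"
    by (simp add: X_field_eq_hfield[OF assms] Y_field_eq_hfield[OF assms] hfield_def q inner_axis inner_axis')
  finally show ?thesis .
qed

lemma axis_heis_Basis: "(axis i 1, 0, 0) \<in> (Basis :: 'n::finite heis set)"
  "(0, axis i 1, 0) \<in> (Basis :: 'n heis set)" "(0, 0, 1) \<in> (Basis :: 'n heis set)"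
  by (auto simp: heis_Basis)

lemma test_function_X_field:
  fixes f :: "'n::finite heis \<Rightarrow> real"
  assumes f: "test_function f"
  shows "test_function (X_field i f)"
proof -
  have "bounded_linear (\<lambda>q :: 'n heis. 2 * fst (snd q) $ i)"
    by (intro bounded_linear_mult_right[THEN bounded_linear_compose]
        bounded_linear_vec_nth[THEN bounded_linear_compose]
        bounded_linear_compose[OF bounded_linear_fst] bounded_linear_snd)
  then have s: "smooth (\<lambda>q :: 'n heis. 2 * fst (snd q) $ i)" by (intro allI Ck_linear)
  have "X_field i f = (\<lambda>q. 1 * dir_deriv (axis i 1, 0, 0) f q + 1 * (2 * fst (snd q) $ i * dir_deriv (0, 0, 1) f q))"
    by (auto simp: X_field_def)
  then show ?thesis
    by (simp only: test_function_lin test_function_mult[OF _ s] test_function_dir_deriv f axis_heis_Basis)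
qed

lemma test_function_Y_field:
  fixes f :: "'n::finite heis \<Rightarrow> real"
  assumes f: "test_function f"
  shows "test_function (Y_field i f)"
proof -
  have "bounded_linear (\<lambda>q :: 'n heis. 2 * fst q $ i)"
    by (intro bounded_linear_mult_right[THEN bounded_linear_compose]
        bounded_linear_vec_nth[THEN bounded_linear_compose] bounded_linear_fst)
  then have s: "smooth (\<lambda>q :: 'n heis. 2 * fst q $ i)" by (intro allI Ck_linear)
  have "Y_field i f = (\<lambda>q. 1 * dir_deriv (0, axis i 1, 0) f q + (-1) * (2 * fst q $ i * dir_deriv (0, 0, 1) f q))"
    by (auto simp: Y_field_def)
  then show ?thesis
    by (simp only: test_function_lin test_function_mult[OF _ s] test_function_dir_deriv f axis_heis_Basis)
qed

lemma test_function_sub_laplacian: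
  assumes f: "test_function f"
  shows "test_function (sub_laplacian f)"
proof -
  have "test_function (\<lambda>q. 1 * X_field i (X_field i f) q + 1 * Y_field i (Y_field i f) q)" for i
    by (intro test_function_lin test_function_X_field test_function_Y_field f)
  then show ?thesis
    unfolding sub_laplacian_def[abs_def] by (intro test_function_sum) simp_all
qed

lemma test_function_hfield:
  assumes f: "test_function f"
  shows "test_function (hfield a b f)"
proof -
  have X: "test_function (\<lambda>q. \<Sum>i\<in>UNIV. a $ i * X_field i f q)"
    using test_function_lin[OF test_function_X_field[OF f] test_function_X_field[OF f], where b = 0]
    by (intro test_function_sum) simp_all
  have Y: "test_function (\<lambda>q. \<Sum>i\<in>UNIV. b $ i * Y_field i f q)"
    using test_function_lin[OF test_function_Y_field[OF f] test_function_Y_field[OF f], where b = 0]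
    by (intro test_function_sum) simp_all
  have "hfield a b f = (\<lambda>q. 1 * (\<Sum>i\<in>UNIV. a $ i * X_field i f q) + 1 * (\<Sum>i\<in>UNIV. b $ i * Y_field i f q))"
    using hfield_sum[OF test_function_smooth[OF f]] by (simp add: fun_eq_iff)
  then show ?thesis
    using test_function_lin[OF X Y, of 1 1] by simp
qed

text \<open>The curve is the straight line \<open>q + r *\<^sub>R ?v\<close>. The direction of the
  field is constant along it, because the changes of the two inner products cancel.\<close>

lemma hfield_flow:
  assumes "smooth f"
  shows "((\<lambda>r. f (q \<star> (r *\<^sub>R a, r *\<^sub>R b, 0))) has_real_derivative hfield a b f (q \<star> (r *\<^sub>R a, r *\<^sub>R b, 0))) (at r)"
proof -
  let ?v = "(a, b, 2 * (a \<bullet> fst (snd q) - fst q \<bullet> b))"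
  have g: "q \<star> (r *\<^sub>R a, r *\<^sub>R b, 0) = q + r *\<^sub>R ?v" for r
    by (cases q) (simp add: heis_mult_conv algebra_simps)
  have c: "hfield a b f (q + r *\<^sub>R ?v) = dir_deriv ?v f (q + r *\<^sub>R ?v)"
    by (cases q) (simp add: hfield_def algebra_simps)
  interpret linear "\<lambda>v. dir_deriv v f (q + r *\<^sub>R ?v)" by (rule linear_dir_deriv[OF assms])
  have "((\<lambda>r. q + r *\<^sub>R ?v) has_derivative (\<lambda>h. h *\<^sub>R ?v)) (at r)"
    by (auto intro!: derivative_eq_intros)
  then have "((\<lambda>r. f (q + r *\<^sub>R ?v)) has_derivative (\<lambda>h. dir_deriv (h *\<^sub>R ?v) f (q + r *\<^sub>R ?v))) (at r)"
    by (rule has_derivative_compose) (rule smooth_has_derivative[OF assms])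
  moreover have "(\<lambda>h. dir_deriv (h *\<^sub>R ?v) f (q + r *\<^sub>R ?v)) = (*) (hfield a b f (q + r *\<^sub>R ?v))"
    unfolding c scale by (simp add: fun_eq_iff mult.commute)
  ultimately show ?thesis
    unfolding g has_field_derivative_def by simp
qed

text \<open>Preparation for two averaging arguments over the unit segment of the flow; the indicator
  turns the segment into a function on the whole product space, as Fubini and Tonelli need.\<close>

lemma
  fixes f :: "'n::finite heis \<Rightarrow> real" and a b :: "real^'n"
  assumes f: "test_function f"
  defines "F \<equiv> \<lambda>r q. indicator {0..1::real} r * hfield a b f (q \<star> (r *\<^sub>R a, r *\<^sub>R b, 0))"
  shows hfield_FTC: "(\<integral>r. F r q \<partial>lborel) = f (q \<star> (a, b, 0)) - f q"
    and hfield_F_measurable: "(\<lambda>(r, q). F r q) \<in> borel_measurable (lborel \<Otimes>\<^sub>M lborel)"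
    and hfield_F_bounded: "\<exists>B. \<forall>r q. \<bar>F r q\<bar> \<le> B"
proof -
  note hf = test_function_hfield[OF f]
  have "(\<integral>r. hfield a b f (q \<star> (r *\<^sub>R a, r *\<^sub>R b, 0)) * indicator {0..1} r \<partial>lborel)
      = f (q \<star> (1 *\<^sub>R a, 1 *\<^sub>R b, 0)) - f (q \<star> (0 *\<^sub>R a, 0 *\<^sub>R b, 0))"
  proof (rule integral_FTC_Icc_real)
    have "continuous_on UNIV (\<lambda>r. hfield a b f (q \<star> (r *\<^sub>R a, r *\<^sub>R b, 0)))"
      by (intro continuous_on_compose2[OF test_function_continuous[OF hf, of UNIV]] continuous_intros) auto
    then show "isCont (\<lambda>r. hfield a b f (q \<star> (r *\<^sub>R a, r *\<^sub>R b, 0))) x" for x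
      by (simp add: continuous_on_eq_continuous_at)
    show "((\<lambda>r. f (q \<star> (r *\<^sub>R a, r *\<^sub>R b, 0))) has_real_derivative
        hfield a b f (q \<star> (x *\<^sub>R a, x *\<^sub>R b, 0))) (at x)" for x
      by (rule hfield_flow[OF test_function_smooth[OF f]])
  qed simp
  then show "(\<integral>r. F r q \<partial>lborel) = f (q \<star> (a, b, 0)) - f q"
    using heis_mult_e(2)[of q] by (simp add: F_def mult.commute heis_e_def)
  have [measurable]: "hfield a b f \<in> borel_measurable borel"
    by (rule test_function_measurable[OF hf])
  have [measurable]: "(\<lambda>p. snd p \<star> (fst p *\<^sub>R a, fst p *\<^sub>R b, 0)) \<in> borel_measurable (lborel \<Otimes>\<^sub>M lborel)"
  proof -
    have "(\<lambda>p. snd p \<star> (fst p *\<^sub>R a, fst p *\<^sub>R b, 0)) \<in> borel_measurable (borel :: (real \<times> 'n heis) measure)"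
      by (intro borel_measurable_continuous_onI continuous_intros)
    then show ?thesis by (simp add: lborel_prod)
  qed
  show "(\<lambda>(r, q). F r q) \<in> borel_measurable (lborel \<Otimes>\<^sub>M lborel)"
    unfolding F_def split_beta by measurable
  obtain B where B: "\<And>q. \<bar>hfield a b f q\<bar> \<le> B"
    using test_function_bounded[OF hf] by blast
  show "\<exists>B. \<forall>r q. \<bar>F r q\<bar> \<le> B"
  proof (intro exI allI)
    show "\<bar>F r q\<bar> \<le> B" for r q
      using B[of "q \<star> (r *\<^sub>R a, r *\<^sub>R b, 0)"] by (auto simp: F_def indicator_def intro: order_trans[OF abs_ge_zero])
  qed
qed

text \<open>The flow is right translation, which preserves the measure. Averaging over the flow
  therefore leaves the integral of \<open>hfield a b f\<close> unchanged, but also turns it into the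
  integral of \<open>f (q \<star> (a, b, 0)) - f q\<close>, which is 0 by the same
  invariance.\<close>

lemma hfield_integral:
  fixes f :: "'n::finite heis \<Rightarrow> real"
  assumes f: "test_function f"
  shows "(\<integral>q. hfield a b f q \<partial>lborel) = 0"
proof -
  define F where "F r q = indicator {0..1::real} r * hfield a b f (q \<star> (r *\<^sub>R a, r *\<^sub>R b, 0))" for r q
  note hf = test_function_hfield[OF f]
  have [measurable]: "hfield a b f \<in> borel_measurable borel"
    by (rule test_function_measurable[OF hf])
  have "f \<in> borel_measurable borel" by (rule test_function_measurable[OF f])
  have Fq: "integrable lborel (F r)" "(\<integral>q. F r q \<partial>lborel) = indicator {0..1} r * (\<integral>q. hfield a b f q \<partial>lborel)"
    "(\<integral>q. norm (F r q) \<partial>lborel) = indicator {0..1} r * (\<integral>q. norm (hfield a b f q) \<partial>lborel)" for r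
    using integrable_preserving[OF distr_heis_mult_right[of "(r *\<^sub>R a, r *\<^sub>R b, 0)"], of "hfield a b f"]
      integral_preserving[OF distr_heis_mult_right[of "(r *\<^sub>R a, r *\<^sub>R b, 0)"], of "hfield a b f"]
      integral_preserving[OF distr_heis_mult_right[of "(r *\<^sub>R a, r *\<^sub>R b, 0)"], of "\<lambda>q. norm (hfield a b f q)"]
      test_function_integrable[OF hf] by (auto simp: F_def[abs_def] abs_mult)
  have int: "integrable (lborel \<Otimes>\<^sub>M lborel) (\<lambda>(r, q). F r q)"
  proof (rule lborel_pair.Fubini_integrable)
    show "(\<lambda>(r, q). F r q) \<in> borel_measurable (lborel \<Otimes>\<^sub>M lborel)"
      unfolding F_def by (rule hfield_F_measurable[OF f])
    have "integrable lborel (\<lambda>r. indicator {0..1::real} r * (\<integral>q. norm (hfield a b f q) \<partial>lborel))"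
      by (intro integrable_mult_left) (simp add: integrable_indicator_iff)
    then show "integrable lborel (\<lambda>r. \<integral>q. norm (case (r, q) of (r, q) \<Rightarrow> F r q) \<partial>lborel)"
      by (simp add: Fq(3)[unfolded real_norm_def])
  qed (simp add: Fq)
  have "(\<integral>q. \<integral>r. F r q \<partial>lborel \<partial>lborel) = (\<integral>r. \<integral>q. F r q \<partial>lborel \<partial>lborel)"
    by (rule lborel_pair.Fubini_integral[OF int])
  also have "\<dots> = (\<integral>q. hfield a b f q \<partial>lborel)"
    by (simp add: Fq)
  also have "(\<integral>q. \<integral>r. F r q \<partial>lborel \<partial>lborel) = (\<integral>q. f (q \<star> (a, b, 0)) - f q \<partial>lborel)"
    unfolding F_def hfield_FTC[OF f] ..
  also have "\<dots> = 0"
    using integrable_preserving[OF distr_heis_mult_right[of "(a, b, 0)"] _ \<open>f \<in> borel_measurable borel\<close>]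
      integral_preserving[OF distr_heis_mult_right[of "(a, b, 0)"] _ \<open>f \<in> borel_measurable borel\<close>]
      test_function_integrable[OF f] by simp
  finally show ?thesis by simp
qed

text \<open>Cauchy-Schwarz on the unit segment bounds the squared increment by the average of
  \<open>(F r q)^2\<close> over \<open>r\<close>; by right invariance every slice in
  \<open>r\<close> contributes the same norm.\<close>

lemma hfield_translation:
  fixes f :: "'n::finite heis \<Rightarrow> real"
  assumes f: "test_function f"
  shows "norm_L2 lborel (\<lambda>q. f (q \<star> (a, b, 0)) - f q) \<le> norm_L2 lborel (hfield a b f)"
proof -
  define F where "F r q = indicator {0..1::real} r * hfield a b f (q \<star> (r *\<^sub>R a, r *\<^sub>R b, 0))" for r q
  note hf = test_function_hfield[OF f]
  have [measurable]: "hfield a b f \<in> borel_measurable borel"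
    by (rule test_function_measurable[OF hf])
  have [measurable]: "f \<in> borel_measurable borel" by (rule test_function_measurable[OF f])
  have [measurable]: "(\<lambda>(r, q). F r q) \<in> borel_measurable (lborel \<Otimes>\<^sub>M lborel)"
    unfolding F_def by (rule hfield_F_measurable[OF f])
  obtain B where B: "\<bar>F r q\<bar> \<le> B" for r q
    using hfield_F_bounded[OF f, of a b] unfolding F_def by blast
  have m1[measurable]: "(\<lambda>r. F r q) \<in> borel_measurable lborel" for q
    using measurable_Pair1[of "\<lambda>(r, q). F r q" lborel lborel borel q] by simp
  have i2: "integrable lborel (\<lambda>r. (F r q)\<^sup>2)" for q
  proof (rule Bochner_Integration.integrable_bound)
    show "integrable lborel (\<lambda>r. indicator {0..1::real} r * B\<^sup>2)"
      by (intro integrable_mult_left) (simp add: integrable_indicator_iff)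
    have "(F r q)\<^sup>2 \<le> indicator {0..1::real} r * B\<^sup>2" for r
      using power_mono[OF B[of r q], of 2] by (auto simp: F_def indicator_def)
    then show "AE r in lborel. norm ((F r q)\<^sup>2) \<le> norm (indicator {0..1::real} r * B\<^sup>2)"
      by (intro AE_I2) (simp add: abs_mult)
  qed simp
  have pt: "(f (q \<star> (a, b, 0)) - f q)\<^sup>2 \<le> (\<integral>r. (F r q)\<^sup>2 \<partial>lborel)" for q
  proof -
    let ?i = "indicator {0..1::real} :: real \<Rightarrow> real"
    have i2': "(?i r)\<^sup>2 = ?i r" for r by (simp add: indicator_def)
    have i: "?i \<in> L2 lborel" and F: "(\<lambda>r. F r q) \<in> L2 lborel"
      using i2 by (auto simp: L2_def i2' integrable_indicator_iff)
    have "\<bar>ip lborel ?i (\<lambda>r. F r q)\<bar> \<le> norm_L2 lborel ?i * norm_L2 lborel (\<lambda>r. F r q)"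
      by (rule ip_bound[OF i F])
    moreover have "ip lborel ?i (\<lambda>r. F r q) = f (q \<star> (a, b, 0)) - f q"
      unfolding ip_def hfield_FTC[OF f, of a b q, symmetric] F_def
      by (intro Bochner_Integration.integral_cong) (auto simp: indicator_def)
    moreover have "norm_L2 lborel ?i = 1"
      by (simp add: norm_L2_def i2')
    ultimately have "\<bar>f (q \<star> (a, b, 0)) - f q\<bar>\<^sup>2 \<le> (norm_L2 lborel (\<lambda>r. F r q))\<^sup>2"
      by (intro power_mono) auto
    also have "\<dots> = (\<integral>r. (F r q)\<^sup>2 \<partial>lborel)"
      unfolding norm_L2_power2 ip_def by (simp add: power2_eq_square)
    finally show ?thesis by simp
  qed
  have inner: "(\<integral>\<^sup>+q. ennreal ((F r q)\<^sup>2) \<partial>lborel)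
      = indicator {0..1} r * ennreal ((norm_L2 lborel (hfield a b f))\<^sup>2)" for r
  proof -
    have "(\<integral>\<^sup>+q. ennreal ((F r q)\<^sup>2) \<partial>lborel)
        = (\<integral>\<^sup>+q. indicator {0..1} r * ennreal ((hfield a b f (q \<star> (r *\<^sub>R a, r *\<^sub>R b, 0)))\<^sup>2) \<partial>lborel)"
      by (intro nn_integral_cong) (auto simp: F_def indicator_def)
    also have "\<dots> = indicator {0..1} r * (\<integral>\<^sup>+q. ennreal ((hfield a b f (q \<star> (r *\<^sub>R a, r *\<^sub>R b, 0)))\<^sup>2) \<partial>lborel)"
      by (rule nn_integral_cmult) measurable
    also have "(\<integral>\<^sup>+q. ennreal ((hfield a b f (q \<star> (r *\<^sub>R a, r *\<^sub>R b, 0)))\<^sup>2) \<partial>lborel)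
        = (\<integral>\<^sup>+q. ennreal ((hfield a b f q)\<^sup>2) \<partial>lborel)"
      by (rule nn_integral_preserving[OF distr_heis_mult_right, where f = "\<lambda>q. ennreal ((hfield a b f q)\<^sup>2)"]) simp_all
    also have "\<dots> = ennreal ((norm_L2 lborel (hfield a b f))\<^sup>2)"
      using L2_integrable[OF test_function_L2[OF hf]]
      unfolding norm_L2_power2 ip_def by (simp add: nn_integral_eq_integral flip: power2_eq_square)
    finally show ?thesis .
  qed
  have "(\<integral>\<^sup>+q. ennreal ((f (q \<star> (a, b, 0)) - f q)\<^sup>2) \<partial>lborel)
      \<le> (\<integral>\<^sup>+q. \<integral>\<^sup>+r. ennreal ((F r q)\<^sup>2) \<partial>lborel \<partial>lborel)"
    using pt i2 by (intro nn_integral_mono) (simp add: nn_integral_eq_integral)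
  also have "\<dots> = (\<integral>\<^sup>+r. \<integral>\<^sup>+q. ennreal ((F r q)\<^sup>2) \<partial>lborel \<partial>lborel)"
    by (rule lborel_pair.Fubini') (simp add: split_beta')
  also have "\<dots> = (\<integral>\<^sup>+r. indicator {0..1::real} r * ennreal ((norm_L2 lborel (hfield a b f))\<^sup>2) \<partial>lborel)"
    by (simp only: inner)
  also have "\<dots> = ennreal ((norm_L2 lborel (hfield a b f))\<^sup>2)"
    by (simp add: nn_integral_multc)
  finally have le: "(\<integral>\<^sup>+q. ennreal ((f (q \<star> (a, b, 0)) - f q)\<^sup>2) \<partial>lborel) \<le> ennreal ((norm_L2 lborel (hfield a b f))\<^sup>2)" .
  have "(\<lambda>q. f (q \<star> (a, b, 0)) - f q) \<in> L2 lborel"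
    by (intro L2_diff L2_preserving[OF distr_heis_mult_right] test_function_L2 f) simp
  then have "(norm_L2 lborel (\<lambda>q. f (q \<star> (a, b, 0)) - f q))\<^sup>2 \<le> (norm_L2 lborel (hfield a b f))\<^sup>2"
    using le by (simp add: nn_integral_eq_integral L2_def norm_L2_def)
  then show ?thesis
    by (rule power2_le_imp_le) (rule norm_L2_nonneg)
qed

lemma hfield_mult:
  assumes "smooth f" "smooth g"
  shows "hfield a b (\<lambda>q. f q * g q) q = f q * hfield a b g q + hfield a b f q * g q"
  unfolding hfield_def
  by (intro dir_deriv_eq has_derivative_mult smooth_has_derivative assms)

text \<open>The product rule, together with the vanishing integral of a horizontal
  derivative.\<close>

lemma hfield_antisym:
  fixes f :: "'n::finite heis \<Rightarrow> real"
  assumes f: "test_function f" and g: "test_function g"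
  shows "ip lborel (hfield a b f) g = - ip lborel f (hfield a b g)"
proof -
  have fg: "test_function (\<lambda>q. f q * g q)"
    by (rule test_function_mult[OF g test_function_smooth[OF f]])
  have "0 = (\<integral>q. f q * hfield a b g q + hfield a b f q * g q \<partial>lborel)"
    using hfield_integral[OF fg, of a b]
    by (simp add: hfield_mult test_function_smooth f g)
  also have "\<dots> = ip lborel f (hfield a b g) + ip lborel (hfield a b f) g"
    unfolding ip_def
    by (intro Bochner_Integration.integral_add L2_integrable_mult test_function_L2 test_function_hfield f g)
  finally show ?thesis by simp
qed

text \<open>Integration by parts in each field produces the Dirichlet form, from which symmetry and
  sign are both read off.\<close>

lemma ip_sub_laplacian:
  fixes f g :: "'n::finite heis \<Rightarrow> real"
  assumes f: "test_function f" and g: "test_function g"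
  shows "ip lborel (sub_laplacian f) g
    = - (\<Sum>i\<in>UNIV. ip lborel (X_field i f) (X_field i g) + ip lborel (Y_field i f) (Y_field i g))"
proof -
  note L = test_function_L2 test_function_X_field test_function_Y_field f g
  have X: "ip lborel (X_field i (X_field i f)) g = - ip lborel (X_field i f) (X_field i g)" for i
    unfolding X_field_eq_hfield[OF test_function_smooth[OF test_function_X_field[OF f]]]
      X_field_eq_hfield[OF test_function_smooth[OF g]]
    by (rule hfield_antisym[OF test_function_X_field[OF f] g])
  have Y: "ip lborel (Y_field i (Y_field i f)) g = - ip lborel (Y_field i f) (Y_field i g)" for i
    unfolding Y_field_eq_hfield[OF test_function_smooth[OF test_function_Y_field[OF f]]]
      Y_field_eq_hfield[OF test_function_smooth[OF g]]
    by (rule hfield_antisym[OF test_function_Y_field[OF f] g])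
  have "ip lborel (sub_laplacian f) g
      = (\<integral>q. (\<Sum>i\<in>UNIV. X_field i (X_field i f) q * g q + Y_field i (Y_field i f) q * g q) \<partial>lborel)"
    by (simp add: ip_def sub_laplacian_def sum_distrib_right distrib_right)
  also have "\<dots> = (\<Sum>i\<in>UNIV. ip lborel (X_field i (X_field i f)) g + ip lborel (Y_field i (Y_field i f)) g)"
    unfolding ip_def
    by (subst Bochner_Integration.integral_sum)
      (auto intro!: sum.cong Bochner_Integration.integral_add Bochner_Integration.integrable_add L2_integrable_mult L)
  finally show ?thesis
    by (simp add: X Y sum_negf[symmetric])
qed

lemma sub_laplacian_sym:
  assumes "test_function f" "test_function g"
  shows "ip lborel (sub_laplacian f) g = ip lborel f (sub_laplacian g)"
  using ip_sub_laplacian[OF assms] ip_sub_laplacian[OF assms(2,1)]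
  by (simp add: ip_commute)

lemma sub_laplacian_nonpos:
  assumes "test_function f"
  shows "ip lborel (sub_laplacian f) f \<le> 0"
  unfolding ip_sub_laplacian[OF assms assms] by (simp add: sum_nonneg ip_self_nonneg)

text \<open>The Dirichlet form contains all the horizontal derivatives, and
  \<open>hfield a b f\<close> is a combination of them. The constant comes from Cauchy-Schwarz in
  the index, with the factor 2 from separating the X part from the Y part.\<close>

lemma horizontal_translation:
  fixes f :: "'n::finite heis \<Rightarrow> real"
  assumes f: "test_function f"
  shows "norm_L2 lborel (\<lambda>q. f (q \<star> (a, b, 0)) - f q)
    \<le> sqrt (2 * ((norm a)\<^sup>2 + (norm b)\<^sup>2)) * sqrt (- ip lborel (sub_laplacian f) f)"
proof -
  let ?X = "\<lambda>q. \<Sum>i\<in>UNIV. (X_field i f q)\<^sup>2" and ?Y = "\<lambda>q. \<Sum>i\<in>UNIV. (Y_field i f q)\<^sup>2"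
  let ?C = "2 * ((norm a)\<^sup>2 + (norm b)\<^sup>2)"
  have n: "(\<Sum>i\<in>UNIV. (c $ i)\<^sup>2) = (norm c)\<^sup>2" for c :: "real^'n"
    unfolding power2_norm_eq_inner inner_vec_def by (simp add: power2_eq_square)
  have pt: "(hfield a b f q)\<^sup>2 \<le> ?C * (?X q + ?Y q)" for q
  proof -
    let ?A = "\<Sum>i\<in>UNIV. a $ i * X_field i f q" and ?B = "\<Sum>i\<in>UNIV. b $ i * Y_field i f q"
    have "(hfield a b f q)\<^sup>2 = (?A + ?B)\<^sup>2"
      by (simp add: hfield_sum[OF test_function_smooth[OF f]])
    also have "\<dots> \<le> 2 * ?A\<^sup>2 + 2 * ?B\<^sup>2"
      using sum_squares_bound[of ?A ?B] by (simp add: power2_sum)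
    also have "\<dots> \<le> 2 * ((norm a)\<^sup>2 * ?X q) + 2 * ((norm b)\<^sup>2 * ?Y q)"
      using Cauchy_Schwarz_ineq_sum[of "\<lambda>i. a $ i" "\<lambda>i. X_field i f q" UNIV]
        Cauchy_Schwarz_ineq_sum[of "\<lambda>i. b $ i" "\<lambda>i. Y_field i f q" UNIV] by (simp add: n)
    also have "\<dots> \<le> ?C * (?X q + ?Y q)"
      by (simp add: algebra_simps sum_nonneg)
    finally show ?thesis .
  qed
  have int: "integrable lborel (\<lambda>q. (X_field i f q)\<^sup>2)" "integrable lborel (\<lambda>q. (Y_field i f q)\<^sup>2)" for i
    by (intro L2_integrable test_function_L2 test_function_X_field test_function_Y_field f)+
  have "(norm_L2 lborel (hfield a b f))\<^sup>2 = (\<integral>q. (hfield a b f q)\<^sup>2 \<partial>lborel)"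
    by (simp add: norm_L2_def)
  also have "\<dots> \<le> (\<integral>q. ?C * (?X q + ?Y q) \<partial>lborel)"
    by (intro integral_mono pt L2_integrable test_function_L2 test_function_hfield f
        integrable_mult_right Bochner_Integration.integrable_add Bochner_Integration.integrable_sum int)
  also have "\<dots> = ?C * (- ip lborel (sub_laplacian f) f)"
    unfolding ip_sub_laplacian[OF f f] using int
    by (simp add: ip_def power2_eq_square sum.distrib)
  finally have "norm_L2 lborel (hfield a b f) \<le> sqrt (?C * (- ip lborel (sub_laplacian f) f))"
    by (rule real_le_rsqrt)
  then show ?thesis
    using hfield_translation[OF f, of a b] by (simp only: real_sqrt_mult)
qed

text \<open>Horizontal elements generate the group; the centre is reached through commutators.\<close>

lemma translation_bound:
  fixes p :: "'n::finite heis"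
  shows "\<exists>C\<ge>0. \<forall>f. test_function f \<longrightarrow>
    norm_L2 lborel (\<lambda>q. f (q \<star> p) - f q) \<le> C * sqrt (- ip lborel (sub_laplacian f) f)"
proof -
  define P where "P p \<longleftrightarrow> (\<exists>C\<ge>0. \<forall>f. test_function f \<longrightarrow>
    norm_L2 lborel (\<lambda>q. f (q \<star> p) - f q) \<le> C * sqrt (- ip lborel (sub_laplacian f) f))" for p :: "'n heis"
  have hor: "P (a, b, 0)" for a b
    unfolding P_def
    by (intro exI[of _ "sqrt (2 * ((norm a)\<^sup>2 + (norm b)\<^sup>2))"] conjI allI impI horizontal_translation) simp_all
  \<comment> \<open>The increment is split at \<open>q \<star> p\<close>; right invariance reduces
    the first piece to a translation by \<open>p'\<close>, and the constants add.\<close>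
  have mult: "P (p \<star> p')" if pp: "P p" "P p'" for p p'
  proof -
    obtain C where C: "C \<ge> 0"
      "\<And>f. test_function f \<Longrightarrow> norm_L2 lborel (\<lambda>q. f (q \<star> p) - f q) \<le> C * sqrt (- ip lborel (sub_laplacian f) f)"
      using pp(1) unfolding P_def by blast
    obtain C' where C': "C' \<ge> 0"
      "\<And>f. test_function f \<Longrightarrow> norm_L2 lborel (\<lambda>q. f (q \<star> p') - f q) \<le> C' * sqrt (- ip lborel (sub_laplacian f) f)"
      using pp(2) unfolding P_def by blast
    have "norm_L2 lborel (\<lambda>q. f (q \<star> (p \<star> p')) - f q) \<le> (C + C') * sqrt (- ip lborel (sub_laplacian f) f)"
      if f: "test_function f" for f
    proof -
      note fL = test_function_L2[OF f]
      have R: "(\<lambda>q. f (q \<star> r)) \<in> L2 lborel" for r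
        by (intro L2_preserving[OF distr_heis_mult_right] fL) simp
      have "norm_L2 lborel (\<lambda>q. f (q \<star> (p \<star> p')) - f q)
          \<le> norm_L2 lborel (\<lambda>q. f (q \<star> (p \<star> p')) - f (q \<star> p)) + norm_L2 lborel (\<lambda>q. f (q \<star> p) - f q)"
        by (rule norm_L2_triangle[OF R fL R])
      also have "norm_L2 lborel (\<lambda>q. f (q \<star> (p \<star> p')) - f (q \<star> p)) = norm_L2 lborel (\<lambda>q. f (q \<star> p') - f q)"
        using norm_L2_preserving[OF distr_heis_mult_right[of p], of "\<lambda>q. f (q \<star> p') - f q"]
          L2_measurable[OF L2_diff[OF R[of p'] fL], simplified]
        by (simp add: heis_mult_assoc)
      finally show ?thesis
        using C(2)[OF f] C'(2)[OF f] by (simp add: algebra_simps)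
    qed
    then show ?thesis
      unfolding P_def using C(1) C'(1) by (intro exI[of _ "C + C'"]) simp
  qed
  obtain a b c where p: "p = (a, b, c)" by (cases p)
  \<comment> \<open>An index is available because types are nonempty, that is, because n is at least
    1.\<close>
  fix i :: 'n
  \<comment> \<open>The group commutator of \<open>(axis i 1, 0, 0)\<close> and
    \<open>(0, axis i s, 0)\<close> is central with last coordinate -4 s, whence
    \<open>s = - (c / 4)\<close>.\<close>
  have "P (((axis i 1, 0, 0) \<star> (0, axis i (- (c / 4)), 0)) \<star> ((- axis i 1, 0, 0) \<star> (0, - axis i (- (c / 4)), 0)))"
    by (intro mult hor)
  also have "((axis i 1, 0, 0) \<star> (0, axis i (- (c / 4)), 0)) \<star> ((- axis i 1, 0, 0) \<star> (0, - axis i (- (c / 4)), 0))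
      = ((0, 0, c) :: 'n heis)"
    by (simp add: heis_mult_conv inner_axis_axis)
  finally have "P ((a, b, 0) \<star> (0, 0, c))"
    by (intro mult hor)
  then show ?thesis
    by (simp add: p P_def)
qed

section \<open>The heat kernel\<close>

text \<open>Fatou's lemma for squares: a pointwise limit inherits square integrability and the
  limiting norm bound. This is how estimates for bumps become estimates for the kernel.\<close>

lemma L2_fatou:
  assumes u: "\<And>k :: nat. u k \<in> L2 M" and lim: "AE x in M. (\<lambda>k. u k x) \<longlonglongrightarrow> v x"
    and v[measurable]: "v \<in> borel_measurable M"
    and le: "\<And>k. norm_L2 M (u k) \<le> c k" and c: "c \<longlonglongrightarrow> c0"
  shows "v \<in> L2 M" "norm_L2 M v \<le> c0"
proof -
  have [measurable]: "u k \<in> borel_measurable M" for k by (rule L2_measurable[OF u])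
  have c0: "0 \<le> c0"
    using le norm_L2_nonneg[of M] by (intro LIMSEQ_le_const[OF c]) (meson order_trans)
  have nn: "(\<integral>\<^sup>+x. ennreal ((u k x)\<^sup>2) \<partial>M) = ennreal ((norm_L2 M (u k))\<^sup>2)" for k
    using L2_integrable[OF u, of k] by (simp add: nn_integral_eq_integral norm_L2_def)
  have "(\<integral>\<^sup>+x. ennreal ((v x)\<^sup>2) \<partial>M) = (\<integral>\<^sup>+x. liminf (\<lambda>k. ennreal ((u k x)\<^sup>2)) \<partial>M)"
  proof (rule nn_integral_cong_AE, use lim in eventually_elim)
    case (elim x)
    then have "(\<lambda>k. ennreal ((u k x)\<^sup>2)) \<longlonglongrightarrow> ennreal ((v x)\<^sup>2)"
      by (intro tendsto_ennrealI tendsto_power)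
    from lim_imp_Liminf[OF sequentially_bot this] show ?case by simp
  qed
  also have "\<dots> \<le> liminf (\<lambda>k. \<integral>\<^sup>+x. ennreal ((u k x)\<^sup>2) \<partial>M)"
    by (rule nn_integral_liminf) measurable
  also have "\<dots> \<le> liminf (\<lambda>k. ennreal ((c k)\<^sup>2))"
    unfolding nn by (intro Liminf_mono always_eventually allI ennreal_leI power_mono le norm_L2_nonneg)
  also have "\<dots> = ennreal (c0\<^sup>2)"
    by (intro lim_imp_Liminf sequentially_bot tendsto_ennrealI tendsto_power c)
  finally have le: "(\<integral>\<^sup>+x. ennreal ((v x)\<^sup>2) \<partial>M) \<le> ennreal (c0\<^sup>2)" .
  then show vL: "v \<in> L2 M"
    by (auto simp: L2_def intro!: integrableI_bounded intro: le_less_trans)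
  have "(norm_L2 M v)\<^sup>2 \<le> c0\<^sup>2"
    using le vL by (simp add: L2_def nn_integral_eq_integral norm_L2_def)
  then show "norm_L2 M v \<le> c0"
    using c0 by (rule power2_le_imp_le)
qed

text \<open>Stands for the point mass at \<open>a\<close>. The explicit radius allows two such
  sequences to be localised with a common index.\<close>

definition delta_seq :: "'a::euclidean_space \<Rightarrow> (nat \<Rightarrow> 'a \<Rightarrow> real) \<Rightarrow> bool" where
  "delta_seq a f \<longleftrightarrow> (\<forall>k. test_function (f k) \<and> (\<forall>q. 0 \<le> f k q) \<and>
     (\<forall>q. f k q \<noteq> 0 \<longrightarrow> dist a q < 1 / real (Suc k)) \<and> (\<integral>q. f k q \<partial>lborel) = 1)"

lemma delta_seq_exists: "\<exists>f. delta_seq (a :: 'a::euclidean_space) f"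
proof -
  have "\<exists>f. test_function f \<and> (\<forall>q. 0 \<le> f q) \<and>
     (\<forall>q. f q \<noteq> 0 \<longrightarrow> dist a q < 1 / real (Suc k)) \<and> (\<integral>q. f q \<partial>lborel) = 1" for k
    by (rule bump_function_exists[of "1 / real (Suc k)" a]) (auto simp: mem_ball)
  then show ?thesis
    unfolding delta_seq_def by (rule choice[OF allI])
qed

lemma delta_seq_test: "delta_seq a f \<Longrightarrow> test_function (f k)"
  by (simp add: delta_seq_def)

text \<open>\<open>f k\<close> is a probability density on the small ball. Integrability is a
  hypothesis, rather than a consequence of continuity of \<open>g\<close>, because the lemma is also
  applied to \<open>K t (f k)\<close>.\<close>

lemma delta_seq_average:
  assumes f: "delta_seq a f" and int: "integrable lborel (\<lambda>q. g q * f k q)"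
    and g: "\<And>q. dist a q < 1 / real (Suc k) \<Longrightarrow> \<bar>g q - L\<bar> \<le> \<epsilon>"
  shows "\<bar>(\<integral>q. g q * f k q \<partial>lborel) - L\<bar> \<le> \<epsilon>"
proof -
  note fi = test_function_integrable[OF delta_seq_test[OF f, of k]]
  have one: "(\<integral>q. f k q \<partial>lborel) = 1" using f by (simp add: delta_seq_def)
  have "(\<integral>q. g q * f k q \<partial>lborel) - L = (\<integral>q. g q * f k q - L * f k q \<partial>lborel)"
    using int fi by (simp add: one)
  also have "\<bar>\<dots>\<bar> \<le> (\<integral>q. \<bar>g q * f k q - L * f k q\<bar> \<partial>lborel)"
    by (rule integral_abs_bound)
  also have "\<dots> \<le> (\<integral>q. \<epsilon> * f k q \<partial>lborel)"
  proof (rule integral_mono)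
    show "\<bar>g q * f k q - L * f k q\<bar> \<le> \<epsilon> * f k q" for q
    proof (cases "f k q = 0")
      case False
      then have "\<bar>g q - L\<bar> \<le> \<epsilon>" "0 \<le> f k q" using f g by (auto simp: delta_seq_def)
      moreover have "\<bar>g q * f k q - L * f k q\<bar> = \<bar>g q - L\<bar> * \<bar>f k q\<bar>"
        by (simp add: abs_mult[symmetric] left_diff_distrib)
      ultimately show ?thesis by (simp add: mult_right_mono)
    qed simp
  qed (use int fi in auto)
  also have "\<dots> = \<epsilon>" by (simp add: one)
  finally show ?thesis .
qed

lemma delta_seq_tendsto:
  assumes f: "delta_seq a f" and g: "continuous_on UNIV g"
  shows "(\<lambda>k. \<integral>q. g q * f k q \<partial>lborel) \<longlonglongrightarrow> g a"
proof (rule LIMSEQ_I)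
  fix e :: real assume "0 < e"
  then have e: "0 < e / 2" by simp
  obtain d where d: "d > 0" "\<And>q. dist q a < d \<Longrightarrow> dist (g q) (g a) < e / 2"
    using g e unfolding continuous_on_iff by (metis UNIV_I)
  obtain N where N: "1 / real (Suc N) < d"
    using nat_approx_posE[OF d(1)] .
  have "norm ((\<integral>q. g q * f k q \<partial>lborel) - g a) < e" if k: "k \<ge> N" for k
  proof -
    have "1 / real (Suc k) \<le> 1 / real (Suc N)" using k by (simp add: frac_le)
    with N have kd: "1 / real (Suc k) < d" by simp
    have "\<bar>(\<integral>q. g q * f k q \<partial>lborel) - g a\<bar> \<le> e / 2"
    proof (rule delta_seq_average[OF f])
      show "integrable lborel (\<lambda>q. g q * f k q)"
        by (intro continuous_times_test_integrable delta_seq_test[OF f] g)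
      fix q assume "dist a q < 1 / real (Suc k)"
      then have "dist q a < d" using kd by (simp add: dist_commute[of q])
      from d(2)[OF this] show "\<bar>g q - g a\<bar> \<le> e / 2" by (simp add: dist_real_def)
    qed
    then show ?thesis using \<open>0 < e\<close> by simp
  qed
  then show "\<exists>no. \<forall>n\<ge>no. norm ((\<integral>q. g q * f n q \<partial>lborel) - g a) < e" by blast
qed

text \<open>The semigroup behind the existential quantifier of \<open>is_heat_kernel\<close> becomes
  a parameter, so that the dilated pair can be shown to be another instance.\<close>

locale heat_kernel =
  fixes h :: "real \<Rightarrow> 'n::finite heis \<Rightarrow> real" and T :: "real \<Rightarrow> ('n heis \<Rightarrow> real) \<Rightarrow> 'n heis \<Rightarrow> real"
  assumes cont: "continuous_on ({0<..} \<times> UNIV) (\<lambda>(t, q). h t q)"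
    and semi: "is_heat_semigroup T"
    and kern: "0 < t \<Longrightarrow> f \<in> L2 lborel \<Longrightarrow> AE q1 in lborel.
       integrable lborel (\<lambda>q2. h t (heis_inv q1 \<star> q2) * f q2) \<and>
       T t f q1 = (\<integral>q2. h t (heis_inv q1 \<star> q2) * f q2 \<partial>lborel)"
begin

lemma h_continuous:
  assumes "0 < t" and g: "continuous_on A g"
  shows "continuous_on A (\<lambda>x. h t (g x))"
proof -
  have "continuous_on A (\<lambda>x. (t, g x))" by (intro continuous_intros g)
  then have "continuous_on A (\<lambda>x. case (t, g x) of (t, q) \<Rightarrow> h t q)"
    by (rule continuous_on_compose2[OF cont]) (use assms in auto)
  then show ?thesis by simp
qed

lemma h_measurable: "0 < t \<Longrightarrow> h t \<in> borel_measurable borel"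
  by (intro borel_measurable_continuous_onI h_continuous continuous_on_id)

text \<open>A representative of \<open>T t f\<close> fixed at every point: \<open>T t f\<close> is
  pinned down only up to null sets, whereas the limits below are taken pointwise.\<close>

definition K :: "real \<Rightarrow> ('n heis \<Rightarrow> real) \<Rightarrow> 'n heis \<Rightarrow> real" where
  "K t f q = (\<integral>q2. h t (heis_inv q \<star> q2) * f q2 \<partial>lborel)"

lemma K_measurable:
  assumes t: "0 < t" and [measurable]: "f \<in> borel_measurable borel"
  shows "K t f \<in> borel_measurable borel"
proof -
  have [measurable]: "h t \<in> borel_measurable borel" by (rule h_measurable[OF t])
  have "(\<lambda>(q, q2). h t (heis_inv q \<star> q2) * f q2) \<in> borel_measurable (borel \<Otimes>\<^sub>M lborel)"
    unfolding split_beta by measurable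
  from lborel.borel_measurable_lebesgue_integral[OF this] show ?thesis
    unfolding K_def .
qed

lemma T_eq_K:
  assumes "0 < t" "f \<in> L2 lborel"
  shows "AE q in lborel. T t f q = K t f q"
  using kern[OF assms] by eventually_elim (simp add: K_def)

lemma T_in_L2: "0 \<le> t \<Longrightarrow> f \<in> L2 lborel \<Longrightarrow> T t f \<in> L2 lborel"
  using semi unfolding is_heat_semigroup_def C0_semigroup_L2_def by blast

lemma K_L2:
  assumes "0 < t" "f \<in> L2 lborel"
  shows "K t f \<in> L2 lborel" "norm_L2 lborel (K t f) = norm_L2 lborel (T t f)"
proof -
  have m: "K t f \<in> borel_measurable lborel"
    using K_measurable[OF assms(1)] L2_measurable[OF assms(2)] by simp
  note L = T_in_L2[OF less_imp_le[OF assms(1)] assms(2)]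
  show "K t f \<in> L2 lborel"
    by (rule L2_cong_AE[OF T_eq_K[OF assms] L m])
  show "norm_L2 lborel (K t f) = norm_L2 lborel (T t f)"
    by (rule norm_L2_cong_AE[OF L2_measurable[OF L] m T_eq_K[OF assms], symmetric])
qed

text \<open>Dominated convergence: for fixed \<open>q\<close> the continuous kernel is bounded on
  the compact product of \<open>{s / 2..s}\<close> and the support of \<open>f\<close>.\<close>

lemma K_left_continuous:
  assumes f: "test_function f" and s: "0 < s"
  shows "(\<lambda>k. K (s - s / real (k + 2)) f q) \<longlonglongrightarrow> K s f q"
proof -
  \<comment> \<open>The shift by 2 keeps the times between \<open>s / 2\<close> and
    \<open>s\<close>, away from 0, where no continuity of the kernel is given.\<close>
  let ?S = "closure {q. f q \<noteq> 0}" and ?r = "\<lambda>k :: nat. s - s / real (k + 2)"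
  have r: "?r k \<in> {s / 2..s}" "0 < ?r k" for k
  proof -
    have "s / real (k + 2) \<le> s / 2" using s by (intro divide_left_mono) auto
    moreover have "s / 2 < s" using s by simp
    moreover have "0 < s / real (k + 2)" using s by simp
    ultimately show "?r k \<in> {s / 2..s}" "0 < ?r k" unfolding atLeastAtMost_iff by linarith+
  qed
  have "continuous_on ({s / 2..s} \<times> ?S) (\<lambda>p. (fst p, heis_inv q \<star> snd p))"
    by (intro continuous_intros)
  then have "continuous_on ({s / 2..s} \<times> ?S) (\<lambda>p. case (fst p, heis_inv q \<star> snd p) of (t, q) \<Rightarrow> h t q)"
    by (rule continuous_on_compose2[OF cont]) (use s in auto)
  then have c: "continuous_on ({s / 2..s} \<times> ?S) (\<lambda>p. h (fst p) (heis_inv q \<star> snd p))"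
    by simp
  have "bounded ((\<lambda>p. h (fst p) (heis_inv q \<star> snd p)) ` ({s / 2..s} \<times> ?S))"
    using f by (intro compact_imp_bounded compact_continuous_image c compact_Times test_function_compact) simp_all
  then obtain B where B: "\<And>r q2. r \<in> {s / 2..s} \<Longrightarrow> q2 \<in> ?S \<Longrightarrow> \<bar>h r (heis_inv q \<star> q2)\<bar> \<le> B"
    unfolding bounded_iff by fastforce
  have lim: "?r \<longlonglongrightarrow> s"
  proof -
    have "(\<lambda>k. s / real k) \<longlonglongrightarrow> 0"
      by (rule lim_const_over_n)
    then have "(\<lambda>k. s / real (k + 2)) \<longlonglongrightarrow> 0"
      by (rule LIMSEQ_ignore_initial_segment)
    from tendsto_diff[OF tendsto_const[of s] this] show ?thesis by simp
  qed
  have [measurable]: "f \<in> borel_measurable borel"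
    by (rule test_function_measurable[OF f])
  show ?thesis
    unfolding K_def
  proof (rule integral_dominated_convergence)
    show "integrable lborel (\<lambda>q2. B * \<bar>f q2\<bar>)"
      using test_function_integrable[OF f] by (intro integrable_mult_right integrable_abs)
    show "(\<lambda>q2. h s (heis_inv q \<star> q2) * f q2) \<in> borel_measurable lborel"
      using h_measurable[OF s] by simp
    show "(\<lambda>q2. h (?r k) (heis_inv q \<star> q2) * f q2) \<in> borel_measurable lborel" for k
      using h_measurable[OF r(2)[of k]] by simp
    show "AE q2 in lborel. norm (h (?r k) (heis_inv q \<star> q2) * f q2) \<le> B * \<bar>f q2\<bar>" for k
    proof (rule AE_I2)
      fix q2
      show "norm (h (?r k) (heis_inv q \<star> q2) * f q2) \<le> B * \<bar>f q2\<bar>"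
        using B[OF r(1)[of k], of q2] notin_support[of q2 f]
        by (cases "q2 \<in> ?S") (simp_all add: abs_mult mult_right_mono)
    qed
    have "(\<lambda>k. h (?r k) (heis_inv q \<star> q2)) \<longlonglongrightarrow> h s (heis_inv q \<star> q2)" for q2
    proof -
      have "isCont (\<lambda>(t, q). h t q) (s, heis_inv q \<star> q2)"
      proof -
        have op: "open ({0<..} \<times> UNIV :: (real \<times> 'n heis) set)"
          by (intro open_Times) auto
        have "(s, heis_inv q \<star> q2) \<in> {0<..} \<times> UNIV"
          using s by (intro SigmaI) auto
        then show ?thesis
          by (rule bspec[OF cont[unfolded continuous_on_eq_continuous_at[OF op]]])
      qed
      from isCont_tendsto_compose[OF this tendsto_Pair[OF lim tendsto_const[of "heis_inv q \<star> q2"]]]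
      show ?thesis by simp
    qed
    then show "AE q2 in lborel. (\<lambda>k. h (?r k) (heis_inv q \<star> q2) * f q2) \<longlonglongrightarrow> h s (heis_inv q \<star> q2) * f q2"
      by (intro AE_I2 tendsto_mult_right)
  qed
qed

text \<open>Fatou along times increasing to \<open>s\<close>, applied to the representative
  \<open>K\<close>. This discharges the assumption \<open>lsc\<close> of the abstract
  semigroup.\<close>

lemma K_lsc:
  assumes f: "test_function f" and s: "0 < s"
    and le: "\<And>r. 0 \<le> r \<Longrightarrow> r < s \<Longrightarrow> norm_L2 lborel (T r f) \<le> c"
  shows "norm_L2 lborel (T s f) \<le> c"
proof -
  let ?r = "\<lambda>k :: nat. s - s / real (k + 2)"
  note fL = test_function_L2[OF f]
  have r: "0 < ?r k" "?r k < s" for k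
  proof -
    have "s / real (k + 2) \<le> s / 2" using s by (intro divide_left_mono) auto
    moreover have "s / 2 < s" using s by simp
    moreover have "0 < s / real (k + 2)" using s by simp
    ultimately show "0 < ?r k" "?r k < s" by linarith+
  qed
  have "norm_L2 lborel (K s f) \<le> c"
  proof (rule L2_fatou(2)[where u = "\<lambda>k. K (?r k) f" and c = "\<lambda>_. c"])
    show "AE q in lborel. (\<lambda>k. K (?r k) f q) \<longlonglongrightarrow> K s f q"
      by (intro AE_I2 K_left_continuous f s)
    show "norm_L2 lborel (K (?r k) f) \<le> c" for k
      using r[of k] le[of "?r k"] by (simp only: K_L2(2)[OF r(1) fL] less_imp_le)
    show "K (?r k) f \<in> L2 lborel" for k
      by (rule K_L2(1)[OF r(1) fL])
    show "K s f \<in> borel_measurable lborel"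
      by (rule L2_measurable[OF K_L2(1)[OF s fL]])
  qed simp
  then show ?thesis by (simp add: K_L2[OF s fL])
qed

sublocale L2_semigroup lborel T "{f. test_function f}" sub_laplacian
proof
  show "C0_semigroup_L2 lborel T" using semi by (simp add: is_heat_semigroup_def)
  show "generator_L2 lborel T = {(f, g). f \<in> L2 lborel \<and> g \<in> L2 lborel \<and>
      (\<exists>\<phi>. (\<forall>k. \<phi> k \<in> {f. test_function f}) \<and> (\<lambda>k. norm_L2 lborel (\<lambda>q. \<phi> k q - f q)) \<longlonglongrightarrow> 0 \<and>
           (\<lambda>k. norm_L2 lborel (\<lambda>q. sub_laplacian (\<phi> k) q - g q)) \<longlonglongrightarrow> 0)}"
    using semi by (simp add: is_heat_semigroup_def sub_laplacian_L2_def)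
qed (auto intro: test_function_L2 test_function_lin test_function_sub_laplacian
    sub_laplacian_sym sub_laplacian_nonpos K_lsc)

lemma test_gen: "test_function f \<Longrightarrow> (f, sub_laplacian f) \<in> generator_L2 lborel T"
  using D_gen by simp

section \<open>Kernel values and norms through approximate identities\<close>

lemma K_delta:
  assumes "delta_seq a f" "0 < t"
  shows "(\<lambda>k. K t (f k) q) \<longlonglongrightarrow> h t (heis_inv q \<star> a)"
  unfolding K_def
  by (rule delta_seq_tendsto[OF assms(1)]) (intro h_continuous assms continuous_intros)

text \<open>Two successive averages, against \<open>f k\<close> and then against \<open>g k\<close>;
  joint continuity of the kernel at the pair of centres makes the error of the inner average uniform
  in the outer variable.\<close>

lemma ip_T_delta:
  assumes f: "delta_seq a f" and g: "delta_seq b g" and t: "0 < t"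
  shows "(\<lambda>k. ip lborel (T t (f k)) (g k)) \<longlonglongrightarrow> h t (heis_inv b \<star> a)"
proof (rule LIMSEQ_I)
  fix e :: real assume "0 < e"
  then have e: "0 < e / 2" by simp
  have "continuous_on UNIV (\<lambda>p. h t (heis_inv (fst p) \<star> snd p))"
    by (intro h_continuous t continuous_intros)
  then obtain d where d: "d > 0" "\<And>p. dist p (b, a) < d \<Longrightarrow>
      dist (h t (heis_inv (fst p) \<star> snd p)) (h t (heis_inv b \<star> a)) < e / 2"
    using e unfolding continuous_on_iff by (metis UNIV_I fst_conv snd_conv)
  have d': "\<bar>h t (heis_inv q \<star> q2) - h t (heis_inv b \<star> a)\<bar> \<le> e / 2"
    if "dist b q < d / 2" "dist a q2 < d / 2" for q q2
  proof -
    have "dist (q, q2) (b, a) \<le> dist q b + dist q2 a"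
      unfolding dist_Pair_Pair by (rule sqrt_sum_squares_le_sum) simp_all
    then have "dist (q, q2) (b, a) < d"
      using that by (simp add: dist_commute[of b] dist_commute[of a])
    from d(2)[OF this] show ?thesis
      by (simp add: dist_real_def)
  qed
  have "0 < d / 2" using d by simp
  then obtain N where N: "1 / real (Suc N) < d / 2"
    using nat_approx_posE by blast
  have "norm (ip lborel (T t (f k)) (g k) - h t (heis_inv b \<star> a)) < e" if k: "k \<ge> N" for k
  proof -
    note fk = delta_seq_test[OF f, of k] and gk = delta_seq_test[OF g, of k]
    have "1 / real (Suc k) \<le> 1 / real (Suc N)" using k by (simp add: frac_le)
    then have kd: "1 / real (Suc k) < d / 2" using N by simp
    have "\<bar>K t (f k) q - h t (heis_inv b \<star> a)\<bar> \<le> e / 2" if q: "dist b q < 1 / real (Suc k)" for q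
      unfolding K_def using d' q kd
      by (intro delta_seq_average[OF f] continuous_times_test_integrable fk h_continuous t continuous_intros) auto
    then have "\<bar>ip lborel (K t (f k)) (g k) - h t (heis_inv b \<star> a)\<bar> \<le> e / 2"
      unfolding ip_def
      by (intro delta_seq_average[OF g] L2_integrable_mult K_L2 t test_function_L2 fk gk)
    moreover have "ip lborel (K t (f k)) (g k) = ip lborel (T t (f k)) (g k)"
    proof (rule ip_cong_AE)
      show "AE q in lborel. K t (f k) q = T t (f k) q"
        using T_eq_K[OF t test_function_L2[OF fk]] by eventually_elim simp
    qed (use t fk gk in \<open>auto intro: K_L2 T_in_L2 test_function_L2\<close>)
    ultimately show ?thesis using \<open>0 < e\<close> by simp
  qed
  then show "\<exists>no. \<forall>n\<ge>no. norm (ip lborel (T t (f n)) (g n) - h t (heis_inv b \<star> a)) < e" by blast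
qed

text \<open>Symmetry of the semigroup, tested on point masses at \<open>q\<close> and at the
  identity.\<close>

lemma h_inv:
  assumes t: "0 < t"
  shows "h t (heis_inv q) = h t q"
proof -
  obtain f where f: "delta_seq q f" using delta_seq_exists by blast
  obtain g where g: "delta_seq (heis_e :: 'n heis) g" using delta_seq_exists by blast
  have "ip lborel (T t (f k)) (g k) = ip lborel (T t (g k)) (f k)" for k
    using symmetric[OF test_gen test_gen, of "f k" "g k" t] t delta_seq_test[OF f] delta_seq_test[OF g]
    by (simp add: ip_commute)
  with ip_T_delta[OF f g t] ip_T_delta[OF g f t] have "h t (heis_inv heis_e \<star> q) = h t (heis_inv q \<star> heis_e)"
    by (simp add: LIMSEQ_unique)
  moreover have "heis_inv heis_e = (heis_e :: 'n heis)" by (simp add: heis_e_def)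
  ultimately show ?thesis by (simp add: heis_mult_e)
qed

text \<open>Half of the time is placed on each side of the inner product, so the limit is the value
  of the kernel on the diagonal.\<close>

lemma norm_T_delta:
  assumes f: "delta_seq a f" and t: "0 < t"
  shows "(\<lambda>k. (norm_L2 lborel (T (t / 2) (f k)))\<^sup>2) \<longlonglongrightarrow> h t heis_e"
proof -
  have "(norm_L2 lborel (T (t / 2) (f k)))\<^sup>2 = ip lborel (T t (f k)) (f k)" for k
    using ip_T_add[OF test_gen[OF delta_seq_test[OF f]], of "t / 2" "t / 2" k] t
    by (simp add: norm_L2_power2)
  with ip_T_delta[OF f f t] show ?thesis by (simp add: heis_mult_inv)
qed

lemma norm_T_delta_sqrt:
  assumes f: "delta_seq a f" and t: "0 < t"
  shows "(\<lambda>k. norm_L2 lborel (T (t / 2) (f k))) \<longlonglongrightarrow> sqrt (h t heis_e)"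
  using tendsto_real_sqrt[OF norm_T_delta[OF assms]] by (simp add: norm_L2_nonneg)

lemma h_e_nonneg: "0 < t \<Longrightarrow> 0 \<le> h t heis_e"
proof -
  assume t: "0 < t"
  obtain f where "delta_seq (heis_e :: 'n heis) f" using delta_seq_exists by blast
  from norm_T_delta[OF this t] show ?thesis
    by (rule LIMSEQ_le_const) simp
qed

text \<open>Cauchy-Schwarz for \<open>T (t / 2)\<close> applied to point masses at \<open>q\<close>
  and at the identity. The kernel depends only on the quotient of its arguments, so both diagonal
  values are \<open>h t heis_e\<close>.\<close>

lemma h_bound:
  assumes t: "0 < t"
  shows "\<bar>h t q\<bar> \<le> h t heis_e"
proof -
  obtain f where f: "delta_seq q f" using delta_seq_exists by blast
  obtain g where g: "delta_seq (heis_e :: 'n heis) g" using delta_seq_exists by blast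
  have t2: "0 \<le> t / 2" using t by simp
  have le: "\<bar>ip lborel (T t (f k)) (g k)\<bar> \<le> norm_L2 lborel (T (t / 2) (f k)) * norm_L2 lborel (T (t / 2) (g k))" for k
  proof -
    note fk = delta_seq_test[OF f, of k] and gk = delta_seq_test[OF g, of k]
    have Tf: "T (t / 2) (f k) \<in> L2 lborel" and Tg: "T (t / 2) (g k) \<in> L2 lborel"
      by (intro T_in_L2 t2 test_function_L2 fk gk)+
    have "AE q in lborel. T (t / 2 + t / 2) (f k) q = T (t / 2) (T (t / 2) (f k)) q"
      by (intro T_add t2 test_function_L2 fk)
    then have "ip lborel (T t (f k)) (g k) = ip lborel (T (t / 2) (T (t / 2) (f k))) (g k)"
      using t fk gk Tf by (intro ip_cong_AE T_in_L2 t2 test_function_L2) auto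
    also have "\<dots> = ip lborel (T (t / 2) (f k)) (T (t / 2) (g k))"
      by (rule symmetric[OF gen_T[OF t2 test_gen[OF fk]] test_gen[OF gk] t2])
    finally show ?thesis using ip_bound[OF Tf Tg] by simp
  qed
  have "\<bar>h t (heis_inv heis_e \<star> q)\<bar> \<le> sqrt (h t heis_e) * sqrt (h t heis_e)"
    by (rule LIMSEQ_le[OF tendsto_rabs[OF ip_T_delta[OF f g t]]
          tendsto_mult[OF norm_T_delta_sqrt[OF f t] norm_T_delta_sqrt[OF g t]]]) (use le in auto)
  moreover have "heis_inv heis_e = (heis_e :: 'n heis)" by (simp add: heis_e_def)
  ultimately show ?thesis using h_e_nonneg[OF t] by (simp add: heis_mult_e)
qed

text \<open>\<open>h t\<close> is the pointwise limit of the semigroup applied to bumps at the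
  identity, with \<open>h_inv\<close> removing an inversion; the norms converge by the diagonal
  formula at time \<open>2 * t\<close>.\<close>

lemma h_L2:
  assumes t: "0 < t"
  shows "h t \<in> L2 lborel" "norm_L2 lborel (h t) \<le> sqrt (h (2 * t) heis_e)"
proof -
  obtain f where f: "delta_seq (heis_e :: 'n heis) f" using delta_seq_exists by blast
  have fL: "f k \<in> L2 lborel" for k by (intro test_function_L2 delta_seq_test[OF f])
  have "(\<lambda>k. K t (f k) q) \<longlonglongrightarrow> h t q" for q
    using K_delta[OF f t, of q] by (simp add: heis_mult_e h_inv[OF t])
  then have lim: "AE q in lborel. (\<lambda>k. K t (f k) q) \<longlonglongrightarrow> h t q"
    by (intro AE_I2)
  have c: "(\<lambda>k. norm_L2 lborel (K t (f k))) \<longlonglongrightarrow> sqrt (h (2 * t) heis_e)"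
    using norm_T_delta_sqrt[OF f, of "2 * t"] t by (simp add: K_L2(2)[OF t fL])
  show "h t \<in> L2 lborel"
    by (rule L2_fatou(1)[OF K_L2(1)[OF t fL] lim _ order_refl c]) (simp add: h_measurable[OF t])
  show "norm_L2 lborel (h t) \<le> sqrt (h (2 * t) heis_e)"
    by (rule L2_fatou(2)[OF K_L2(1)[OF t fL] lim _ order_refl c]) (simp add: h_measurable[OF t])
qed

text \<open>The bound passes to the closure that defines the generator: right translation is an
  isometry, and the energy converges along sequences that converge in the graph.\<close>

lemma gen_translation_bound:
  fixes p :: "'n heis"
  assumes C: "\<And>f. test_function f \<Longrightarrow> norm_L2 lborel (\<lambda>q. f (q \<star> p) - f q) \<le> C * sqrt (- ip lborel (sub_laplacian f) f)"
    and uw: "(u, w) \<in> generator_L2 lborel T"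
  shows "norm_L2 lborel (\<lambda>q. u (q \<star> p) - u q) \<le> C * sqrt (- ip lborel w u)"
proof -
  note L = gen_L2[OF uw]
  obtain \<phi> where \<phi>: "\<And>k::nat. test_function (\<phi> k)" "(\<lambda>k. norm_L2 lborel (\<lambda>q. \<phi> k q - u q)) \<longlonglongrightarrow> 0"
      "(\<lambda>k. norm_L2 lborel (\<lambda>q. sub_laplacian (\<phi> k) q - w q)) \<longlonglongrightarrow> 0"
    using uw unfolding gen by blast
  note \<phi>L = test_function_L2[OF \<phi>(1)]
  have R: "(\<lambda>q. f (q \<star> p)) \<in> L2 lborel" if "f \<in> L2 lborel" for f :: "'n heis \<Rightarrow> real"
    by (rule L2_preserving[OF distr_heis_mult_right _ that]) simp
  have nR: "norm_L2 lborel (\<lambda>q. f (q \<star> p)) = norm_L2 lborel f" if "f \<in> L2 lborel" for f :: "'n heis \<Rightarrow> real"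
    using L2_measurable[OF that] by (intro norm_L2_preserving[OF distr_heis_mult_right]) simp_all
  have "(\<lambda>k. norm_L2 lborel (\<lambda>q. \<phi> k (q \<star> p) - \<phi> k q)) \<longlonglongrightarrow> norm_L2 lborel (\<lambda>q. u (q \<star> p) - u q)"
  proof (rule norm_L2_tendsto)
    show "(\<lambda>k. norm_L2 lborel (\<lambda>q. \<phi> k (q \<star> p) - \<phi> k q - (u (q \<star> p) - u q))) \<longlonglongrightarrow> 0"
    proof (rule Lim_null_comparison)
      have "norm_L2 lborel (\<lambda>q. \<phi> k (q \<star> p) - \<phi> k q - (u (q \<star> p) - u q))
          \<le> 2 * norm_L2 lborel (\<lambda>q. \<phi> k q - u q)" for k
      proof -
        let ?d = "\<lambda>q. \<phi> k q - u q"
        have d: "?d \<in> L2 lborel" by (rule L2_diff[OF \<phi>L L(1)])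
        have "norm_L2 lborel (\<lambda>q. ?d (q \<star> p) - ?d q) \<le> norm_L2 lborel (\<lambda>q. ?d (q \<star> p)) + norm_L2 lborel ?d"
          by (rule norm_L2_diff[OF R[OF d] d])
        also have "norm_L2 lborel (\<lambda>q. ?d (q \<star> p)) = norm_L2 lborel ?d"
          by (rule nR[OF d])
        finally show ?thesis by (simp add: algebra_simps)
      qed
      then show "\<forall>\<^sub>F k in sequentially. norm (norm_L2 lborel (\<lambda>q. \<phi> k (q \<star> p) - \<phi> k q - (u (q \<star> p) - u q)))
          \<le> 2 * norm_L2 lborel (\<lambda>q. \<phi> k q - u q)"
        by (simp add: norm_L2_nonneg)
      show "(\<lambda>k. 2 * norm_L2 lborel (\<lambda>q. \<phi> k q - u q)) \<longlonglongrightarrow> 0"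
        using tendsto_mult_left[OF \<phi>(2), of 2] by simp
    qed
  qed (intro L2_diff R L \<phi>L)+
  moreover have "(\<lambda>k. ip lborel (sub_laplacian (\<phi> k)) (\<phi> k)) \<longlonglongrightarrow> ip lborel w u"
    by (intro ip_tendsto L \<phi>L \<phi> test_function_L2[OF test_function_sub_laplacian])
  then have "(\<lambda>k. C * sqrt (- ip lborel (sub_laplacian (\<phi> k)) (\<phi> k))) \<longlonglongrightarrow> C * sqrt (- ip lborel w u)"
    by (intro tendsto_intros)
  ultimately show ?thesis
    by (rule LIMSEQ_le) (use C[OF \<phi>(1)] in auto)
qed

text \<open>The previous bound is applied to \<open>T t (f k)\<close>, which lies in the domain and
  whose energy is controlled by \<open>energy_bound\<close>; concentrating the bumps replaces
  \<open>ip lborel (T t (f k)) (f k)\<close> by \<open>h t heis_e\<close>.\<close>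

lemma h_translation:
  fixes x :: "'n heis"
  shows "\<exists>C\<ge>0. \<forall>t>0. norm_L2 lborel (\<lambda>q. h t (heis_inv x \<star> q) - h t q) \<le> C * sqrt (h t heis_e / t)"
proof -
  obtain C where C0: "C \<ge> 0" and C: "\<And>f. test_function f \<Longrightarrow>
      norm_L2 lborel (\<lambda>q. f (q \<star> x) - f q) \<le> C * sqrt (- ip lborel (sub_laplacian f) f)"
    using translation_bound[of x] by blast
  have "norm_L2 lborel (\<lambda>q. h t (heis_inv x \<star> q) - h t q) \<le> C * sqrt (h t heis_e / t)" if t: "0 < t" for t
  proof -
    have [measurable]: "h t \<in> borel_measurable borel" by (rule h_measurable[OF t])
    obtain f where f: "delta_seq (heis_e :: 'n heis) f" using delta_seq_exists by blast
    note fk = delta_seq_test[OF f]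
    note fL = test_function_L2[OF fk]
    have R: "(\<lambda>q. u (q \<star> x)) \<in> L2 lborel" if "u \<in> L2 lborel" for u :: "'n heis \<Rightarrow> real"
      by (rule L2_preserving[OF distr_heis_mult_right _ that]) simp
    have t0: "0 \<le> t" using t by simp
    have bound: "norm_L2 lborel (\<lambda>q. K t (f k) (q \<star> x) - K t (f k) q) \<le> C * sqrt (ip lborel (T t (f k)) (f k) / t)" for k
    proof -
      note g = gen_T[OF t0 test_gen[OF fk, of k]]
      have KT: "AE q in lborel. K t (f k) q = T t (f k) q"
        using T_eq_K[OF t fL[of k]] by eventually_elim simp
      have KTx: "AE q in lborel. K t (f k) (q \<star> x) = T t (f k) (q \<star> x)"
        by (rule AE_preserving[OF distr_heis_mult_right _ KT]) simp
      have "norm_L2 lborel (\<lambda>q. K t (f k) (q \<star> x) - K t (f k) q) = norm_L2 lborel (\<lambda>q. T t (f k) (q \<star> x) - T t (f k) q)"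
        using KT KTx by (intro norm_L2_cong_AE L2_measurable L2_diff R K_L2 t T_in_L2 t0 fL) auto
      also have "\<dots> \<le> C * sqrt (- ip lborel (T t (sub_laplacian (f k))) (T t (f k)))"
        by (rule gen_translation_bound[OF C g])
      also have "\<dots> \<le> C * sqrt (ip lborel (T t (f k)) (f k) / t)"
        by (intro mult_left_mono C0 real_sqrt_le_mono energy_bound[OF test_gen[OF fk] t g])
      finally show ?thesis .
    qed
    have "(\<lambda>k. ip lborel (T t (f k)) (f k)) \<longlonglongrightarrow> h t heis_e"
      using ip_T_delta[OF f f t] by (simp add: heis_mult_inv)
    then have lim: "(\<lambda>k. C * sqrt (ip lborel (T t (f k)) (f k) / t)) \<longlonglongrightarrow> C * sqrt (h t heis_e / t)"
      using t by (intro tendsto_intros) auto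
    have Kq: "(\<lambda>k. K t (f k) q) \<longlonglongrightarrow> h t q" for q
      using K_delta[OF f t, of q] by (simp add: heis_mult_e h_inv[OF t])
    have *: "norm_L2 lborel (\<lambda>q. h t (q \<star> x) - h t q) \<le> C * sqrt (h t heis_e / t)"
    proof (rule L2_fatou(2)[OF _ _ _ bound lim])
      show "(\<lambda>q. K t (f k) (q \<star> x) - K t (f k) q) \<in> L2 lborel" for k
        by (intro L2_diff R K_L2 t fL)
      show "AE q in lborel. (\<lambda>k. K t (f k) (q \<star> x) - K t (f k) q) \<longlonglongrightarrow> h t (q \<star> x) - h t q"
        by (intro AE_I2 tendsto_diff Kq)
    qed simp
    \<comment> \<open>So far the translation acts from the right, while \<open>G_kernel\<close>
      involves a left one. Inversion exchanges the two and preserves both \<open>h t\<close> and the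
      measure.\<close>
    have "h t (heis_inv x \<star> q) - h t q = h t (heis_inv q \<star> x) - h t (heis_inv q)" for q
      using h_inv[OF t, of "heis_inv q \<star> x"] h_inv[OF t, of q] by (simp add: heis_inv_mult heis_inv_inv)
    then have "norm_L2 lborel (\<lambda>q. h t (heis_inv x \<star> q) - h t q)
        = norm_L2 lborel (\<lambda>q. (\<lambda>q. h t (q \<star> x) - h t q) (heis_inv q))"
      by simp
    also have "\<dots> = norm_L2 lborel (\<lambda>q. h t (q \<star> x) - h t q)"
      by (rule norm_L2_preserving[OF distr_heis_inv]) simp_all
    finally show ?thesis using * by simp
  qed
  with C0 show ?thesis by blast
qed

end

section \<open>Scaling of the heat kernel\<close>

lemma AE_heis_dil:
  fixes P :: "'n::finite heis \<Rightarrow> bool"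
  assumes r: "0 < r" and P: "AE q in lborel. P q"
  shows "AE q in lborel. P (heis_dil r q)"
proof -
  obtain N where N: "{q. \<not> P q} \<subseteq> N" "N \<in> sets lborel" "emeasure lborel N = 0"
    using AE_E[OF P] by auto
  have [measurable]: "N \<in> sets borel" using N(2) by simp
  have "(\<integral>\<^sup>+q. indicator N (heis_dil r q) \<partial>(lborel :: 'n heis measure)) = 0"
  proof -
    have "0 = (\<integral>\<^sup>+q. indicator N q \<partial>lborel)" using N by simp
    also have "\<dots> = ennreal (r ^ (2 * CARD('n) + 2)) * (\<integral>\<^sup>+q. indicator N (heis_dil r q) \<partial>lborel)"
      by (rule nn_integral_heis_dil[OF _ r]) simp
    finally show ?thesis using r by (simp add: ennreal_mult_eq_top_iff del: power_Suc)
  qed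
  then have "AE q in lborel. indicator N (heis_dil r q) = (0 :: ennreal)"
    by (subst (asm) nn_integral_0_iff_AE) simp_all
  then show ?thesis
  proof eventually_elim
    case (elim q)
    then have "heis_dil r q \<notin> N" by (simp add: indicator_eq_0_iff)
    then show ?case using N(1) by blast
  qed
qed

lemma L2_heis_dil:
  fixes f :: "'n::finite heis \<Rightarrow> real"
  assumes f: "f \<in> L2 lborel" and r: "0 < r"
  shows "(\<lambda>q. f (heis_dil r q)) \<in> L2 lborel"
    and "norm_L2 lborel (\<lambda>q. f (heis_dil r q)) = norm_L2 lborel f / r ^ (CARD('n) + 1)"
proof -
  have [measurable]: "f \<in> borel_measurable borel" using L2_measurable[OF f] by simp
  have m: "(\<lambda>q. (f q)\<^sup>2) \<in> borel_measurable borel" by simp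
  show "(\<lambda>q. f (heis_dil r q)) \<in> L2 lborel"
    using integrable_heis_dil[OF m r] f by (simp add: L2_def)
  have "sqrt (r ^ (2 * CARD('n) + 2)) = r ^ (CARD('n) + 1)"
    using r by (intro real_sqrt_unique) (simp_all add: power_mult[symmetric] power_add[symmetric] algebra_simps del: power_Suc)
  then show "norm_L2 lborel (\<lambda>q. f (heis_dil r q)) = norm_L2 lborel f / r ^ (CARD('n) + 1)"
    using integral_heis_dil[OF m r] by (simp only: norm_L2_def real_sqrt_divide)
qed

lemma test_function_heis_dil:
  fixes f :: "'n::finite heis \<Rightarrow> real"
  assumes f: "test_function f" and r: "0 < r"
  shows "test_function (\<lambda>q. f (heis_dil r q))"
proof (rule test_functionI)
  show "smooth (\<lambda>q. f (heis_dil r q))"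
    using test_function_smooth[OF f] Ck_heis_dil by blast
  show "compact (heis_dil (1 / r) ` closure {q. f q \<noteq> 0})"
    by (intro compact_continuous_image continuous_intros test_function_compact f)
  show "f (heis_dil r q) = 0" if q: "q \<notin> heis_dil (1 / r) ` closure {q. f q \<noteq> 0}" for q
  proof (rule notin_support[of _ f])
    show "heis_dil r q \<notin> closure {q. f q \<noteq> 0}"
    proof
      assume "heis_dil r q \<in> closure {q. f q \<noteq> 0}"
      then have "heis_dil (1 / r) (heis_dil r q) \<in> heis_dil (1 / r) ` closure {q. f q \<noteq> 0}"
        by (rule imageI)
      with q r show False by (simp only: heis_dil_dil) (simp add: heis_dil_1)
    qed
  qed
qed

lemma dir_deriv_cmult:
  assumes "smooth f"
  shows "dir_deriv v (\<lambda>q. c * f q) q = c * dir_deriv v f q"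
  by (intro dir_deriv_eq has_derivative_mult_right smooth_has_derivative assms)

text \<open>The central derivative produces \<open>r\<^sup>2\<close>, but one factor is absorbed
  into the coefficient at the dilated point, so both summands scale by \<open>r\<close>. The
  constant \<open>c\<close> allows the lemma to be iterated.\<close>

lemma X_field_heis_dil:
  fixes f :: "'n::finite heis \<Rightarrow> real"
  assumes "smooth f"
  shows "X_field i (\<lambda>q. c * f (heis_dil r q)) = (\<lambda>q. c * r * X_field i f (heis_dil r q))"
    and "Y_field i (\<lambda>q. c * f (heis_dil r q)) = (\<lambda>q. c * r * Y_field i f (heis_dil r q))"
proof -
  have s: "smooth (\<lambda>q. f (heis_dil r q))" using assms Ck_heis_dil by blast
  have w: "dil_weight r (axis i 1, 0, 0 :: real) = r" "dil_weight r (0, axis i 1, 0 :: real) = r"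
    "dil_weight r ((0, 0, 1) :: 'n heis) = r\<^sup>2"
    by (simp_all add: dil_weight_def)
  show "X_field i (\<lambda>q. c * f (heis_dil r q)) = (\<lambda>q. c * r * X_field i f (heis_dil r q))"
    unfolding X_field_def dir_deriv_cmult[OF s] dir_deriv_heis_dil[OF assms axis_heis_Basis(1)]
      dir_deriv_heis_dil[OF assms axis_heis_Basis(3)] w
    by (auto simp: heis_dil_def fun_eq_iff algebra_simps power2_eq_square)
  show "Y_field i (\<lambda>q. c * f (heis_dil r q)) = (\<lambda>q. c * r * Y_field i f (heis_dil r q))"
    unfolding Y_field_def dir_deriv_cmult[OF s] dir_deriv_heis_dil[OF assms axis_heis_Basis(2)]
      dir_deriv_heis_dil[OF assms axis_heis_Basis(3)] w
    by (auto simp: heis_dil_def fun_eq_iff algebra_simps power2_eq_square)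
qed

lemma sub_laplacian_heis_dil:
  fixes f :: "'n::finite heis \<Rightarrow> real"
  assumes f: "test_function f"
  shows "sub_laplacian (\<lambda>q. f (heis_dil r q)) = (\<lambda>q. r\<^sup>2 * sub_laplacian f (heis_dil r q))"
proof
  fix q
  note s = test_function_smooth[OF f] test_function_smooth[OF test_function_X_field[OF f]]
    test_function_smooth[OF test_function_Y_field[OF f]]
  have X: "X_field i (X_field i (\<lambda>q. f (heis_dil r q))) = (\<lambda>q. r * r * X_field i (X_field i f) (heis_dil r q))" for i
    using X_field_heis_dil(1)[OF s(1), where i = i and c = 1 and r = r]
      X_field_heis_dil(1)[OF s(2)[of i], where i = i and c = r and r = r] by simp
  have Y: "Y_field i (Y_field i (\<lambda>q. f (heis_dil r q))) = (\<lambda>q. r * r * Y_field i (Y_field i f) (heis_dil r q))" for i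
    using X_field_heis_dil(2)[OF s(1), where i = i and c = 1 and r = r]
      X_field_heis_dil(2)[OF s(3)[of i], where i = i and c = r and r = r] by simp
  show "sub_laplacian (\<lambda>q. f (heis_dil r q)) q = r\<^sup>2 * sub_laplacian f (heis_dil r q)"
    unfolding sub_laplacian_def X Y by (simp add: sum_distrib_left power2_eq_square algebra_simps)
qed

lemma sub_laplacian_L2_heis_dil:
  fixes f g :: "'n::finite heis \<Rightarrow> real"
  assumes fg: "(f, g) \<in> sub_laplacian_L2" and r: "0 < r"
  shows "((\<lambda>q. f (heis_dil r q)), (\<lambda>q. r\<^sup>2 * g (heis_dil r q))) \<in> sub_laplacian_L2"
proof -
  have f: "f \<in> L2 lborel" and g: "g \<in> L2 lborel" using fg by (auto simp: sub_laplacian_L2_def)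
  obtain \<phi> where \<phi>: "\<And>k::nat. test_function (\<phi> k)" "(\<lambda>k. norm_L2 lborel (\<lambda>q. \<phi> k q - f q)) \<longlonglongrightarrow> 0"
    "(\<lambda>k. norm_L2 lborel (\<lambda>q. sub_laplacian (\<phi> k) q - g q)) \<longlonglongrightarrow> 0"
    using fg unfolding sub_laplacian_L2_def by blast
  let ?m = "r ^ (CARD('n) + 1)"
  show ?thesis
    unfolding sub_laplacian_L2_def
  proof (intro CollectI case_prodI conjI exI[of _ "\<lambda>k q. \<phi> k (heis_dil r q)"] allI L2_cmult L2_heis_dil f g r
      test_function_heis_dil \<phi>)
    have "norm_L2 lborel (\<lambda>q. \<phi> k (heis_dil r q) - f (heis_dil r q)) = norm_L2 lborel (\<lambda>q. \<phi> k q - f q) / ?m" for k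
      by (rule L2_heis_dil(2)[OF L2_diff[OF test_function_L2[OF \<phi>(1)] f] r])
    with tendsto_divide[OF \<phi>(2) tendsto_const[of ?m]] r
    show "(\<lambda>k. norm_L2 lborel (\<lambda>q. \<phi> k (heis_dil r q) - f (heis_dil r q))) \<longlonglongrightarrow> 0"
      by simp
    have "norm_L2 lborel (\<lambda>q. sub_laplacian (\<lambda>q. \<phi> k (heis_dil r q)) q - r\<^sup>2 * g (heis_dil r q))
        = r\<^sup>2 * (norm_L2 lborel (\<lambda>q. sub_laplacian (\<phi> k) q - g q) / ?m)" for k
    proof -
      have "norm_L2 lborel (\<lambda>q. sub_laplacian (\<lambda>q. \<phi> k (heis_dil r q)) q - r\<^sup>2 * g (heis_dil r q))
          = norm_L2 lborel (\<lambda>q. r\<^sup>2 * (sub_laplacian (\<phi> k) (heis_dil r q) - g (heis_dil r q)))"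
        by (simp add: sub_laplacian_heis_dil[OF \<phi>(1)] algebra_simps)
      also have "\<dots> = r\<^sup>2 * norm_L2 lborel (\<lambda>q. sub_laplacian (\<phi> k) (heis_dil r q) - g (heis_dil r q))"
        by (simp add: norm_L2_cmult)
      also have "norm_L2 lborel (\<lambda>q. sub_laplacian (\<phi> k) (heis_dil r q) - g (heis_dil r q))
          = norm_L2 lborel (\<lambda>q. sub_laplacian (\<phi> k) q - g q) / ?m"
        by (rule L2_heis_dil(2)[OF L2_diff[OF test_function_L2[OF test_function_sub_laplacian[OF \<phi>(1)]] g] r])
      finally show ?thesis .
    qed
    with tendsto_mult_left[OF tendsto_divide[OF \<phi>(3) tendsto_const[of ?m]], of "r\<^sup>2"] r
    show "(\<lambda>k. norm_L2 lborel (\<lambda>q. sub_laplacian (\<lambda>q. \<phi> k (heis_dil r q)) q - r\<^sup>2 * g (heis_dil r q))) \<longlonglongrightarrow> 0"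
      by simp
  qed
qed

section \<open>The dilated semigroup and its kernel\<close>

lemma filterlim_scale_at_right_0:
  fixes c :: real
  assumes "0 < c"
  shows "filterlim (\<lambda>t. c * t) (at_right 0) (at_right 0)"
proof -
  have "((\<lambda>t. c * t) \<longlongrightarrow> c * 0) (at_right 0)" by (intro tendsto_intros)
  moreover have "\<forall>\<^sub>F t in at_right 0. c * t \<in> {0<..} \<and> c * t \<noteq> 0"
    using assms by (intro eventually_mono[OF eventually_at_right_less[of "0 :: real"]]) auto
  ultimately show ?thesis by (simp add: filterlim_at)
qed

context heat_kernel
begin

lemma T_cont: "f \<in> L2 lborel \<Longrightarrow> ((\<lambda>t. norm_L2 lborel (\<lambda>q. T t f q - f q)) \<longlongrightarrow> 0) (at_right 0)"
  using C0 unfolding C0_semigroup_L2_def by simp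

text \<open>Conjugation by the dilation divides the generator by \<open>l\<^sup>2\<close>, and
  running time at speed \<open>l\<^sup>2\<close> restores it. The power of \<open>l\<close> in the
  kernel is the Jacobian of the change of variables.\<close>

lemma heat_kernel_dilated:
  assumes l: "0 < l"
  shows "heat_kernel (\<lambda>t q. l ^ (2 * CARD('n) + 2) * h (l\<^sup>2 * t) (heis_dil l q))
    (\<lambda>t f q. T (l\<^sup>2 * t) (\<lambda>p. f (heis_dil (1 / l) p)) (heis_dil l q))"
proof -
  define U where "U f = (\<lambda>q. f (heis_dil (1 / l) q))" for f :: "'n heis \<Rightarrow> real"
  define T' where "T' t f = (\<lambda>q. T (l\<^sup>2 * t) (U f) (heis_dil l q))" for t f
  \<comment> \<open>The factor by which \<open>U\<close> scales norms, the square root of the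
    Jacobian.\<close>
  let ?m = "l ^ (CARD('n) + 1)"
  have l': "0 < 1 / l" and l2: "0 < l\<^sup>2" and m: "0 < ?m" using l by auto
  have dd: "heis_dil (1 / l) (heis_dil l q) = q" "heis_dil l (heis_dil (1 / l) q) = q" for q :: "'n heis"
    using l by (simp_all only: heis_dil_dil) (simp_all add: heis_dil_1)
  have UV: "U (\<lambda>q. f (heis_dil l q)) = f" and VU: "U f (heis_dil l q) = f q" for f q
    by (simp_all add: U_def dd)
  have U: "U f \<in> L2 lborel" "norm_L2 lborel (U f) = norm_L2 lborel f * ?m" if "f \<in> L2 lborel" for f
    unfolding U_def using L2_heis_dil[OF that l'] l by (simp_all add: power_one_over field_simps)
  have V: "(\<lambda>q. f (heis_dil l q)) \<in> L2 lborel"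
    "norm_L2 lborel (\<lambda>q. f (heis_dil l q)) = norm_L2 lborel f / ?m" if "f \<in> L2 lborel" for f :: "'n heis \<Rightarrow> real"
    by (rule L2_heis_dil[OF that l])+
  have lt: "0 \<le> l\<^sup>2 * t" if "0 \<le> t" for t using that by simp
  have C0': "C0_semigroup_L2 lborel T'"
    unfolding C0_semigroup_L2_def
  proof (intro conjI allI impI ballI)
    fix t :: real assume t: "0 \<le> t"
    show "T' t f \<in> L2 lborel" if "f \<in> L2 lborel" for f
      unfolding T'_def by (intro V T_in_L2 U lt t that)
    show "AE q in lborel. T' t (\<lambda>p. a * f p + b * g p) q = a * T' t f q + b * T' t g q"
      if "f \<in> L2 lborel" "g \<in> L2 lborel" for f g a b
      using AE_heis_dil[OF l T_lin[OF lt[OF t] U(1)[OF that(1)] U(1)[OF that(2)], of a b]]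
      by (simp add: T'_def U_def)
    obtain C where C: "\<forall>f\<in>L2 lborel. norm_L2 lborel (T (l\<^sup>2 * t) f) \<le> C * norm_L2 lborel f"
      using T_bdd[OF lt[OF t]] by blast
    have "norm_L2 lborel (T' t f) \<le> C * norm_L2 lborel f" if f: "f \<in> L2 lborel" for f
    proof -
      have "norm_L2 lborel (T' t f) = norm_L2 lborel (T (l\<^sup>2 * t) (U f)) / ?m"
        unfolding T'_def by (intro V T_in_L2 U lt t f)
      also have "\<dots> \<le> C * norm_L2 lborel (U f) / ?m"
        using m C U(1)[OF f] by (intro divide_right_mono) auto
      also have "\<dots> = C * norm_L2 lborel f"
        unfolding U(2)[OF f] mult.assoc[symmetric] using l by (intro nonzero_mult_div_cancel_right) simp
      finally show ?thesis .
    qed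
    then show "\<exists>C. \<forall>f\<in>L2 lborel. norm_L2 lborel (T' t f) \<le> C * norm_L2 lborel f" by blast
  next
    fix f :: "'n heis \<Rightarrow> real" assume f: "f \<in> L2 lborel"
    show "AE q in lborel. T' 0 f q = f q"
      using AE_heis_dil[OF l T_0[OF U(1)[OF f]]] by (simp add: T'_def VU)
    show "AE q in lborel. T' (s + t) f q = T' s (T' t f) q" if "0 \<le> s" "0 \<le> t" for s t
      using AE_heis_dil[OF l T_add[OF lt[OF that(1)] lt[OF that(2)] U(1)[OF f]]]
      by (simp add: T'_def UV distrib_left)
    show "((\<lambda>t. norm_L2 lborel (\<lambda>q. T' t f q - f q)) \<longlongrightarrow> 0) (at_right 0)"
    proof (rule Lim_transform_eventually)
      have "((\<lambda>t. norm_L2 lborel (\<lambda>q. T (l\<^sup>2 * t) (U f) q - U f q)) \<longlongrightarrow> 0) (at_right 0)"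
        by (rule filterlim_compose[OF T_cont[OF U(1)[OF f]] filterlim_scale_at_right_0[OF l2]])
      from tendsto_divide[OF this tendsto_const[of ?m]] l
      show "((\<lambda>t. norm_L2 lborel (\<lambda>q. T (l\<^sup>2 * t) (U f) q - U f q) / ?m) \<longlongrightarrow> 0) (at_right 0)" by simp
      have "norm_L2 lborel (\<lambda>q. T (l\<^sup>2 * t) (U f) q - U f q) / ?m = norm_L2 lborel (\<lambda>q. T' t f q - f q)"
        if t: "0 < t" for t
        using V(2)[OF L2_diff[OF T_in_L2[OF lt[OF less_imp_le[OF t]] U(1)[OF f]] U(1)[OF f]]]
        by (simp add: T'_def VU)
      then show "\<forall>\<^sub>F t in at_right 0. norm_L2 lborel (\<lambda>q. T (l\<^sup>2 * t) (U f) q - U f q) / ?m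
          = norm_L2 lborel (\<lambda>q. T' t f q - f q)"
        by (intro eventually_mono[OF eventually_at_right_less[of "0 :: real"]])
    qed
  qed
  have "(f, g) \<in> generator_L2 lborel T' \<longleftrightarrow> (f, g) \<in> sub_laplacian_L2" for f g
  proof (cases "f \<in> L2 lborel \<and> g \<in> L2 lborel")
    case True
    then have f: "f \<in> L2 lborel" and g: "g \<in> L2 lborel" by auto
    \<comment> \<open>By homogeneity of degree two, this is the image of \<open>U f\<close> under
      the closed sub-Laplacian whenever \<open>g\<close> is that of \<open>f\<close>.\<close>
    define g' where "g' = (\<lambda>q. (1 / l)\<^sup>2 * U g q)"
    have g': "g' \<in> L2 lborel" unfolding g'_def by (intro L2_cmult U g)
    define \<Phi> where "\<Phi> t = norm_L2 lborel (\<lambda>q. (T t (U f) q - U f q) / t - g' q)" for t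
    define \<Phi>' where "\<Phi>' t = norm_L2 lborel (\<lambda>q. (T' t f q - f q) / t - g q)" for t
    have rel: "\<Phi>' t = l\<^sup>2 / ?m * \<Phi> (l\<^sup>2 * t)" if t: "0 < t" for t
    proof -
      let ?s = "l\<^sup>2 * t"
      have s: "0 \<le> ?s" using t by simp
      note L = L2_quot[OF s U(1)[OF f] g']
      have "\<Phi>' t = norm_L2 lborel (\<lambda>q. l\<^sup>2 * ((\<lambda>q. (T ?s (U f) q - U f q) / ?s - g' q) (heis_dil l q)))"
        unfolding \<Phi>'_def
        by (rule arg_cong[where f = "norm_L2 lborel"])
          (use l t in \<open>simp add: T'_def VU g'_def fun_eq_iff field_simps\<close>)
      also have "\<dots> = l\<^sup>2 * (norm_L2 lborel (\<lambda>q. (T ?s (U f) q - U f q) / ?s - g' q) / ?m)"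
        by (simp only: norm_L2_cmult V(2)[OF L]) simp
      finally show ?thesis by (simp add: \<Phi>_def)
    qed
    \<comment> \<open>Convergence is transferred in both directions, since the two generators must
      coincide as graphs.\<close>
    have "(\<Phi>' \<longlongrightarrow> 0) (at_right 0) \<longleftrightarrow> (\<Phi> \<longlongrightarrow> 0) (at_right 0)"
    proof
      assume "(\<Phi> \<longlongrightarrow> 0) (at_right 0)"
      then have "((\<lambda>t. \<Phi> (l\<^sup>2 * t)) \<longlongrightarrow> 0) (at_right 0)"
        by (rule filterlim_compose[OF _ filterlim_scale_at_right_0[OF l2]])
      from tendsto_mult_left[OF this, of "l\<^sup>2 / ?m"]
      have lim: "((\<lambda>t. l\<^sup>2 / ?m * \<Phi> (l\<^sup>2 * t)) \<longlongrightarrow> 0) (at_right 0)" by simp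
      show "(\<Phi>' \<longlongrightarrow> 0) (at_right 0)"
        by (rule Lim_transform_eventually[OF lim eventually_mono[OF eventually_at_right_less[of "0 :: real"]]])
          (simp only: rel)
    next
      assume "(\<Phi>' \<longlongrightarrow> 0) (at_right 0)"
      then have "((\<lambda>t. \<Phi>' (1 / l\<^sup>2 * t)) \<longlongrightarrow> 0) (at_right 0)"
        by (rule filterlim_compose[OF _ filterlim_scale_at_right_0]) (use l in simp)
      from tendsto_mult_left[OF this, of "?m / l\<^sup>2"]
      have lim: "((\<lambda>t. ?m / l\<^sup>2 * \<Phi>' (1 / l\<^sup>2 * t)) \<longlongrightarrow> 0) (at_right 0)" by simp
      have "?m / l\<^sup>2 * \<Phi>' (1 / l\<^sup>2 * t) = \<Phi> t" if "0 < t" for t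
        using rel[of "1 / l\<^sup>2 * t"] that l by simp
      with lim show "(\<Phi> \<longlongrightarrow> 0) (at_right 0)"
        by (rule Lim_transform_eventually[OF _ eventually_mono[OF eventually_at_right_less[of "0 :: real"]]])
    qed
    then have "(f, g) \<in> generator_L2 lborel T' \<longleftrightarrow> (U f, g') \<in> generator_L2 lborel T"
      using f g g' U(1)[OF f] by (simp add: generator_L2_def \<Phi>_def[abs_def] \<Phi>'_def[abs_def])
    also have "\<dots> \<longleftrightarrow> (U f, g') \<in> sub_laplacian_L2"
      using semi by (simp add: is_heat_semigroup_def)
    also have "\<dots> \<longleftrightarrow> (f, g) \<in> sub_laplacian_L2"
    proof
      assume "(U f, g') \<in> sub_laplacian_L2"
      from sub_laplacian_L2_heis_dil[OF this l] show "(f, g) \<in> sub_laplacian_L2"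
        using l by (simp add: VU g'_def power_one_over)
    next
      assume "(f, g) \<in> sub_laplacian_L2"
      from sub_laplacian_L2_heis_dil[OF this l'] show "(U f, g') \<in> sub_laplacian_L2"
        unfolding g'_def U_def .
    qed
    finally show ?thesis .
  next
    case False
    then show ?thesis by (auto simp: generator_L2_def sub_laplacian_L2_def)
  qed
  then have "is_heat_semigroup T'"
    using C0' by (auto simp: is_heat_semigroup_def)
  then have semi': "is_heat_semigroup (\<lambda>t f q. T (l\<^sup>2 * t) (\<lambda>p. f (heis_dil (1 / l) p)) (heis_dil l q))"
    unfolding T'_def[abs_def] U_def .
  show ?thesis
  proof
    show "is_heat_semigroup (\<lambda>t f q. T (l\<^sup>2 * t) (\<lambda>p. f (heis_dil (1 / l) p)) (heis_dil l q))"
      by (rule semi')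
    have "continuous_on ({0<..} \<times> UNIV) (\<lambda>p. (l\<^sup>2 * fst p, heis_dil l (snd p)))"
      by (intro continuous_intros)
    then have "continuous_on ({0<..} \<times> UNIV) (\<lambda>p. case (l\<^sup>2 * fst p, heis_dil l (snd p)) of (t, q) \<Rightarrow> h t q)"
      by (rule continuous_on_compose2[OF cont]) (use l in auto)
    then show "continuous_on ({0<..} \<times> UNIV) (\<lambda>(t, q). l ^ (2 * CARD('n) + 2) * h (l\<^sup>2 * t) (heis_dil l q))"
      unfolding split_beta by (intro continuous_intros) (simp add: split_beta)
    fix t :: real and f :: "'n heis \<Rightarrow> real"
    assume t: "0 < t" and f: "f \<in> L2 lborel"
    have lt: "0 < l\<^sup>2 * t" using l t by simp
    have [measurable]: "h (l\<^sup>2 * t) \<in> borel_measurable borel" by (rule h_measurable[OF lt])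
    have [measurable]: "f \<in> borel_measurable borel" using L2_measurable[OF f] by simp
    have "AE q1 in lborel. integrable lborel (\<lambda>q2. h (l\<^sup>2 * t) (heis_inv (heis_dil l q1) \<star> q2) * U f q2) \<and>
       T (l\<^sup>2 * t) (U f) (heis_dil l q1) = (\<integral>q2. h (l\<^sup>2 * t) (heis_inv (heis_dil l q1) \<star> q2) * U f q2 \<partial>lborel)"
      by (rule AE_heis_dil[OF l kern[OF lt U(1)[OF f]]])
    then show "AE q1 in lborel.
       integrable lborel (\<lambda>q2. l ^ (2 * CARD('n) + 2) * h (l\<^sup>2 * t) (heis_dil l (heis_inv q1 \<star> q2)) * f q2) \<and>
       T (l\<^sup>2 * t) (\<lambda>p. f (heis_dil (1 / l) p)) (heis_dil l q1)
         = (\<integral>q2. l ^ (2 * CARD('n) + 2) * h (l\<^sup>2 * t) (heis_dil l (heis_inv q1 \<star> q2)) * f q2 \<partial>lborel)"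
    proof eventually_elim
      case (elim q1)
      define F where "F q2 = h (l\<^sup>2 * t) (heis_inv (heis_dil l q1) \<star> q2) * U f q2" for q2
      have Fm: "F \<in> borel_measurable borel" unfolding F_def U_def by measurable
      have FV: "F (heis_dil l q2) = h (l\<^sup>2 * t) (heis_dil l (heis_inv q1 \<star> q2)) * f q2" for q2
        by (simp add: F_def VU heis_dil_mult heis_dil_inv)
      have int: "integrable lborel F" and eq: "T (l\<^sup>2 * t) (U f) (heis_dil l q1) = (\<integral>q2. F q2 \<partial>lborel)"
        using elim by (simp_all add: F_def[abs_def])
      have "integrable lborel (\<lambda>q2. h (l\<^sup>2 * t) (heis_dil l (heis_inv q1 \<star> q2)) * f q2)"
        using integrable_heis_dil[OF Fm l] int by (simp add: FV)
      moreover have "l ^ (2 * CARD('n) + 2) * (\<integral>q2. h (l\<^sup>2 * t) (heis_dil l (heis_inv q1 \<star> q2)) * f q2 \<partial>lborel)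
          = (\<integral>q2. F q2 \<partial>lborel)"
        using integral_heis_dil[OF Fm l] l by (simp add: FV del: power_Suc)
      ultimately show ?case
        using eq by (simp add: mult.assoc U_def del: power_Suc)
    qed
  qed
qed

text \<open>\<open>T\<close> and its dilate have the same generator, so \<open>duality\<close> makes
  their quadratic forms agree on bumps. With \<open>l = 1 / sqrt t\<close> the dilated time is 1,
  and dilations fix the identity; the power of \<open>t\<close> is the Jacobian.\<close>

lemma h_scaling:
  assumes t: "0 < t"
  shows "h t heis_e = h 1 heis_e * t powr (- (real CARD('n) + 1))"
proof -
  define l where "l = 1 / sqrt t"
  have l: "0 < l" and lt: "l\<^sup>2 * t = 1" using t by (auto simp: l_def power_divide)
  interpret D: heat_kernel "\<lambda>t q. l ^ (2 * CARD('n) + 2) * h (l\<^sup>2 * t) (heis_dil l q)"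
    "\<lambda>t f q. T (l\<^sup>2 * t) (\<lambda>p. f (heis_dil (1 / l) p)) (heis_dil l q)"
    by (rule heat_kernel_dilated[OF l])
  obtain f where f: "delta_seq (heis_e :: 'n heis) f" using delta_seq_exists by blast
  have "ip lborel (T t (f k)) (f k)
      = ip lborel (\<lambda>q. T (l\<^sup>2 * t) (\<lambda>p. f k (heis_dil (1 / l) p)) (heis_dil l q)) (f k)" for k
    using duality[OF D.L2_semigroup_axioms test_gen test_gen, of "f k" "f k" t] t delta_seq_test[OF f]
    by (simp add: ip_commute)
  with ip_T_delta[OF f f t] D.ip_T_delta[OF f f t]
  have "h t heis_e = l ^ (2 * CARD('n) + 2) * h 1 (heis_dil l heis_e)"
    by (simp add: LIMSEQ_unique heis_mult_inv lt del: power_Suc)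
  also have "heis_dil l heis_e = (heis_e :: 'n heis)"
    by (simp add: heis_dil_def heis_e_def)
  also have "l ^ (2 * CARD('n) + 2) = (l\<^sup>2) ^ (CARD('n) + 1)"
    by (simp add: power_mult[symmetric] algebra_simps del: power_Suc)
  also have "l\<^sup>2 = t powr (- 1)"
    using t by (simp add: l_def power_divide powr_minus_divide)
  also have "(t powr (- 1)) ^ (CARD('n) + 1) = t powr (- (real CARD('n) + 1))"
    using t by (subst powr_power) (simp_all add: minus_diff_commute[of 1])
  finally show ?thesis by simp
qed

end

section \<open>Weighted integrals over time\<close>

lemma nn_integral_Cauchy_Schwarz:
  fixes u v :: "'a \<Rightarrow> real"
  assumes [measurable]: "u \<in> borel_measurable M" "v \<in> borel_measurable M"
    and nn: "\<And>x. 0 \<le> u x" "\<And>x. 0 \<le> v x"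
    and fin: "(\<integral>\<^sup>+x. ennreal ((u x)\<^sup>2) \<partial>M) < \<infinity>" "(\<integral>\<^sup>+x. ennreal ((v x)\<^sup>2) \<partial>M) < \<infinity>"
  shows "(\<integral>\<^sup>+x. ennreal (u x * v x) \<partial>M)\<^sup>2 \<le> (\<integral>\<^sup>+x. ennreal ((u x)\<^sup>2) \<partial>M) * (\<integral>\<^sup>+x. ennreal ((v x)\<^sup>2) \<partial>M)"
proof -
  have L: "u \<in> L2 M" "v \<in> L2 M"
    using fin by (auto simp: L2_def intro!: integrableI_bounded)
  have n: "(\<integral>\<^sup>+x. ennreal ((f x)\<^sup>2) \<partial>M) = ennreal ((norm_L2 M f)\<^sup>2)" if "f \<in> L2 M" for f :: "'a \<Rightarrow> real"
    using L2_integrable[OF that] by (simp add: nn_integral_eq_integral norm_L2_def)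
  have "(\<integral>\<^sup>+x. ennreal (u x * v x) \<partial>M) = ennreal (ip M u v)"
    unfolding ip_def using L2_integrable_mult[OF L] nn by (intro nn_integral_eq_integral) auto
  also have "\<dots> \<le> ennreal (norm_L2 M u * norm_L2 M v)"
    using ip_bound[OF L] by (intro ennreal_leI) simp
  finally have "(\<integral>\<^sup>+x. ennreal (u x * v x) \<partial>M)\<^sup>2 \<le> (ennreal (norm_L2 M u * norm_L2 M v))\<^sup>2"
    by (intro power_mono) auto
  also have "\<dots> = ennreal ((norm_L2 M u)\<^sup>2) * ennreal ((norm_L2 M v)\<^sup>2)"
    by (simp add: ennreal_power ennreal_mult[symmetric] power_mult_distrib norm_L2_nonneg)
  finally show ?thesis by (simp add: n L)
qed

text \<open>Minkowski's inequality with a power weight split between the two Cauchy-Schwarz factors.\<close>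

lemma weighted_time_integral_L2:
  fixes F :: "real \<Rightarrow> 'a::euclidean_space \<Rightarrow> real"
  assumes F[measurable]: "(\<lambda>(t, q). F t q) \<in> borel_measurable (lborel \<Otimes>\<^sub>M lborel)"
    and S[measurable]: "S \<in> sets borel" and S0: "S \<subseteq> {0<..}"
    and bound: "\<And>t. t \<in> S \<Longrightarrow> (\<integral>\<^sup>+q. ennreal ((F t q)\<^sup>2) \<partial>lborel) \<le> ennreal (B * t powr (- \<beta>))"
    and B: "0 \<le> B"
    and wa: "(\<integral>\<^sup>+t. indicator S t * ennreal (t powr a) \<partial>lborel) < \<infinity>"
    and wb: "(\<integral>\<^sup>+t. indicator S t * ennreal (t powr (b - \<beta>)) \<partial>lborel) < \<infinity>"
    and ab: "a + b = 2 * \<gamma>"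
  shows "(\<integral>\<^sup>+q. (\<integral>\<^sup>+t. indicator S t * ennreal (t powr \<gamma> * \<bar>F t q\<bar>) \<partial>lborel)\<^sup>2 \<partial>lborel) < \<infinity>"
proof -
  have [measurable]: "(\<lambda>p. F (snd p) (fst p)) \<in> borel_measurable (lborel \<Otimes>\<^sub>M lborel)"
    using measurable_compose[OF measurable_pair_swap' F] by (simp add: split_beta')
  have Fq[measurable]: "(\<lambda>t. F t q) \<in> borel_measurable borel" for q
    using measurable_Pair1[OF F, of q] by simp
  have Ft[measurable]: "F t \<in> borel_measurable borel" for t
    using measurable_Pair2[OF F, of t] by simp
  \<comment> \<open>The weight \<open>t powr \<gamma>\<close> is split into
    \<open>t powr (a / 2)\<close> and \<open>t powr (b / 2)\<close>: \<open>u\<close> is a pure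
    power, and \<open>v\<close> carries the function.\<close>
  define u where "u t = indicator S t * t powr (a / 2)" for t :: real
  define v where "v q t = indicator S t * (t powr (b / 2) * \<bar>F t q\<bar>)" for q t
  have [measurable]: "u \<in> borel_measurable borel" "v q \<in> borel_measurable borel" for q
    unfolding u_def[abs_def] v_def[abs_def] by measurable
  have u2: "ennreal ((u t)\<^sup>2) = indicator S t * ennreal (t powr a)" for t
    using S0 by (auto simp: u_def indicator_def power2_eq_square powr_add[symmetric])
  have v2: "ennreal ((v q t)\<^sup>2) = indicator S t * ennreal (t powr b) * ennreal ((F t q)\<^sup>2)" for q t
  proof (cases "t \<in> S")
    case True
    have "(t powr (b / 2))\<^sup>2 = t powr b"
      by (simp add: power2_eq_square powr_add[symmetric])
    then show ?thesis using True by (simp add: v_def power_mult_distrib ennreal_mult)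
  qed (simp add: v_def)
  have uv: "ennreal (u t * v q t) = indicator S t * ennreal (t powr \<gamma> * \<bar>F t q\<bar>)" for q t
  proof (cases "t \<in> S")
    case True
    have "t powr (a / 2) * t powr (b / 2) = t powr \<gamma>"
      using ab by (simp add: powr_add[symmetric] add_divide_distrib[symmetric])
    then show ?thesis using True by (simp add: u_def v_def mult.assoc[symmetric])
  qed (simp add: u_def v_def)
  define A where "A = (\<integral>\<^sup>+t. ennreal ((u t)\<^sup>2) \<partial>lborel)"
  have A: "A < \<infinity>" using wa by (simp add: A_def u2)
  \<comment> \<open>Tonelli puts the space integral inside, where the slice bound
    \<open>bound\<close> applies.\<close>
  have "(\<integral>\<^sup>+q. \<integral>\<^sup>+t. ennreal ((v q t)\<^sup>2) \<partial>lborel \<partial>lborel) = (\<integral>\<^sup>+t. \<integral>\<^sup>+q. ennreal ((v q t)\<^sup>2) \<partial>lborel \<partial>lborel)"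
    unfolding v2 by (intro lborel_pair.Fubini') measurable
  also have "\<dots> = (\<integral>\<^sup>+t. indicator S t * ennreal (t powr b) * (\<integral>\<^sup>+q. ennreal ((F t q)\<^sup>2) \<partial>lborel) \<partial>lborel)"
    unfolding v2 by (subst nn_integral_cmult) simp_all
  also have "\<dots> \<le> (\<integral>\<^sup>+t. ennreal B * (indicator S t * ennreal (t powr (b - \<beta>))) \<partial>lborel)"
  proof (intro nn_integral_mono)
    fix t
    show "indicator S t * ennreal (t powr b) * (\<integral>\<^sup>+q. ennreal ((F t q)\<^sup>2) \<partial>lborel)
        \<le> ennreal B * (indicator S t * ennreal (t powr (b - \<beta>)))"
    proof (cases "t \<in> S")
      case True
      then have "ennreal (t powr b) * (\<integral>\<^sup>+q. ennreal ((F t q)\<^sup>2) \<partial>lborel) \<le> ennreal (t powr b) * ennreal (B * t powr (- \<beta>))"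
        by (intro mult_left_mono bound) simp_all
      also have "\<dots> = ennreal (B * t powr (b - \<beta>))"
        using B by (simp add: ennreal_mult[symmetric] powr_add[symmetric] mult.left_commute)
      finally show ?thesis using True B by (simp add: ennreal_mult)
    qed simp
  qed
  also have "\<dots> = ennreal B * (\<integral>\<^sup>+t. indicator S t * ennreal (t powr (b - \<beta>)) \<partial>lborel)"
    by (rule nn_integral_cmult) measurable
  also have "\<dots> < \<infinity>" using wb by (simp add: ennreal_mult_less_top)
  finally have V: "(\<integral>\<^sup>+q. \<integral>\<^sup>+t. ennreal ((v q t)\<^sup>2) \<partial>lborel \<partial>lborel) < \<infinity>" .
  have mV: "(\<lambda>q. \<integral>\<^sup>+t. ennreal ((v q t)\<^sup>2) \<partial>lborel) \<in> borel_measurable lborel"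
    unfolding v2 by measurable
  have "AE q in lborel. (\<integral>\<^sup>+t. ennreal ((v q t)\<^sup>2) \<partial>lborel) \<noteq> \<infinity>"
    by (rule nn_integral_PInf_AE[OF mV]) (use V in auto)
  then have "AE q in lborel. (\<integral>\<^sup>+t. indicator S t * ennreal (t powr \<gamma> * \<bar>F t q\<bar>) \<partial>lborel)\<^sup>2
      \<le> A * (\<integral>\<^sup>+t. ennreal ((v q t)\<^sup>2) \<partial>lborel)"
  proof eventually_elim
    case (elim q)
    have "(\<integral>\<^sup>+t. ennreal (u t * v q t) \<partial>lborel)\<^sup>2 \<le> (\<integral>\<^sup>+t. ennreal ((u t)\<^sup>2) \<partial>lborel) * (\<integral>\<^sup>+t. ennreal ((v q t)\<^sup>2) \<partial>lborel)"
      by (rule nn_integral_Cauchy_Schwarz)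
        (use A elim in \<open>auto simp: A_def top.not_eq_extremum u_def v_def\<close>)
    then show ?case by (simp add: uv A_def)
  qed
  then have "(\<integral>\<^sup>+q. (\<integral>\<^sup>+t. indicator S t * ennreal (t powr \<gamma> * \<bar>F t q\<bar>) \<partial>lborel)\<^sup>2 \<partial>lborel)
      \<le> (\<integral>\<^sup>+q. A * (\<integral>\<^sup>+t. ennreal ((v q t)\<^sup>2) \<partial>lborel) \<partial>lborel)"
    by (rule nn_integral_mono_AE)
  also have "\<dots> = A * (\<integral>\<^sup>+q. \<integral>\<^sup>+t. ennreal ((v q t)\<^sup>2) \<partial>lborel \<partial>lborel)"
    by (rule nn_integral_cmult[OF mV])
  also have "\<dots> < \<infinity>" using A V by (simp add: ennreal_mult_less_top)
  finally show ?thesis .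
qed

lemma nn_integral_powr_0:
  fixes a :: real
  assumes "-1 < a"
  shows "(\<integral>\<^sup>+t. indicator {0<..1} t * ennreal (t powr a) \<partial>lborel) < \<infinity>"
proof -
  have "(\<integral>\<^sup>+t. indicator {0<..1} t * ennreal (t powr a) \<partial>lborel)
      \<le> (\<integral>\<^sup>+t. ennreal (indicator {0..1} t * t powr a) \<partial>lborel)"
    by (intro nn_integral_mono) (auto simp: indicator_def)
  also have "\<dots> = ennreal (1 powr (a + 1) / (a + 1))"
    by (rule nn_integral_has_integral_lebesgue) (use assms has_integral_powr_from_0[of a 1] in auto)
  also have "\<dots> < \<infinity>" by simp
  finally show ?thesis .
qed

lemma nn_integral_powr_inf:
  fixes a :: real
  assumes "a < -1"
  shows "(\<integral>\<^sup>+t. indicator {1<..} t * ennreal (t powr a) \<partial>lborel) < \<infinity>"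
proof -
  have "(\<integral>\<^sup>+t. indicator {1<..} t * ennreal (t powr a) \<partial>lborel)
      \<le> (\<integral>\<^sup>+t. ennreal (indicator {1..} t * t powr a) \<partial>lborel)"
    by (intro nn_integral_mono) (auto simp: indicator_def)
  also have "\<dots> = ennreal (- (1 powr (a + 1)) / (a + 1))"
    by (rule nn_integral_has_integral_lebesgue) (use assms has_integral_powr_to_inf[of a 1] in auto)
  also have "\<dots> < \<infinity>" by simp
  finally show ?thesis .
qed

lemma ennreal_power2_sum3_le: "(a + b + c)\<^sup>2 \<le> 9 * (a\<^sup>2 + b\<^sup>2 + (c :: ennreal)\<^sup>2)"
proof -
  define m where "m = max a (max b c)"
  have "a + b + c \<le> m + m + m"
    by (intro add_mono) (simp_all add: m_def le_max_iff_disj)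
  also have "\<dots> = 3 * m"
  proof -
    have "(3 :: ennreal) = 1 + 1 + 1" by simp
    then show ?thesis by (simp only: distrib_right mult_1_left)
  qed
  finally have "(a + b + c)\<^sup>2 \<le> (3 * m)\<^sup>2" by (intro power_mono) auto
  also have "\<dots> = 9 * m\<^sup>2" by (simp add: power_mult_distrib)
  also have "m\<^sup>2 \<le> a\<^sup>2 + b\<^sup>2 + c\<^sup>2"
    by (auto simp: m_def max_def add_increasing add_increasing2)
  finally show ?thesis by (simp add: mult_left_mono)
qed

section \<open>Short-time and long-time estimates for the kernel\<close>

context heat_kernel
begin

text \<open>Nothing is known of \<open>h t\<close> for \<open>t \<le> 0\<close>; the cut-off gives a
  jointly measurable function on all of time and space.\<close>

definition H :: "real \<Rightarrow> 'n heis \<Rightarrow> real" where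
  "H t q = indicator {0<..} t * h t q"

lemma H_measurable [measurable]:
  assumes [measurable]: "f \<in> borel_measurable N" "g \<in> borel_measurable N"
  shows "(\<lambda>x. H (f x) (g x)) \<in> borel_measurable N"
proof -
  have "(\<lambda>p. indicator ({0<..} \<times> UNIV) p *\<^sub>R (case p of (t, q) \<Rightarrow> h t q)) \<in> borel_measurable borel"
    by (intro borel_measurable_continuous_on_indicator cont borel_open open_Times) auto
  also have "(\<lambda>p. indicator ({0<..} \<times> UNIV) p *\<^sub>R (case p of (t, q) \<Rightarrow> h t q)) = (\<lambda>p. H (fst p) (snd p))"
    by (auto simp: H_def indicator_def fun_eq_iff)
  finally have "(\<lambda>p. H (fst p) (snd p)) \<in> borel_measurable (borel \<Otimes>\<^sub>M borel)"
    by (simp add: borel_prod)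
  from measurable_compose[OF _ this, of "\<lambda>x. (f x, g x)" N] show ?thesis by simp
qed

lemma nn_norm_L2: "f \<in> L2 lborel \<Longrightarrow> (\<integral>\<^sup>+q. ennreal ((f q)\<^sup>2) \<partial>lborel) = ennreal ((norm_L2 lborel f)\<^sup>2)"
  for f :: "'n heis \<Rightarrow> real"
  using L2_integrable[of f lborel] by (simp add: nn_integral_eq_integral norm_L2_def)

lemma short_time_L2:
  assumes \<alpha>: "real CARD('n) / 2 + 1 / 2 < \<alpha>"
  shows "(\<integral>\<^sup>+q. (\<integral>\<^sup>+t. indicator {0<..1} t * ennreal (t powr (\<alpha> - 1) * \<bar>H t q\<bar>) \<partial>lborel)\<^sup>2 \<partial>lborel) < \<infinity>"
proof -
  \<comment> \<open>The distance of \<open>\<alpha>\<close> from its lower limit. The slices have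
    decay exponent n + 1, and the weight is split so that both power integrals on
    \<open>{0<..1}\<close> have exponent \<open>-1 + e\<close>.\<close>
  define e where "e = \<alpha> - (real CARD('n) + 1) / 2"
  have e: "0 < e" using \<alpha> by (simp add: e_def add_divide_distrib)
  show ?thesis
  proof (rule weighted_time_integral_L2)
    show "(\<lambda>(t, q). H t q) \<in> borel_measurable (lborel \<Otimes>\<^sub>M lborel)"
      unfolding split_beta by measurable
    show "(\<integral>\<^sup>+t. indicator {0<..1} t * ennreal (t powr (-1 + e)) \<partial>lborel) < \<infinity>"
      by (rule nn_integral_powr_0) (use e in simp)
    show "(\<integral>\<^sup>+t. indicator {0<..1} t * ennreal (t powr ((2 * \<alpha> - 1 - e) - (real CARD('n) + 1))) \<partial>lborel) < \<infinity>"
      by (rule nn_integral_powr_0) (use e in \<open>simp add: e_def field_simps\<close>)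
    show "-1 + e + (2 * \<alpha> - 1 - e) = 2 * (\<alpha> - 1)" by simp
    show "0 \<le> h 1 heis_e * 2 powr (- (real CARD('n) + 1))"
      using h_e_nonneg[of 1] by simp
    fix t :: real assume "t \<in> {0<..1}"
    then have t: "0 < t" by simp
    have "H t = h t" using t by (auto simp: H_def)
    then have "(\<integral>\<^sup>+q. ennreal ((H t q)\<^sup>2) \<partial>lborel) = ennreal ((norm_L2 lborel (h t))\<^sup>2)"
      by (simp add: nn_norm_L2[OF h_L2(1)[OF t]])
    also have "\<dots> \<le> ennreal ((sqrt (h (2 * t) heis_e))\<^sup>2)"
      by (intro ennreal_leI power_mono h_L2(2) t norm_L2_nonneg)
    also have "(sqrt (h (2 * t) heis_e))\<^sup>2 = h (2 * t) heis_e"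
      using h_e_nonneg[of "2 * t"] t by simp
    also have "\<dots> = h 1 heis_e * 2 powr (- (real CARD('n) + 1)) * t powr (- (real CARD('n) + 1))"
      using h_scaling[of "2 * t"] t by (simp only: powr_mult mult.assoc)
    finally show "(\<integral>\<^sup>+q. ennreal ((H t q)\<^sup>2) \<partial>lborel)
      \<le> ennreal (h 1 heis_e * 2 powr (- (real CARD('n) + 1)) * t powr (- (real CARD('n) + 1)))" .
  qed auto
qed

lemma long_time_L2:
  fixes x :: "'n heis"
  assumes \<alpha>: "\<alpha> < real CARD('n) / 2 + 1"
  shows "(\<integral>\<^sup>+q. (\<integral>\<^sup>+t. indicator {1<..} t * ennreal (t powr (\<alpha> - 1) * \<bar>H t (heis_inv x \<star> q) - H t q\<bar>) \<partial>lborel)\<^sup>2 \<partial>lborel) < \<infinity>"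
proof -
  \<comment> \<open>The distance of \<open>\<alpha>\<close> from its upper limit. The slices have
    decay exponent n + 2, one more than \<open>h t heis_e\<close>, through the factor
    \<open>1 / t\<close> of \<open>h_translation\<close>; both power integrals on
    \<open>{1<..}\<close> get the exponent \<open>-1 - e\<close>.\<close>
  define e where "e = (real CARD('n) + 2) / 2 - \<alpha>"
  have e: "0 < e" using \<alpha> by (simp add: e_def add_divide_distrib)
  obtain C where C: "C \<ge> 0" "\<And>t. 0 < t \<Longrightarrow>
      norm_L2 lborel (\<lambda>q. h t (heis_inv x \<star> q) - h t q) \<le> C * sqrt (h t heis_e / t)"
    using h_translation[of x] by blast
  show ?thesis
  proof (rule weighted_time_integral_L2)
    show "(\<lambda>(t, q). H t (heis_inv x \<star> q) - H t q) \<in> borel_measurable (lborel \<Otimes>\<^sub>M lborel)"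
      unfolding split_beta by measurable
    show "(\<integral>\<^sup>+t. indicator {1<..} t * ennreal (t powr (-1 - e)) \<partial>lborel) < \<infinity>"
      by (rule nn_integral_powr_inf) (use e in simp)
    show "(\<integral>\<^sup>+t. indicator {1<..} t * ennreal (t powr ((2 * \<alpha> - 1 + e) - (real CARD('n) + 2))) \<partial>lborel) < \<infinity>"
      by (rule nn_integral_powr_inf) (use e in \<open>simp add: e_def field_simps\<close>)
    show "-1 - e + (2 * \<alpha> - 1 + e) = 2 * (\<alpha> - 1)" by simp
    show "0 \<le> C\<^sup>2 * h 1 heis_e"
      using h_e_nonneg[of 1] by simp
    fix t :: real assume "t \<in> {1<..}"
    then have t: "0 < t" by simp
    have Ht: "H t = h t" using t by (auto simp: H_def)
    have L: "(\<lambda>q. h t (heis_inv x \<star> q) - h t q) \<in> L2 lborel"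
      by (intro L2_diff L2_preserving[OF distr_heis_mult_left] h_L2 t) simp
    have "(\<integral>\<^sup>+q. ennreal ((H t (heis_inv x \<star> q) - H t q)\<^sup>2) \<partial>lborel)
        = ennreal ((norm_L2 lborel (\<lambda>q. h t (heis_inv x \<star> q) - h t q))\<^sup>2)"
      by (simp add: nn_norm_L2[OF L] Ht)
    also have "\<dots> \<le> ennreal ((C * sqrt (h t heis_e / t))\<^sup>2)"
      by (intro ennreal_leI power_mono C t norm_L2_nonneg)
    also have "(C * sqrt (h t heis_e / t))\<^sup>2 = C\<^sup>2 * (h t heis_e / t)"
      using h_e_nonneg[OF t] t by (simp add: power_mult_distrib)
    also have "h t heis_e / t = h 1 heis_e * t powr (- (real CARD('n) + 2))"
    proof -
      have "t powr (- (real CARD('n) + 2)) = t powr (- (real CARD('n) + 1)) * t powr (- 1)"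
        unfolding powr_add[symmetric] by (rule arg_cong[where f = "(powr) t"]) simp
      also have "t powr (- 1) = 1 / t" using t by (simp add: powr_minus_divide)
      finally show ?thesis by (simp only: h_scaling[OF t] times_divide_eq_right mult_1_right)
    qed
    finally show "(\<integral>\<^sup>+q. ennreal ((H t (heis_inv x \<star> q) - H t q)\<^sup>2) \<partial>lborel)
      \<le> ennreal (C\<^sup>2 * h 1 heis_e * t powr (- (real CARD('n) + 2)))"
      by (simp add: mult.assoc)
  qed auto
qed

text \<open>A difference of two Bochner integrals is the integral of the difference only where both
  converge, so convergence is secured first, almost everywhere. The difference is then dominated by
  \<open>J (heis_inv x \<star> q) + J q + D q\<close>, whose terms are square integrable by the two
  estimates above.\<close>

lemma G_kernel_difference_L2:
  fixes x :: "'n heis"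
  assumes \<alpha>: "real CARD('n) / 2 + 1 / 2 < \<alpha>" "\<alpha> < real CARD('n) / 2 + 1"
  shows "(\<lambda>q. G_kernel h \<alpha> x q - G_kernel h \<alpha> heis_e q) \<in> L2 lborel"
proof -
  define g where "g p = (\<integral>t. t powr (\<alpha> - 1) * H t p \<partial>lborel)" for p
  define J where "J p = (\<integral>\<^sup>+t. indicator {0<..1} t * ennreal (t powr (\<alpha> - 1) * \<bar>H t p\<bar>) \<partial>lborel)" for p
  define D where "D q = (\<integral>\<^sup>+t. indicator {1<..} t * ennreal (t powr (\<alpha> - 1) * \<bar>H t (heis_inv x \<star> q) - H t q\<bar>) \<partial>lborel)" for q
  have G: "G_kernel h \<alpha> y q = 1 / Gamma \<alpha> * g (heis_inv y \<star> q)" for y q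
    unfolding G_kernel_def g_def set_lebesgue_integral_def H_def
    by (rule arg_cong[where f = "\<lambda>I. 1 / Gamma \<alpha> * I"], rule Bochner_Integration.integral_cong) auto
  have J2: "(\<integral>\<^sup>+q. (J q)\<^sup>2 \<partial>lborel) < \<infinity>" unfolding J_def by (rule short_time_L2[OF \<alpha>(1)])
  have D2: "(\<integral>\<^sup>+q. (D q)\<^sup>2 \<partial>lborel) < \<infinity>" unfolding D_def by (rule long_time_L2[OF \<alpha>(2)])
  have [measurable]: "J \<in> borel_measurable borel" "D \<in> borel_measurable borel" "g \<in> borel_measurable borel"
    unfolding J_def[abs_def] D_def[abs_def] g_def[abs_def] by measurable
  let ?\<tau> = "\<lambda>q. heis_inv x \<star> q"
  have J2x: "(\<integral>\<^sup>+q. (J (?\<tau> q))\<^sup>2 \<partial>lborel) = (\<integral>\<^sup>+q. (J q)\<^sup>2 \<partial>lborel)"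
    by (rule nn_integral_preserving[OF distr_heis_mult_left, where f = "\<lambda>q. (J q)\<^sup>2"]) simp_all
  \<comment> \<open>Only short times can obstruct integrability: for \<open>t > 1\<close>,
    \<open>h_bound\<close> and \<open>h_scaling\<close> give a bound of order t^-(n+1) at every
    point, and \<alpha> lies below n + 1.\<close>
  have int: "integrable lborel (\<lambda>t. t powr (\<alpha> - 1) * H t p)" if fin: "J p < \<infinity>" for p
  proof (rule integrableI_bounded)
    have exponent: "\<alpha> - 1 + (- (real CARD('n) + 1)) < -1"
      using \<alpha>(2) by (simp add: field_simps)
    have pt: "ennreal (norm (t powr (\<alpha> - 1) * H t p))
        \<le> indicator {0<..1} t * ennreal (t powr (\<alpha> - 1) * \<bar>H t p\<bar>)
          + ennreal (h 1 heis_e) * (indicator {1<..} t * ennreal (t powr (\<alpha> - 1 + (- (real CARD('n) + 1)))))" for t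
    proof -
      consider "t \<le> 0" | "0 < t" "t \<le> 1" | "1 < t" by linarith
      then show ?thesis
      proof cases
        case 3
        then have "\<bar>H t p\<bar> \<le> h 1 heis_e * t powr (- (real CARD('n) + 1))"
          using h_bound[of t p] h_scaling[of t] by (simp add: H_def)
        then have "t powr (\<alpha> - 1) * \<bar>H t p\<bar> \<le> t powr (\<alpha> - 1) * (h 1 heis_e * t powr (- (real CARD('n) + 1)))"
          by (rule mult_left_mono) simp
        also have "\<dots> = h 1 heis_e * t powr (\<alpha> - 1 + (- (real CARD('n) + 1)))"
          by (simp only: powr_add mult.left_commute)
        finally have "ennreal (t powr (\<alpha> - 1) * \<bar>H t p\<bar>) \<le> ennreal (h 1 heis_e * t powr (\<alpha> - 1 + (- (real CARD('n) + 1))))"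
          by (rule ennreal_leI)
        then show ?thesis using 3 h_e_nonneg[of 1] by (simp add: abs_mult ennreal_mult)
      qed (simp_all add: H_def abs_mult)
    qed
    have "(\<integral>\<^sup>+t. ennreal (norm (t powr (\<alpha> - 1) * H t p)) \<partial>lborel)
        \<le> (\<integral>\<^sup>+t. indicator {0<..1} t * ennreal (t powr (\<alpha> - 1) * \<bar>H t p\<bar>)
          + ennreal (h 1 heis_e) * (indicator {1<..} t * ennreal (t powr (\<alpha> - 1 + (- (real CARD('n) + 1))))) \<partial>lborel)"
      by (intro nn_integral_mono pt)
    also have "\<dots> = J p + ennreal (h 1 heis_e) * (\<integral>\<^sup>+t. indicator {1<..} t * ennreal (t powr (\<alpha> - 1 + (- (real CARD('n) + 1)))) \<partial>lborel)"
      unfolding J_def by (subst nn_integral_add, measurable, subst nn_integral_cmult, measurable)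
    also have "\<dots> < \<infinity>"
      using fin nn_integral_powr_inf[OF exponent] by (simp add: ennreal_mult_less_top)
    finally show "(\<integral>\<^sup>+t. ennreal (norm (t powr (\<alpha> - 1) * H t p)) \<partial>lborel) < \<infinity>" .
  qed measurable
  have "AE q in lborel. (J q)\<^sup>2 \<noteq> \<infinity>"
    by (rule nn_integral_PInf_AE) (use J2 in auto)
  then have Jfin: "AE q in lborel. J q < \<infinity>"
    by eventually_elim (auto simp: power2_eq_square ennreal_mult_eq_top_iff less_top)
  have Jxfin: "AE q in lborel. J (?\<tau> q) < \<infinity>"
    by (rule AE_preserving[OF distr_heis_mult_left _ Jfin]) simp
  \<comment> \<open>For \<open>t \<le> 1\<close> the two kernels are estimated separately by the
    triangle inequality; the cancellation between them is kept for \<open>t > 1\<close>.\<close>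
  have "AE q in lborel. ennreal ((g (?\<tau> q) - g q)\<^sup>2) \<le> 9 * ((J (?\<tau> q))\<^sup>2 + (J q)\<^sup>2 + (D q)\<^sup>2)"
    using Jfin Jxfin
  proof eventually_elim
    case (elim q)
    let ?f = "\<lambda>t. t powr (\<alpha> - 1) * H t (?\<tau> q) - t powr (\<alpha> - 1) * H t q"
    have pt: "ennreal (norm (?f t)) \<le> (indicator {0<..1} t * ennreal (t powr (\<alpha> - 1) * \<bar>H t (?\<tau> q)\<bar>)
        + indicator {0<..1} t * ennreal (t powr (\<alpha> - 1) * \<bar>H t q\<bar>))
        + indicator {1<..} t * ennreal (t powr (\<alpha> - 1) * \<bar>H t (?\<tau> q) - H t q\<bar>)" for t
    proof -
      have n: "norm (?f t) = t powr (\<alpha> - 1) * \<bar>H t (?\<tau> q) - H t q\<bar>"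
        by (simp add: right_diff_distrib[symmetric] abs_mult)
      consider "t \<le> 0" | "0 < t" "t \<le> 1" | "1 < t" by linarith
      then show ?thesis
      proof cases
        case 1
        then show ?thesis unfolding n by (simp add: H_def)
      next
        case 2
        have "t powr (\<alpha> - 1) * \<bar>H t (?\<tau> q) - H t q\<bar> \<le> t powr (\<alpha> - 1) * (\<bar>H t (?\<tau> q)\<bar> + \<bar>H t q\<bar>)"
          by (intro mult_left_mono abs_triangle_ineq4) simp
        then have "ennreal (norm (?f t)) \<le> ennreal (t powr (\<alpha> - 1) * \<bar>H t (?\<tau> q)\<bar> + t powr (\<alpha> - 1) * \<bar>H t q\<bar>)"
          unfolding n by (intro ennreal_leI) (simp add: distrib_left)
        then show ?thesis using 2 by simp
      next
        case 3
        then show ?thesis unfolding n by simp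
      qed
    qed
    have "g (?\<tau> q) - g q = (\<integral>t. ?f t \<partial>lborel)"
      unfolding g_def using int[OF elim(1)] int[OF elim(2)] by simp
    then have "ennreal \<bar>g (?\<tau> q) - g q\<bar> \<le> (\<integral>\<^sup>+t. ennreal (norm (?f t)) \<partial>lborel)"
      using integral_norm_bound_ennreal[of lborel ?f] int[OF elim(1)] int[OF elim(2)] by simp
    also have "\<dots> \<le> (\<integral>\<^sup>+t. (indicator {0<..1} t * ennreal (t powr (\<alpha> - 1) * \<bar>H t (?\<tau> q)\<bar>)
        + indicator {0<..1} t * ennreal (t powr (\<alpha> - 1) * \<bar>H t q\<bar>))
        + indicator {1<..} t * ennreal (t powr (\<alpha> - 1) * \<bar>H t (?\<tau> q) - H t q\<bar>) \<partial>lborel)"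
      by (intro nn_integral_mono pt)
    also have "\<dots> = J (?\<tau> q) + J q + D q"
      unfolding J_def D_def by (subst nn_integral_add, measurable, subst nn_integral_add, measurable)
    finally have "(ennreal \<bar>g (?\<tau> q) - g q\<bar>)\<^sup>2 \<le> (J (?\<tau> q) + J q + D q)\<^sup>2"
      by (intro power_mono) auto
    also have "\<dots> \<le> 9 * ((J (?\<tau> q))\<^sup>2 + (J q)\<^sup>2 + (D q)\<^sup>2)"
      by (rule ennreal_power2_sum3_le)
    finally show ?case by (simp add: ennreal_power)
  qed
  then have "(\<integral>\<^sup>+q. ennreal ((g (?\<tau> q) - g q)\<^sup>2) \<partial>lborel)
      \<le> (\<integral>\<^sup>+q. 9 * ((J (?\<tau> q))\<^sup>2 + (J q)\<^sup>2 + (D q)\<^sup>2) \<partial>lborel)"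
    by (rule nn_integral_mono_AE)
  also have "\<dots> = 9 * ((\<integral>\<^sup>+q. (J (?\<tau> q))\<^sup>2 \<partial>lborel) + (\<integral>\<^sup>+q. (J q)\<^sup>2 \<partial>lborel) + (\<integral>\<^sup>+q. (D q)\<^sup>2 \<partial>lborel))"
    by (simp add: nn_integral_cmult nn_integral_add)
  also have "\<dots> < \<infinity>"
    using J2 D2 unfolding J2x by (simp add: ennreal_mult_less_top)
  finally have "(\<integral>\<^sup>+q. ennreal ((g (?\<tau> q) - g q)\<^sup>2) \<partial>lborel) < \<infinity>" .
  then have gL: "(\<lambda>q. g (?\<tau> q) - g q) \<in> L2 lborel"
    by (auto simp: L2_def intro!: integrableI_bounded)
  have "heis_inv heis_e \<star> q = q" for q :: "'n heis"
    by (cases q) (simp add: heis_e_def)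
  then have eq: "(\<lambda>q. G_kernel h \<alpha> x q - G_kernel h \<alpha> heis_e q) = (\<lambda>q. 1 / Gamma \<alpha> * (g (?\<tau> q) - g q))"
    unfolding G by (simp add: right_diff_distrib)
  show ?thesis unfolding eq by (rule L2_cmult[OF gL])
qed

end

section \<open>The process\<close>

text \<open>Time and space separate in the integrand, and the time factor contributes at most the
  finite length of \<open>{0..t}\<close>.\<close>

lemma time_heis_L2:
  fixes g :: "'n::finite heis \<Rightarrow> real"
  assumes g: "g \<in> L2 lborel"
  shows "(\<lambda>(r, q). indicator {0..t} r * g q) \<in> L2 time_heis"
proof -
  have [measurable]: "g \<in> borel_measurable borel" using L2_measurable[OF g] by simp
  have i: "indicator {0..t} \<in> borel_measurable (restrict_space lborel {0..} :: real measure)"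
    by (rule measurable_restrict_space1) simp
  have m[measurable]: "(\<lambda>(r, q). indicator {0..t} r * g q) \<in> borel_measurable time_heis"
    unfolding time_heis_def split_beta
    by (intro borel_measurable_times measurable_compose[OF measurable_fst i] measurable_compose[OF measurable_snd]) simp
  have c: "(\<integral>\<^sup>+q. ennreal ((g q)\<^sup>2) \<partial>lborel) < \<infinity>"
    using g by (simp add: L2_def nn_integral_eq_integral)
  have "(\<integral>\<^sup>+p. ennreal ((case p of (r, q) \<Rightarrow> indicator {0..t} r * g q)\<^sup>2) \<partial>time_heis)
      = (\<integral>\<^sup>+r. \<integral>\<^sup>+q. ennreal ((indicator {0..t} r * g q)\<^sup>2) \<partial>lborel \<partial>restrict_space lborel {0..})"
    using m unfolding time_heis_def by (subst lborel.nn_integral_fst[symmetric]) simp_all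
  also have "\<dots> = (\<integral>\<^sup>+r. indicator {0..t} r * (\<integral>\<^sup>+q. ennreal ((g q)\<^sup>2) \<partial>lborel) \<partial>restrict_space lborel {0..})"
    by (intro nn_integral_cong) (auto simp: indicator_def)
  also have "\<dots> \<le> (\<integral>\<^sup>+r. indicator {0..t} r * (\<integral>\<^sup>+q. ennreal ((g q)\<^sup>2) \<partial>lborel) \<partial>lborel)"
    by (subst nn_integral_restrict_space) (auto intro!: nn_integral_mono simp: indicator_def)
  also have "\<dots> = emeasure lborel {0..t} * (\<integral>\<^sup>+q. ennreal ((g q)\<^sup>2) \<partial>lborel)"
    by (simp add: nn_integral_multc)
  also have "\<dots> < \<infinity>"
    using c by (simp add: ennreal_mult_less_top emeasure_lborel_Icc_eq)
  finally show ?thesis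
    using m by (auto simp: L2_def intro!: integrableI_bounded)
qed

theorem proposition3p12:
  fixes \<alpha> :: real
    and h :: "real \<Rightarrow> 'n::finite heis \<Rightarrow> real"
    and M :: "'w measure"
    and W :: "(real \<times> 'n heis \<Rightarrow> real) \<Rightarrow> 'w \<Rightarrow> real"
  assumes "real CARD('n) / 2 + 1 / 2 < \<alpha>" and "\<alpha> < real CARD('n) / 2 + 1"
    and "is_heat_kernel h"
    and "white_noise M W"
  shows "\<forall>t\<ge>0. \<forall>x. W_integrand h \<alpha> t x \<in> L2 time_heis
                   \<and> centered_gaussian M (W_process W h \<alpha> t x)"
proof (intro allI impI conjI)
  fix t :: real and x :: "'n heis"
  obtain T where "heat_kernel h T"
    using assms(3) unfolding is_heat_kernel_def heat_kernel_def by blast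
  then interpret heat_kernel h T .
  show W_L2: "W_integrand h \<alpha> t x \<in> L2 time_heis"
    unfolding W_integrand_def by (rule time_heis_L2[OF G_kernel_difference_L2[OF assms(1,2)]])
  have "centered_gaussian_family M (L2 time_heis) W"
    using assms(4) by (simp add: white_noise_def)
  \<comment> \<open>One variable of the family is the combination over a singleton with coefficient
    1; the membership just proved makes this singleton an admissible index set.\<close>
  from this[unfolded centered_gaussian_family_def, rule_format, of "{W_integrand h \<alpha> t x}" "\<lambda>_. 1"] W_L2
  show "centered_gaussian M (W_process W h \<alpha> t x)"
    by (simp add: W_process_def)
qed

end
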